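(* Let $G$ be a finite group, and suppose $\chi$ is a nonlinear irreducible complex character of $G$. Then the following properties are equivalent: (1) There exists $g \in G \setminus Z(G)$ such that $\chi$ vanishes on all noncentral conjugacy classes of $G$ except $g^G$ (that is, $\chi(g)\neq 0$ and $\chi(x)=0$ for all $x\in G\setminus (Z(G)\cup g^G)$). (2) We have $Z(G) \le \ker\chi$, and there exists a noncentral element $g$ of $G$ such that, for every character $\psi \in \mathrm{Irr}(G)$ with $\psi \ne \chi$, either $g \in \ker\psi$ when $\psi \in \mathrm{Irr}(G/Z(G))$, or otherwise (when $\psi\notin\mathrm{Irr}(G/Z(G))$) $\psi(g) = 0$. Furthermore, if the equivalent properties (1) and (2) hold, then we have $Z(G) = \ker\chi < G'$ (proper containment), the value $\chi(g)$ is $-|Z(G)|\,\chi(1)/|g^G| \in \mathbb{Z}$, and $|C_G(g)| = |C_{G/Z(G)}(gZ(G))|$ is a $p$-power for a suitable prime $p$. In particular, $Z(G)$ is a $p$-group. Finally, $G/Z(G)$ has a unique minimal normal subgroup $M/Z(G)$, and $M \setminus Z(G)$ is a conjugacy class of $G$.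
   Context: All groups are finite and characters are complex. $Z(G)$ is the center, $G'$ the derived subgroup, $g^G$ the conjugacy class of $g$ in $G$, and $C_G(g)$ the centralizer. $\mathrm{Irr}(G)$ is the set of irreducible complex characters of $G$; $\mathrm{Irr}(G/Z(G))$ is identified by inflation with the set of characters in $\mathrm{Irr}(G)$ whose kernel contains $Z(G)$. A character is nonlinear if its degree is greater than $1$. A conjugacy class is noncentral if it is not contained in $Z(G)$. *)

theory Defs
  imports
    "HOL-Algebra.Algebra"
    "Jordan_Normal_Form.VS_Connect"
begin

section \<open>Group theory\<close>

definition center :: "('a, 'b) monoid_scheme \<Rightarrow> 'a set" where
  "center G = {z \<in> carrier G. \<forall>x \<in> carrier G. z \<otimes>\<^bsub>G\<^esub> x = x \<otimes>\<^bsub>G\<^esub> z}"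

definition centralizer :: "('a, 'b) monoid_scheme \<Rightarrow> 'a \<Rightarrow> 'a set" where
  "centralizer G g = {x \<in> carrier G. x \<otimes>\<^bsub>G\<^esub> g = g \<otimes>\<^bsub>G\<^esub> x}"

definition conj_class :: "('a, 'b) monoid_scheme \<Rightarrow> 'a \<Rightarrow> 'a set" where
  "conj_class G g = {inv\<^bsub>G\<^esub> x \<otimes>\<^bsub>G\<^esub> g \<otimes>\<^bsub>G\<^esub> x | x. x \<in> carrier G}"

definition minimal_normal :: "'a set \<Rightarrow> ('a, 'b) monoid_scheme \<Rightarrow> bool" where
  "minimal_normal N G \<longleftrightarrow>
     N \<lhd> G \<and> N \<noteq> {\<one>\<^bsub>G\<^esub>} \<and> (\<forall>K. K \<lhd> G \<and> K \<subseteq> N \<longrightarrow> K = {\<one>\<^bsub>G\<^esub>} \<or> K = N)"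


section \<open>Complex representations and characters\<close>

definition GL :: "nat \<Rightarrow> complex mat monoid" where
  "GL n = units_of (ring_mat TYPE(complex) n ())"

definition representation ::
    "('a, 'b) monoid_scheme \<Rightarrow> nat \<Rightarrow> ('a \<Rightarrow> complex mat) \<Rightarrow> bool" where
  "representation G n \<rho> \<longleftrightarrow> \<rho> \<in> hom G (GL n)"

definition invariant_subspace ::
    "('a, 'b) monoid_scheme \<Rightarrow> nat \<Rightarrow> ('a \<Rightarrow> complex mat) \<Rightarrow> complex vec set \<Rightarrow> bool" where
  "invariant_subspace G n \<rho> W \<longleftrightarrow>
     VectorSpace.subspace (class_ring :: complex ring) W (module_vec TYPE(complex) n) \<and>
     (\<forall>g \<in> carrier G. \<forall>w \<in> W. \<rho> g *\<^sub>v w \<in> W)"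

definition irreducible_rep ::
    "('a, 'b) monoid_scheme \<Rightarrow> nat \<Rightarrow> ('a \<Rightarrow> complex mat) \<Rightarrow> bool" where
  "irreducible_rep G n \<rho> \<longleftrightarrow>
     representation G n \<rho> \<and> n > 0 \<and>
     (\<forall>W. invariant_subspace G n \<rho> W \<longrightarrow> W = {0\<^sub>v n} \<or> W = carrier_vec n)"

definition mat_trace :: "'c::comm_monoid_add mat \<Rightarrow> 'c" where
  "mat_trace A = (\<Sum>i<dim_row A. A $$ (i, i))"

text \<open>
  The restriction to the carrier makes equality of HOL functions coincide with equality of
  characters as functions on the group.
\<close>

definition character_of ::
    "('a, 'b) monoid_scheme \<Rightarrow> ('a \<Rightarrow> complex mat) \<Rightarrow> 'a \<Rightarrow> complex" where
  "character_of G \<rho> = (\<lambda>g \<in> carrier G. mat_trace (\<rho> g))"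

definition Irr :: "('a, 'b) monoid_scheme \<Rightarrow> ('a \<Rightarrow> complex) set" where
  "Irr G = {character_of G \<rho> | n \<rho>. irreducible_rep G n \<rho>}"

definition char_ker :: "('a, 'b) monoid_scheme \<Rightarrow> ('a \<Rightarrow> complex) \<Rightarrow> 'a set" where
  "char_ker G \<chi> = {g \<in> carrier G. \<chi> g = \<chi> \<one>\<^bsub>G\<^esub>}"

text \<open>The irreducible characters of \<open>G/N\<close>, identified by inflation with characters of \<open>G\<close>.\<close>

definition Irr_quot :: "('a, 'b) monoid_scheme \<Rightarrow> 'a set \<Rightarrow> ('a \<Rightarrow> complex) set" where
  "Irr_quot G N = {\<psi> \<in> Irr G. N \<subseteq> char_ker G \<psi>}"

definition nonlinear :: "('a, 'b) monoid_scheme \<Rightarrow> ('a \<Rightarrow> complex) \<Rightarrow> bool" where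
  "nonlinear G \<chi> \<longleftrightarrow> (\<exists>d::nat. \<chi> \<one>\<^bsub>G\<^esub> = of_nat d \<and> d > 1)"


section \<open>The two equivalent properties, for a given witness \<open>g\<close>\<close>

definition vanishes_off_one_class ::
    "('a, 'b) monoid_scheme \<Rightarrow> ('a \<Rightarrow> complex) \<Rightarrow> 'a \<Rightarrow> bool" where
  "vanishes_off_one_class G \<chi> g \<longleftrightarrow>
     g \<in> carrier G - center G \<and> \<chi> g \<noteq> 0 \<and>
     (\<forall>x \<in> carrier G - (center G \<union> conj_class G g). \<chi> x = 0)"

definition others_trivial_or_vanish ::
    "('a, 'b) monoid_scheme \<Rightarrow> ('a \<Rightarrow> complex) \<Rightarrow> 'a \<Rightarrow> bool" where
  "others_trivial_or_vanish G \<chi> g \<longleftrightarrow>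
     center G \<subseteq> char_ker G \<chi> \<and> g \<in> carrier G - center G \<and>
     (\<forall>\<psi> \<in> Irr G. \<psi> \<noteq> \<chi> \<longrightarrow>
        (if \<psi> \<in> Irr_quot G (center G) then g \<in> char_ker G \<psi> else \<psi> g = 0))"

end

theory Submission
  imports Defs "Jordan_Normal_Form.Spectral_Radius" "HOL-Number_Theory.Cong"
begin

text \<open>
  Write \<open>Z\<close> for the center, \<open>K\<close> for the class of \<open>g\<close> and \<open>M = Z \<union> K\<close>.

  The two conditions are two readings of the same identity between class functions. If \<open>\<chi>\<close> lives on
  \<open>M\<close>, its inner product with any character involves only the values on \<open>Z\<close> and at \<open>g\<close>. Pairing with
  the trivial character forces \<open>Z\<close> into the kernel, because otherwise \<open>\<chi>\<close> would sum to zero over \<open>Z\<close>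
  and hence vanish at \<open>g\<close>; it also gives \<open>\<chi> g\<close>. Pairing with the other irreducible characters then
  gives the second condition (\<open>vanishes_imp_others_trivial_or_vanish\<close>). Conversely, the second
  condition says that the normalised indicator of \<open>K\<close> minus that of \<open>Z\<close> is orthogonal to every irreducible character except \<open>\<chi>\<close>; as the
  irreducible characters separate class functions (\<open>class_function_eq_0\<close>), this difference is a
  multiple of \<open>\<chi>\<close> (\<open>others_trivial_or_vanish_imp_vanishes\<close>). The same \<open>g\<close> serves both conditions.

  Since \<open>\<chi>\<close> is constant on cosets of \<open>Z\<close>, the set \<open>K\<close> is a union of \<open>k\<close> such cosets, where \<open>k\<close> is the
  size of the class of \<open>gZ\<close> in \<open>G/Z\<close>; this makes the two centralizers equally large. With \<open>d = \<chi> 1\<close>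
  and \<open>c = |C(g)|\<close>, the value is \<open>\<chi> g = - d / k\<close> and the norm of \<open>\<chi>\<close> gives \<open>k\<^sup>2 c = d\<^sup>2 (k + 1)\<close>.
  Coprimality of \<open>k\<close> and \<open>k + 1\<close> yields \<open>d = k m\<close>, so \<open>\<chi> g = - m\<close> is an integer by pure arithmetic, and
  \<open>c = m\<^sup>2 (k + 1)\<close>.

  A scalar multiple of \<open>\<chi>\<close> is idempotent under convolution (\<open>irreducible_character_convolution\<close>).
  Evaluated outside \<open>M\<close>, where all terms are nonnegative, this shows that \<open>M\<close> is closed under
  multiplication. A normal subgroup properly containing \<open>Z\<close> is not in the kernel of \<open>\<chi>\<close>, so \<open>\<chi>\<close> sums
  to zero over it and it must meet \<open>K\<close>; therefore \<open>M/Z\<close> is the unique minimal normal subgroup.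
  Linear characters are nonzero at \<open>g\<close>, hence trivial on \<open>Z\<close> and at \<open>g\<close> by the second condition,
  which puts both into the derived subgroup.

  All nontrivial elements of \<open>M/Z\<close> are conjugate, so they have a common prime order \<open>p\<close>, and \<open>Z\<close> has
  exponent dividing \<open>p\<close> because \<open>g z\<close> is conjugate to \<open>g\<close>. Let \<open>Q\<close> be a Sylow \<open>q\<close>-subgroup of \<open>C(g)\<close>
  with \<open>q \<noteq> p\<close>. Then \<open>Q\<close> meets \<open>M\<close> trivially and \<open>\<chi>\<close> vanishes on \<open>g\<^sup>i y\<close> for \<open>1 \<noteq> y \<in> Q\<close>. The
  multiplicities of suitable linear characters in the restriction of \<open>\<chi>\<close> are \<open>d / |Q|\<close> and
  \<open>(d + m) / (p |Q|)\<close>, so \<open>|Q|\<close> divides \<open>m\<close> (\<open>prime_to_p_part_dvd_m\<close>). Now \<open>|Q|\<^sup>2\<close> divides \<open>c\<close> although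
  \<open>|Q|\<close> is the full \<open>q\<close>-part of \<open>c\<close>, whence \<open>Q = 1\<close> and \<open>c\<close> is a power of \<open>p\<close>.
\<close>

section \<open>Complex matrices\<close>

lemma mult_mat_entry:
  assumes "A \<in> carrier_mat r k" "B \<in> carrier_mat k c" "i < r" "j < c"
  shows "(A * B) $$ (i, j) = (\<Sum>l<k. A $$ (i, l) * B $$ (l, j))"
  using assms by (auto simp: scalar_prod_def lessThan_atLeast0)

lemma mult_mat_vec_entry:
  assumes "A \<in> carrier_mat r k" "v \<in> carrier_vec k" "i < r"
  shows "(A *\<^sub>v v) $ i = (\<Sum>l<k. A $$ (i, l) * v $ l)"
  using assms by (auto simp: scalar_prod_def lessThan_atLeast0)

lemma mat_trace_carrier:
  "A \<in> carrier_mat n n \<Longrightarrow> mat_trace A = (\<Sum>i<n. A $$ (i, i))"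
  by (simp add: mat_trace_def)

lemma mat_trace_mult:
  assumes "A \<in> carrier_mat r k" "B \<in> carrier_mat k r"
  shows "mat_trace (A * B) = (\<Sum>i<r. \<Sum>l<k. A $$ (i, l) * B $$ (l, i))"
  unfolding mat_trace_def using assms
  by (auto intro!: sum.cong simp: mult_mat_entry[OF assms] simp del: index_mult_mat(1))

lemma mat_trace_commute:
  fixes A B :: "'c::comm_semiring_0 mat"
  assumes "A \<in> carrier_mat r k" "B \<in> carrier_mat k r"
  shows "mat_trace (A * B) = mat_trace (B * A)"
  unfolding mat_trace_mult[OF assms] mat_trace_mult[OF assms(2,1)]
  by (subst sum.swap) (simp add: mult.commute)

lemma mat_trace_one: "mat_trace (1\<^sub>m n) = of_nat n"
  by (simp add: mat_trace_def)

lemma mat_trace_smult_one: "mat_trace (c \<cdot>\<^sub>m 1\<^sub>m n :: 'c::comm_semiring_1 mat) = c * of_nat n"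
  by (simp add: mat_trace_def mult.commute)

text \<open>
  Matrices of all dimensions share one type, which has no neutral element for addition, so the
  generic \<open>sum\<close> does not apply; the dimensions are supplied explicitly.
\<close>

definition msum :: "nat \<Rightarrow> nat \<Rightarrow> ('x \<Rightarrow> complex mat) \<Rightarrow> 'x set \<Rightarrow> complex mat" where
  "msum r c F S = mat r c (\<lambda>(i, j). \<Sum>x\<in>S. F x $$ (i, j))"

lemma msum_carrier [simp, intro]: "msum r c F S \<in> carrier_mat r c"
  by (simp add: msum_def)

lemma msum_dim [simp]: "dim_row (msum r c F S) = r" "dim_col (msum r c F S) = c"
  by (simp_all add: msum_def)

lemma msum_entry [simp]: "i < r \<Longrightarrow> j < c \<Longrightarrow> msum r c F S $$ (i, j) = (\<Sum>x\<in>S. F x $$ (i, j))"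
  by (simp add: msum_def)

lemma msum_cong: "(\<And>x. x \<in> S \<Longrightarrow> F x = F' x) \<Longrightarrow> msum r c F S = msum r c F' S"
  by (intro eq_matI) auto

lemma msum_reindex: "bij_betw h S T \<Longrightarrow> msum r c (\<lambda>x. F (h x)) S = msum r c F T"
  by (intro eq_matI) (auto intro: sum.reindex_bij_betw)

lemma mult_msum:
  assumes "A \<in> carrier_mat k r" "\<And>x. x \<in> S \<Longrightarrow> F x \<in> carrier_mat r c"
  shows "A * msum r c F S = msum k c (\<lambda>x. A * F x) S"
proof (intro eq_matI)
  fix i j assume "i < dim_row (msum k c (\<lambda>x. A * F x) S)" "j < dim_col (msum k c (\<lambda>x. A * F x) S)"
  then have ij: "i < k" "j < c" by auto
  have "(A * msum r c F S) $$ (i, j) = (\<Sum>l<r. \<Sum>x\<in>S. A $$ (i, l) * F x $$ (l, j))"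
    using ij by (simp add: mult_mat_entry[OF assms(1) msum_carrier] sum_distrib_left
        del: index_mult_mat(1))
  also have "\<dots> = (\<Sum>x\<in>S. (A * F x) $$ (i, j))"
    using ij by (subst sum.swap) (intro sum.cong refl, simp add: mult_mat_entry[OF assms(1,2)] del: index_mult_mat(1))
  finally show "(A * msum r c F S) $$ (i, j) = msum k c (\<lambda>x. A * F x) S $$ (i, j)"
    using ij by simp
qed (use assms in auto)

lemma msum_mult:
  assumes "A \<in> carrier_mat c k" "\<And>x. x \<in> S \<Longrightarrow> F x \<in> carrier_mat r c"
  shows "msum r c F S * A = msum r k (\<lambda>x. F x * A) S"
proof (intro eq_matI)
  fix i j assume "i < dim_row (msum r k (\<lambda>x. F x * A) S)" "j < dim_col (msum r k (\<lambda>x. F x * A) S)"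
  then have ij: "i < r" "j < k" by auto
  have "(msum r c F S * A) $$ (i, j) = (\<Sum>l<c. \<Sum>x\<in>S. F x $$ (i, l) * A $$ (l, j))"
    using ij by (simp add: mult_mat_entry[OF msum_carrier assms(1)] sum_distrib_right
        del: index_mult_mat(1))
  also have "\<dots> = (\<Sum>x\<in>S. (F x * A) $$ (i, j))"
    using ij by (subst sum.swap) (intro sum.cong refl, simp add: mult_mat_entry[OF assms(2,1)] del: index_mult_mat(1))
  finally show "(msum r c F S * A) $$ (i, j) = msum r k (\<lambda>x. F x * A) S $$ (i, j)"
    using ij by simp
qed (use assms in auto)

lemma mat_trace_msum:
  assumes "\<And>x. x \<in> S \<Longrightarrow> F x \<in> carrier_mat n n"
  shows "mat_trace (msum n n F S) = (\<Sum>x\<in>S. mat_trace (F x))"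
proof -
  have "mat_trace (msum n n F S) = (\<Sum>i<n. \<Sum>x\<in>S. F x $$ (i, i))"
    by (simp add: mat_trace_def)
  also have "\<dots> = (\<Sum>x\<in>S. mat_trace (F x))"
    by (subst sum.swap) (auto intro!: sum.cong simp: mat_trace_carrier[OF assms])
  finally show ?thesis .
qed

definition adjoint_mat :: "complex mat \<Rightarrow> complex mat" where
  "adjoint_mat A = mat (dim_col A) (dim_row A) (\<lambda>(i, j). cnj (A $$ (j, i)))"

lemma adjoint_mat_carrier [simp]: "A \<in> carrier_mat r c \<Longrightarrow> adjoint_mat A \<in> carrier_mat c r"
  by (simp add: adjoint_mat_def)

lemma adjoint_mat_entry [simp]:
  "A \<in> carrier_mat r c \<Longrightarrow> i < c \<Longrightarrow> j < r \<Longrightarrow> adjoint_mat A $$ (i, j) = cnj (A $$ (j, i))"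
  by (auto simp: adjoint_mat_def)

lemma adjoint_mat_mult:
  assumes "A \<in> carrier_mat r k" "B \<in> carrier_mat k c"
  shows "adjoint_mat (A * B) = adjoint_mat B * adjoint_mat A"
proof (intro eq_matI)
  note [simp del] = index_mult_mat(1)
  fix i j assume "i < dim_row (adjoint_mat B * adjoint_mat A)" "j < dim_col (adjoint_mat B * adjoint_mat A)"
  then have ij: "i < c" "j < r" using assms by (auto simp: adjoint_mat_def)
  show "adjoint_mat (A * B) $$ (i, j) = (adjoint_mat B * adjoint_mat A) $$ (i, j)"
    using ij assms
    by (simp add: adjoint_mat_entry[OF mult_carrier_mat[OF assms]] mult_mat_entry[OF assms]
        mult_mat_entry[OF adjoint_mat_carrier[OF assms(2)] adjoint_mat_carrier[OF assms(1)]]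
        adjoint_mat_entry[OF assms(1)] adjoint_mat_entry[OF assms(2)] mult.commute)
qed (use assms in \<open>auto simp: adjoint_mat_def\<close>)

lemma adjoint_mat_mult_self_trace:
  assumes "B \<in> carrier_mat r c"
  shows "mat_trace (adjoint_mat B * B) = of_real (\<Sum>i<c. \<Sum>l<r. (norm (B $$ (l, i)))\<^sup>2)"
  unfolding mat_trace_mult[OF adjoint_mat_carrier[OF assms] assms] of_real_sum
  by (intro sum.cong refl)
     (simp add: adjoint_mat_entry[OF assms] mult.commute flip: complex_norm_square)

text \<open>
  The trace of \<open>B\<^sup>* B\<close> is the sum of the squared absolute values of the entries of \<open>B\<close>.
\<close>

lemma adjoint_mat_mult_self_eq_0:
  assumes "B \<in> carrier_mat r c" "mat_trace (adjoint_mat B * B) = 0"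
  shows "B = 0\<^sub>m r c"
proof (intro eq_matI)
  fix i j assume "i < dim_row (0\<^sub>m r c :: complex mat)" "j < dim_col (0\<^sub>m r c :: complex mat)"
  then have ij: "i < r" "j < c" by auto
  have "(\<Sum>j<c. \<Sum>l<r. (norm (B $$ (l, j)))\<^sup>2) = 0"
    using assms(2) unfolding adjoint_mat_mult_self_trace[OF assms(1)] of_real_eq_0_iff .
  then have "(\<Sum>l<r. (norm (B $$ (l, j)))\<^sup>2) = 0"
    using ij by (subst (asm) sum_nonneg_eq_0_iff) (auto intro!: sum_nonneg)
  then have "(norm (B $$ (i, j)))\<^sup>2 = 0"
    using ij by (subst (asm) sum_nonneg_eq_0_iff) auto
  then show "B $$ (i, j) = 0\<^sub>m r c $$ (i, j)" using ij by simp
qed (use assms in auto)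

lemma subspace_iff:
  "VectorSpace.subspace (class_ring :: complex ring) W (module_vec TYPE(complex) n) \<longleftrightarrow>
     W \<subseteq> carrier_vec n \<and> 0\<^sub>v n \<in> W \<and> (\<forall>v\<in>W. \<forall>w\<in>W. v + w \<in> W) \<and> (\<forall>c. \<forall>v\<in>W. c \<cdot>\<^sub>v v \<in> W)"
proof -
  interpret vec_space "TYPE(complex)" n .
  show ?thesis
    unfolding VectorSpace.subspace_def submodule_def
    using vectorspace_axioms module_axioms by (auto simp: module_vec_simps)
qed

lemma mat_eqI_mult_vec:
  fixes A B :: "complex mat"
  assumes "A \<in> carrier_mat r c" "B \<in> carrier_mat r c"
    "\<And>v. v \<in> carrier_vec c \<Longrightarrow> A *\<^sub>v v = B *\<^sub>v v"
  shows "A = B"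
proof (rule eq_matI)
  fix i j assume "i < dim_row B" "j < dim_col B"
  then have ij: "i < r" "j < c" using assms by auto
  let ?e = "vec c (\<lambda>l. if l = j then 1 else 0) :: complex vec"
  have *: "(M *\<^sub>v ?e) $ i = M $$ (i, j)" if "M \<in> carrier_mat r c" for M
    unfolding mult_mat_vec_entry[OF that vec_carrier ij(1)] using ij by (simp add: if_distrib cong: if_cong)
  show "A $$ (i, j) = B $$ (i, j)"
    using assms(3)[OF vec_carrier, of "\<lambda>l. if l = j then 1 else 0"] *[OF assms(1)] *[OF assms(2)]
    by simp
qed (use assms in auto)

text \<open>
  If \<open>m > n\<close>, pad \<open>B\<close> with zero rows and \<open>L\<close> with zero columns to square matrices: the product
  stays the identity, so the padded matrices are mutually inverse, although the one built from \<open>B\<close>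
  has a zero row.
\<close>

lemma left_inverse_mat_le:
  fixes B L :: "'c::field mat"
  assumes "B \<in> carrier_mat n m" "L \<in> carrier_mat m n" "L * B = 1\<^sub>m m"
  shows "m \<le> n"
proof (rule ccontr)
  note [simp del] = index_mult_mat(1)
  assume "\<not> m \<le> n"
  then have nm: "n < m" by simp
  define B0 where "B0 = mat m m (\<lambda>(i, j). if i < n then B $$ (i, j) else 0)"
  define L0 where "L0 = mat m m (\<lambda>(i, j). if j < n then L $$ (i, j) else 0)"
  have c: "B0 \<in> carrier_mat m m" "L0 \<in> carrier_mat m m" by (auto simp: B0_def L0_def)
  have "L0 * B0 = L * B"
  proof (intro eq_matI)
    fix i j assume "i < dim_row (L * B)" "j < dim_col (L * B)"
    then have ij: "i < m" "j < m" using assms by auto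
    have "(L0 * B0) $$ (i, j) = (\<Sum>l<m. if l < n then L $$ (i, l) * B $$ (l, j) else 0)"
      using ij unfolding mult_mat_entry[OF c(2,1) ij] by (intro sum.cong) (auto simp: B0_def L0_def)
    also have "\<dots> = (\<Sum>l<n. L $$ (i, l) * B $$ (l, j))"
      using nm by (intro sum.mono_neutral_cong_right) auto
    finally show "(L0 * B0) $$ (i, j) = (L * B) $$ (i, j)"
      unfolding mult_mat_entry[OF assms(2,1) ij] .
  qed (use assms c in auto)
  then have "B0 * L0 = 1\<^sub>m m"
    using mat_mult_left_right_inverse[OF c(2,1)] assms(3) by simp
  then have "(B0 * L0) $$ (n, n) = 1" using nm by simp
  moreover have "(B0 * L0) $$ (n, n) = 0"
    unfolding mult_mat_entry[OF c nm nm] using nm by (intro sum.neutral) (auto simp: B0_def)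
  ultimately show False by simp
qed

text \<open>
  A subspace is handled through an injective matrix \<open>B\<close> whose columns span it, together with a left
  inverse \<open>L\<close>; then \<open>B L\<close> restricts to the identity on the subspace, and the restriction of a linear
  map becomes an honest matrix \<open>L A B\<close>. Existence follows by choosing the number \<open>m\<close> of columns
  maximal: a vector \<open>w\<close> with \<open>B L w \<noteq> w\<close> would supply a further column.
\<close>

lemma subspace_parametrization:
  assumes "VectorSpace.subspace (class_ring :: complex ring) W (module_vec TYPE(complex) n)"
  obtains m B L where "m \<le> n" "B \<in> carrier_mat n m" "L \<in> carrier_mat m n" "L * B = 1\<^sub>m m"
    "\<And>v. v \<in> carrier_vec m \<Longrightarrow> B *\<^sub>v v \<in> W" "\<And>w. w \<in> W \<Longrightarrow> B *\<^sub>v (L *\<^sub>v w) = w"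
proof -
  note [simp del] = index_mult_mat(1)
  note W = assms[unfolded subspace_iff]
  define P where "P m \<longleftrightarrow> (\<exists>B L. B \<in> carrier_mat n m \<and> L \<in> carrier_mat m n \<and> L * B = 1\<^sub>m m \<and>
      (\<forall>v\<in>carrier_vec m. B *\<^sub>v v \<in> W))" for m
  have "P 0"
  proof -
    have "0\<^sub>m n 0 *\<^sub>v v = 0\<^sub>v n" if "v \<in> carrier_vec 0" for v :: "complex vec"
      using that by (intro eq_vecI) (auto simp: scalar_prod_def)
    then show ?thesis unfolding P_def using W
      by (intro exI[of _ "0\<^sub>m n 0"] exI[of _ "0\<^sub>m 0 n"]) (auto intro!: eq_matI)
  qed
  moreover have bd: "P m \<Longrightarrow> m \<le> n" for m unfolding P_def using left_inverse_mat_le by blast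
  ultimately obtain m where m: "P m" "\<And>k. P k \<Longrightarrow> k \<le> m"
    using Nat.ex_has_greatest_nat[of P 0 n] by auto
  then obtain B L where BL: "B \<in> carrier_mat n m" "L \<in> carrier_mat m n" "L * B = 1\<^sub>m m"
    "\<And>v. v \<in> carrier_vec m \<Longrightarrow> B *\<^sub>v v \<in> W" unfolding P_def by blast
  have "B *\<^sub>v (L *\<^sub>v w) = w" if w: "w \<in> W" for w
  proof (rule ccontr)
    assume ne: "B *\<^sub>v (L *\<^sub>v w) \<noteq> w"
    have wc: "w \<in> carrier_vec n" using W w by auto
    \<comment> \<open>The part of \<open>w\<close> outside the range of \<open>B\<close> is annihilated by \<open>L\<close> and has a nonzero coordinate \<open>i\<close>.\<close>
    define w' where "w' = w + (-1) \<cdot>\<^sub>v (B *\<^sub>v (L *\<^sub>v w))"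
    have w'W: "w' \<in> W" unfolding w'_def using W w BL wc by auto
    then have w'c: "w' \<in> carrier_vec n" using W by auto
    have Lw': "L *\<^sub>v w' = 0\<^sub>v m"
    proof -
      have "L *\<^sub>v w' = L *\<^sub>v w + (-1) \<cdot>\<^sub>v (L *\<^sub>v (B *\<^sub>v (L *\<^sub>v w)))"
        unfolding w'_def using BL wc by (simp add: mult_add_distrib_mat_vec mult_mat_vec)
      also have "L *\<^sub>v (B *\<^sub>v (L *\<^sub>v w)) = L *\<^sub>v w"
        using BL(3) wc assoc_mult_mat_vec[OF BL(2,1), of "L *\<^sub>v w"] mult_mat_vec_carrier[OF BL(2) wc] by simp
      also have "L *\<^sub>v w + (-1) \<cdot>\<^sub>v (L *\<^sub>v w) = 0\<^sub>v m" using BL wc by (intro eq_vecI) auto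
      finally show ?thesis .
    qed
    have "\<exists>i<n. w' $ i \<noteq> 0"
    proof (rule ccontr)
      assume z: "\<not> (\<exists>i<n. w' $ i \<noteq> 0)"
      have "w $ i = (B *\<^sub>v (L *\<^sub>v w)) $ i" if "i < n" for i
      proof -
        have "w' $ i = w $ i - (B *\<^sub>v (L *\<^sub>v w)) $ i"
          unfolding w'_def using that BL wc by (simp del: index_mult_mat_vec)
        then show ?thesis using z that by auto
      qed
      then show False using ne BL wc by (auto intro!: eq_vecI simp del: index_mult_mat_vec)
    qed
    then obtain i where i: "i < n" "w' $ i \<noteq> 0" by blast
    define D where "D = 1\<^sub>m n - B * L"
    have Dc: "D \<in> carrier_mat n n" using BL by (auto simp: D_def)
    have DB: "D * B = 0\<^sub>m n m"
    proof -
      have "D * B = 1\<^sub>m n * B - B * L * B" unfolding D_def using BL by (intro minus_mult_distrib_mat) auto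
      also have "B * L * B = B" using BL by simp
      finally show ?thesis using BL by simp
    qed
    have Dw': "D *\<^sub>v w' = w'"
    proof -
      have "D *\<^sub>v w' = 1\<^sub>m n *\<^sub>v w' - (B * L) *\<^sub>v w'"
        unfolding D_def using BL w'c by (intro minus_mult_distrib_mat_vec) auto
      also have "(B * L) *\<^sub>v w' = 0\<^sub>v n" using BL w'c Lw' by (auto simp: scalar_prod_def intro!: eq_vecI)
      finally show ?thesis using w'c by simp
    qed
    \<comment> \<open>The new column is \<open>w'\<close>; the new row of the left inverse reads off coordinate \<open>i\<close> after
      projecting along the range of \<open>B\<close>, scaled to give 1 on \<open>w'\<close>.\<close>
    define B' where "B' = mat n (Suc m) (\<lambda>(a, b). if b < m then B $$ (a, b) else w' $ a)"
    define L' where "L' = mat (Suc m) n (\<lambda>(a, b). if a < m then L $$ (a, b) else D $$ (i, b) / w' $ i)"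
    have c: "B' \<in> carrier_mat n (Suc m)" "L' \<in> carrier_mat (Suc m) n" by (auto simp: B'_def L'_def)
    have "L' * B' = 1\<^sub>m (Suc m)"
    proof (intro eq_matI)
      fix a b assume "a < dim_row (1\<^sub>m (Suc m) :: complex mat)" "b < dim_col (1\<^sub>m (Suc m) :: complex mat)"
      then have ab: "a < Suc m" "b < Suc m" by auto
      have *: "(L' * B') $$ (a, b) = (\<Sum>l<n. (if a < m then L $$ (a, l) else D $$ (i, l) / w' $ i) *
          (if b < m then B $$ (l, b) else w' $ l))"
        unfolding mult_mat_entry[OF c(2,1) ab] using ab by (intro sum.cong) (auto simp: B'_def L'_def)
      consider "a < m" "b < m" | "a < m" "b = m" | "a = m" "b < m" | "a = m" "b = m" using ab by linarith
      then show "(L' * B') $$ (a, b) = 1\<^sub>m (Suc m) $$ (a, b)"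
      proof cases
        case 1
        then have "(L' * B') $$ (a, b) = (L * B) $$ (a, b)"
          unfolding * mult_mat_entry[OF BL(2,1) 1] by simp
        then show ?thesis using 1 BL by simp
      next
        case 2
        then have "(L' * B') $$ (a, b) = (L *\<^sub>v w') $ a"
          unfolding * mult_mat_vec_entry[OF BL(2) w'c 2(1)] by simp
        then show ?thesis using 2 Lw' by simp
      next
        case 3
        then have "(L' * B') $$ (a, b) = (D * B) $$ (i, b) / w' $ i"
          unfolding * mult_mat_entry[OF Dc BL(1) i(1) 3(2)] by (simp add: sum_divide_distrib)
        then show ?thesis using 3 DB i by simp
      next
        case 4
        then have "(L' * B') $$ (a, b) = (D *\<^sub>v w') $ i / w' $ i"
          unfolding * mult_mat_vec_entry[OF Dc w'c i(1)] by (simp add: sum_divide_distrib)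
        then show ?thesis using 4 Dw' i by simp
      qed
    qed (use c in auto)
    moreover have "B' *\<^sub>v v \<in> W" if v: "v \<in> carrier_vec (Suc m)" for v
    proof -
      have *: "vec m (($) v) \<in> carrier_vec m" by simp
      have "B' *\<^sub>v v = B *\<^sub>v vec m (($) v) + v $ m \<cdot>\<^sub>v w'"
      proof (intro eq_vecI)
        fix a assume "a < dim_vec (B *\<^sub>v vec m (($) v) + v $ m \<cdot>\<^sub>v w')"
        then have a: "a < n" using w'c by auto
        show "(B' *\<^sub>v v) $ a = (B *\<^sub>v vec m (($) v) + v $ m \<cdot>\<^sub>v w') $ a"
          using a w'c BL unfolding mult_mat_vec_entry[OF c(1) v a]
          by (simp add: mult_mat_vec_entry[OF BL(1) *] B'_def mult.commute del: index_mult_mat_vec)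
      qed (use c BL w'c in auto)
      then show ?thesis using W w'W BL(4)[OF *] by auto
    qed
    ultimately have "P (Suc m)" unfolding P_def using c by blast
    then show False using m(2) by fastforce
  qed
  then show ?thesis using that[OF bd[OF m(1)] BL] by blast
qed

text \<open>
  The trace of a projection is the dimension of its range.
\<close>

lemma idempotent_trace_nat:
  assumes P: "P \<in> carrier_mat n n" "P * P = (P :: complex mat)"
  obtains m :: nat where "mat_trace P = of_nat m"
proof -
  define W where "W = {P *\<^sub>v v | v. v \<in> carrier_vec n}"
  have "VectorSpace.subspace (class_ring :: complex ring) W (module_vec TYPE(complex) n)"
    unfolding subspace_iff
  proof (intro conjI ballI allI)
    show "W \<subseteq> carrier_vec n" using P by (auto simp: W_def)
    show "0\<^sub>v n \<in> W" unfolding W_def using P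
      by (auto intro!: exI[of _ "0\<^sub>v n"] eq_vecI simp: scalar_prod_def)
    fix v w assume "v \<in> W" "w \<in> W"
    then obtain v' w' where *: "v = P *\<^sub>v v'" "w = P *\<^sub>v w'" "v' \<in> carrier_vec n" "w' \<in> carrier_vec n"
      by (auto simp: W_def)
    then show "v + w \<in> W" unfolding W_def mem_Collect_eq using *(3,4) by (intro exI[of _ "v' + w'"]) (simp add: *(1,2) mult_add_distrib_mat_vec[OF P(1)])
    show "c \<cdot>\<^sub>v v \<in> W" for c unfolding W_def mem_Collect_eq using *(3)
      by (intro exI[of _ "c \<cdot>\<^sub>v v'"]) (simp add: *(1) mult_mat_vec[OF P(1)])
  qed
  then obtain m B L where BL: "B \<in> carrier_mat n m" "L \<in> carrier_mat m n" "L * B = 1\<^sub>m m"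
    "\<And>v. v \<in> carrier_vec m \<Longrightarrow> B *\<^sub>v v \<in> W" "\<And>w. w \<in> W \<Longrightarrow> B *\<^sub>v (L *\<^sub>v w) = w"
    by (rule subspace_parametrization) blast
  have "P *\<^sub>v w = w" if "w \<in> W" for w
    using that P by (auto simp: W_def simp flip: assoc_mult_mat_vec)
  then have "P *\<^sub>v (B *\<^sub>v v) = B *\<^sub>v v" if "v \<in> carrier_vec m" for v
    using BL(4) that by blast
  then have PB: "P * B = B" using BL P
    by (intro mat_eqI_mult_vec[of _ n m]) (simp_all add: assoc_mult_mat_vec[of P n n B m])
  have "B *\<^sub>v (L *\<^sub>v (P *\<^sub>v v)) = P *\<^sub>v v" if "v \<in> carrier_vec n" for v
    using BL(5) that unfolding W_def by blast
  then have BLP: "B * (L * P) = P" using BL P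
    by (intro mat_eqI_mult_vec[of _ n n]) (simp_all add: assoc_mult_mat_vec[of B n m "L * P" n] assoc_mult_mat_vec[of L m n P n])
  have "mat_trace P = mat_trace (B * (L * P))" by (simp add: BLP)
  also have "\<dots> = mat_trace ((L * P) * B)" using BL P by (intro mat_trace_commute[of _ n m]) auto
  also have "(L * P) * B = 1\<^sub>m m" using BL P PB by simp
  finally show ?thesis using that by (simp add: mat_trace_one)
qed

lemma matrix_range_factor:
  assumes T: "T \<in> carrier_mat r k" and B: "B \<in> carrier_mat r m"
    and ran: "\<And>v. v \<in> carrier_vec m \<Longrightarrow> \<exists>u\<in>carrier_vec k. B *\<^sub>v v = T *\<^sub>v (u :: complex vec)"
  obtains C where "C \<in> carrier_mat k m" "B = T * C"
proof -
  define e :: "nat \<Rightarrow> complex vec" where "e j = vec m (\<lambda>i. if i = j then 1 else 0)" for j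
  have e: "e j \<in> carrier_vec m" for j by (simp add: e_def)
  have "\<forall>j. \<exists>u. u \<in> carrier_vec k \<and> B *\<^sub>v e j = T *\<^sub>v u" using ran[OF e] by blast
  then obtain u where u: "\<And>j. u j \<in> carrier_vec k" "\<And>j. B *\<^sub>v e j = T *\<^sub>v u j" by metis
  define C where "C = mat k m (\<lambda>(i, j). u j $ i)"
  have C: "C \<in> carrier_mat k m" by (simp add: C_def)
  have "B = T * C"
  proof (rule eq_matI)
    fix i j assume "i < dim_row (T * C)" "j < dim_col (T * C)"
    then have ij: "i < r" "j < m" using T C by auto
    have "(T * C) $$ (i, j) = (T *\<^sub>v u j) $ i"
      unfolding mult_mat_entry[OF T C ij] mult_mat_vec_entry[OF T u(1) ij(1)]
      using ij by (simp add: C_def)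
    also have "\<dots> = B $$ (i, j)"
      unfolding u(2)[symmetric] mult_mat_vec_entry[OF B e ij(1)]
      using ij by (simp add: e_def if_distrib cong: if_cong)
    finally show "B $$ (i, j) = (T * C) $$ (i, j)" by simp
  qed (use T B C in auto)
  with C show ?thesis by (rule that)
qed

text \<open>
  When the matrices \<open>F s\<close> multiply like a group, with each left multiplication permuting the index set,
  their average is idempotent and has a natural number as its trace. For \<open>F s = \<lambda> s \<cdot> \<rho> s\<close> with a linear
  character \<open>\<lambda>\<close>, this is the integrality of a multiplicity. It yields divisibility
  properties of character values without algebraic integers.
\<close>

lemma card_dvd_trace_sum:
  fixes F :: "'s \<Rightarrow> complex mat"
  assumes "finite S" "S \<noteq> {}" and F: "\<And>s. s \<in> S \<Longrightarrow> F s \<in> carrier_mat n n"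
    and bij: "\<And>s. s \<in> S \<Longrightarrow> bij_betw (\<tau> s) S S"
    and mult: "\<And>s t. s \<in> S \<Longrightarrow> t \<in> S \<Longrightarrow> F s * F t = F (\<tau> s t)"
  obtains m :: nat where "(\<Sum>s\<in>S. mat_trace (F s)) = of_nat (card S * m)"
proof -
  let ?T = "msum n n F S" and ?c = "of_nat (card S) :: complex"
  have c: "?c \<noteq> 0" using assms(1,2) by simp
  have T: "?T \<in> carrier_mat n n" by simp
  have "F s * ?T = ?T" if s: "s \<in> S" for s
  proof -
    have "F s * ?T = msum n n (\<lambda>t. F s * F t) S" by (rule mult_msum[OF F[OF s] F])
    also have "\<dots> = msum n n (\<lambda>t. F (\<tau> s t)) S" by (rule msum_cong) (rule mult[OF s])
    also have "\<dots> = ?T" by (rule msum_reindex[OF bij[OF s]])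
    finally show ?thesis .
  qed
  then have "msum n n (\<lambda>s. F s * ?T) S = msum n n (\<lambda>s. ?T) S" by (intro msum_cong)
  then have "?T * ?T = msum n n (\<lambda>s. ?T) S" using msum_mult[where F = F and S = S, OF T F] by simp
  also have "\<dots> = ?c \<cdot>\<^sub>m ?T" by (intro eq_matI) auto
  finally have TT: "?T * ?T = ?c \<cdot>\<^sub>m ?T" .
  let ?P = "inverse ?c \<cdot>\<^sub>m ?T"
  have "?P * ?P = inverse ?c \<cdot>\<^sub>m (inverse ?c \<cdot>\<^sub>m (?T * ?T))"
    by (simp add: mult_smult_distrib[of _ n n _ n] mult_smult_assoc_mat[of _ n n _ n])
  also have "\<dots> = ?P" unfolding TT using c by (intro eq_matI) auto
  finally have "?P * ?P = ?P" .
  then obtain m :: nat where m: "mat_trace ?P = of_nat m"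
    using idempotent_trace_nat[of ?P n] by auto
  have "mat_trace ?P = inverse ?c * mat_trace ?T" by (simp add: mat_trace_def sum_distrib_left)
  then have "mat_trace ?T = of_nat (card S * m)" using m c by (simp add: field_simps)
  then show ?thesis using that[of m] mat_trace_msum[where F = F and S = S, OF F] by simp
qed

section \<open>Representations of a finite group\<close>

locale finite_group = group G for G (structure) +
  assumes fin [simp]: "finite (carrier G)"
begin

lemma representationI:
  assumes "\<And>x. x \<in> carrier G \<Longrightarrow> \<rho> x \<in> carrier_mat n n"
    and "\<And>x y. x \<in> carrier G \<Longrightarrow> y \<in> carrier G \<Longrightarrow> \<rho> (x \<otimes> y) = \<rho> x * \<rho> y"
    and "\<rho> \<one> = 1\<^sub>m n"
  shows "representation G n \<rho>"
proof -
  have "\<rho> x \<in> Units (ring_mat TYPE(complex) n ())" if "x \<in> carrier G" for x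
    using that assms(1)[of x] assms(1)[of "inv x"] assms(2)[of x "inv x"] assms(2)[of "inv x" x] assms(3)
    by (auto simp: Units_def ring_mat_simps intro!: bexI[of _ "\<rho> (inv x)"])
  then show ?thesis
    using assms(2) by (auto simp: representation_def GL_def hom_def units_of_def ring_mat_simps)
qed

lemma rep_carrier: "representation G n \<rho> \<Longrightarrow> x \<in> carrier G \<Longrightarrow> \<rho> x \<in> carrier_mat n n"
  by (auto simp: representation_def GL_def hom_def units_of_def Units_def ring_mat_simps)

lemma rep_mult:
  "representation G n \<rho> \<Longrightarrow> x \<in> carrier G \<Longrightarrow> y \<in> carrier G \<Longrightarrow> \<rho> (x \<otimes> y) = \<rho> x * \<rho> y"
  by (auto simp: representation_def GL_def hom_def units_of_def ring_mat_simps)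

lemma rep_one:
  assumes "representation G n \<rho>"
  shows "\<rho> \<one> = 1\<^sub>m n"
proof -
  have "\<rho> \<one> \<in> Units (ring_mat TYPE(complex) n ())"
    using assms by (auto simp: representation_def GL_def hom_def units_of_def)
  then obtain K where K: "K \<in> carrier_mat n n" "K * \<rho> \<one> = 1\<^sub>m n"
    by (auto simp: Units_def ring_mat_simps)
  have c: "\<rho> \<one> \<in> carrier_mat n n" using rep_carrier[OF assms] by simp
  have "\<rho> \<one> * \<rho> \<one> = \<rho> \<one>" using rep_mult[OF assms, of \<one> \<one>] by simp
  then have "K * \<rho> \<one> * \<rho> \<one> = K * \<rho> \<one>" by (simp add: assoc_mult_mat[OF K(1) c c])
  then show ?thesis using c by (simp only: K(2) left_mult_one_mat[OF c])
qed

lemma rep_inv: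
  assumes "representation G n \<rho>" "x \<in> carrier G"
  shows "\<rho> x * \<rho> (inv x) = 1\<^sub>m n" "\<rho> (inv x) * \<rho> x = 1\<^sub>m n"
  using assms rep_mult[OF assms(1), of x "inv x"] rep_mult[OF assms(1), of "inv x" x] rep_one[OF assms(1)]
  by auto

lemma character_of_eq: "x \<in> carrier G \<Longrightarrow> character_of G \<rho> x = mat_trace (\<rho> x)"
  by (simp add: character_of_def)

lemma character_of_one: "representation G n \<rho> \<Longrightarrow> character_of G \<rho> \<one> = of_nat n"
  by (simp add: character_of_eq rep_one mat_trace_one)

lemma IrrE:
  assumes "\<chi> \<in> Irr G"
  obtains n \<rho> where "irreducible_rep G n \<rho>" "representation G n \<rho>" "n > 0" "\<chi> = character_of G \<rho>"
  using assms by (auto simp: Irr_def irreducible_rep_def)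

lemma character_of_class_function:
  assumes "representation G n \<rho>" "x \<in> carrier G" "y \<in> carrier G"
  shows "character_of G \<rho> (inv y \<otimes> x \<otimes> y) = character_of G \<rho> x"
proof -
  note [simp] = rep_carrier[OF assms(1)]
  have "mat_trace (\<rho> (inv y \<otimes> x \<otimes> y)) = mat_trace (\<rho> (inv y) * (\<rho> x * \<rho> y))"
    using assms by (simp add: rep_mult[OF assms(1)] assoc_mult_mat[of _ n n _ n _ n])
  also have "\<dots> = mat_trace (\<rho> x * \<rho> y * \<rho> (inv y))"
    using assms by (intro mat_trace_commute[of _ n n]) (auto intro!: mult_carrier_mat[of _ n n])
  also have "\<rho> x * \<rho> y * \<rho> (inv y) = \<rho> x"
    using assms rep_inv(1)[OF assms(1), of y] by (simp add: assoc_mult_mat[of _ n n _ n _ n] right_mult_one_mat[of _ n n])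
  finally show ?thesis using assms by (simp add: character_of_eq)
qed

lemma irreducible_repD:
  assumes "irreducible_rep G n \<rho>" "W \<subseteq> carrier_vec n" "0\<^sub>v n \<in> W"
    and "\<And>v w. v \<in> W \<Longrightarrow> w \<in> W \<Longrightarrow> v + w \<in> W" "\<And>c v. v \<in> W \<Longrightarrow> c \<cdot>\<^sub>v v \<in> W"
    and "\<And>x v. x \<in> carrier G \<Longrightarrow> v \<in> W \<Longrightarrow> \<rho> x *\<^sub>v v \<in> W"
  shows "W = {0\<^sub>v n} \<or> W = carrier_vec n"
proof -
  have "invariant_subspace G n \<rho> W"
    unfolding invariant_subspace_def subspace_iff using assms(2-) by auto
  then show ?thesis using assms(1) unfolding irreducible_rep_def by blast
qed

section \<open>Schur's lemma\<close>

text \<open>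
  Kernel and range of an intertwiner are invariant. If it is nonzero, then irreducibility leaves only the
  trivial kernel and the full range.
\<close>

lemma Schur_intertwiner:
  assumes \<rho>: "irreducible_rep G n \<rho>" and \<sigma>: "irreducible_rep G m \<sigma>"
    and T: "T \<in> carrier_mat n m"
    and comm: "\<And>x. x \<in> carrier G \<Longrightarrow> \<rho> x * T = T * \<sigma> x"
    and nz: "T \<noteq> 0\<^sub>m n m"
  obtains S where "S \<in> carrier_mat m n" "S * T = 1\<^sub>m m" "T * S = 1\<^sub>m n"
proof -
  have rep: "representation G n \<rho>" "representation G m \<sigma>" using \<rho> \<sigma> by (auto simp: irreducible_rep_def)
  have comm': "\<rho> x *\<^sub>v (T *\<^sub>v v) = T *\<^sub>v (\<sigma> x *\<^sub>v v)" if "x \<in> carrier G" "v \<in> carrier_vec m" for x v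
    using comm[OF that(1)] assoc_mult_mat_vec[OF rep_carrier[OF rep(1) that(1)] T that(2)]
      assoc_mult_mat_vec[OF T rep_carrier[OF rep(2) that(1)] that(2)] by simp
  let ?K = "{v \<in> carrier_vec m. T *\<^sub>v v = 0\<^sub>v n}"
  have mult0: "A *\<^sub>v 0\<^sub>v k = 0\<^sub>v r" if "A \<in> carrier_mat r k" for A :: "complex mat" and r k
    using that by (intro eq_vecI) (auto simp: scalar_prod_def)
  have K: "?K = {0\<^sub>v m} \<or> ?K = carrier_vec m"
  proof (rule irreducible_repD[OF \<sigma>])
    show "c \<cdot>\<^sub>v v \<in> ?K" if "v \<in> ?K" for c v
      using that T by (auto simp: mult_mat_vec[of T n m])
    show "\<sigma> x *\<^sub>v v \<in> ?K" if "x \<in> carrier G" "v \<in> ?K" for x v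
      using that comm'[of x v, symmetric] rep_carrier[OF rep(2) that(1)] rep_carrier[OF rep(1) that(1)]
      by (auto simp: mult0)
  qed (use T in \<open>auto simp: mult_add_distrib_mat_vec[of T n m] mult0\<close>)
  have "?K \<noteq> carrier_vec m"
  proof
    assume "?K = carrier_vec m"
    moreover have "0\<^sub>m n m *\<^sub>v v = 0\<^sub>v n" if "v \<in> carrier_vec m" for v :: "complex vec"
      using that by (intro eq_vecI) (auto simp: scalar_prod_def)
    ultimately have "T = 0\<^sub>m n m" using T by (intro mat_eqI_mult_vec[of _ n m]) (auto simp: set_eq_iff)
    with nz show False by simp
  qed
  with K have ker: "?K = {0\<^sub>v m}" by simp
  let ?R = "{T *\<^sub>v v | v. v \<in> carrier_vec m}"
  have R: "?R = {0\<^sub>v n} \<or> ?R = carrier_vec n"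
  proof (rule irreducible_repD[OF \<rho>])
    show "0\<^sub>v n \<in> ?R" using mult0[OF T] by (auto intro!: exI[of _ "0\<^sub>v m"])
    show "v + w \<in> ?R" if vw: "v \<in> ?R" "w \<in> ?R" for v w
    proof -
      obtain v' w' where "v = T *\<^sub>v v'" "w = T *\<^sub>v w'" "v' \<in> carrier_vec m" "w' \<in> carrier_vec m" using vw by blast
      then show ?thesis unfolding mem_Collect_eq
        by (intro exI[of _ "v' + w'"]) (simp add: mult_add_distrib_mat_vec[OF T])
    qed
    show "c \<cdot>\<^sub>v v \<in> ?R" if v: "v \<in> ?R" for c v
    proof -
      obtain v' where "v = T *\<^sub>v v'" "v' \<in> carrier_vec m" using v by blast
      then show ?thesis unfolding mem_Collect_eq
        by (intro exI[of _ "c \<cdot>\<^sub>v v'"]) (simp add: mult_mat_vec[OF T])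
    qed
    show "\<rho> x *\<^sub>v v \<in> ?R" if x: "x \<in> carrier G" and v: "v \<in> ?R" for x v
    proof -
      obtain v' where "v = T *\<^sub>v v'" "v' \<in> carrier_vec m" using v by blast
      then show ?thesis unfolding mem_Collect_eq using rep_carrier[OF rep(2) x]
        by (intro exI[of _ "\<sigma> x *\<^sub>v v'"]) (simp add: comm'[OF x])
    qed
  qed (use T in auto)
  have "?R \<noteq> {0\<^sub>v n}"
  proof
    assume "?R = {0\<^sub>v n}"
    then have "?K = carrier_vec m" by blast
    with \<open>?K \<noteq> carrier_vec m\<close> show False by simp
  qed
  with R have ran: "?R = carrier_vec n" by simp
  \<comment> \<open>Surjectivity gives a right inverse; injectivity will make it two-sided.\<close>
  have "\<exists>u\<in>carrier_vec m. 1\<^sub>m n *\<^sub>v v = T *\<^sub>v u" if "v \<in> carrier_vec n" for v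
  proof -
    have "v \<in> ?R" using that ran by simp
    then show ?thesis using that by auto
  qed
  then obtain S where S: "S \<in> carrier_mat m n" and TS: "1\<^sub>m n = T * S"
    by (rule matrix_range_factor[OF T one_carrier_mat])
  note TS = TS[symmetric]
  have "S * T = 1\<^sub>m m"
  proof (rule mat_eqI_mult_vec[of _ m m])
    fix v :: "complex vec" assume v: "v \<in> carrier_vec m"
    let ?w = "(S * T) *\<^sub>v v - v"
    have w: "?w \<in> carrier_vec m" using v S T by auto
    have "T *\<^sub>v ((S * T) *\<^sub>v v) = (T * S) *\<^sub>v (T *\<^sub>v v)"
      using mult_mat_vec_carrier[OF T v] assoc_mult_mat_vec[OF S T v] assoc_mult_mat_vec[OF T S, of "T *\<^sub>v v"]
      by simp
    also have "\<dots> = T *\<^sub>v v" using TS T v by simp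
    finally have "T *\<^sub>v ?w = 0\<^sub>v n"
      using S T v by (subst mult_minus_distrib_mat_vec[OF T]) auto
    with w ker have "?w = 0\<^sub>v m" by blast
    then have "(S * T) *\<^sub>v v = v"
    proof (intro eq_vecI)
      fix i assume "?w = 0\<^sub>v m" "i < dim_vec v"
      then have "?w $ i = 0" using v by auto
      then show "((S * T) *\<^sub>v v) $ i = v $ i" using \<open>i < dim_vec v\<close> v S by (simp del: index_mult_mat_vec)
    qed (use v S in auto)
    then show "(S * T) *\<^sub>v v = 1\<^sub>m m *\<^sub>v v" using v by simp
  qed (use S T in auto)
  from that[OF S this TS] show ?thesis .
qed

lemma Schur_intertwiner_distinct:
  assumes \<rho>: "irreducible_rep G n \<rho>" and \<sigma>: "irreducible_rep G m \<sigma>"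
    and T: "T \<in> carrier_mat n m"
    and comm: "\<And>x. x \<in> carrier G \<Longrightarrow> \<rho> x * T = T * \<sigma> x"
    and ne: "character_of G \<rho> \<noteq> character_of G \<sigma>"
  shows "T = 0\<^sub>m n m"
proof (rule ccontr)
  assume "T \<noteq> 0\<^sub>m n m"
  then obtain S where S: "S \<in> carrier_mat m n" "S * T = 1\<^sub>m m" "T * S = 1\<^sub>m n"
    using Schur_intertwiner[OF \<rho> \<sigma> T comm] by blast
  have "mat_trace (\<rho> x) = mat_trace (\<sigma> x)" if x: "x \<in> carrier G" for x
  proof -
    have c: "\<rho> x \<in> carrier_mat n n" "\<sigma> x \<in> carrier_mat m m"
      using \<rho> \<sigma> x rep_carrier by (auto simp: irreducible_rep_def)
    have "\<rho> x = \<rho> x * T * S" using c T S by simp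
    also have "\<dots> = T * (\<sigma> x * S)" unfolding comm[OF x] using c T S by simp
    also have "mat_trace \<dots> = mat_trace (\<sigma> x * S * T)"
      using c T S by (intro mat_trace_commute[of _ n m]) auto
    also have "\<sigma> x * S * T = \<sigma> x" using c T S by simp
    finally show ?thesis .
  qed
  then have "character_of G \<rho> = character_of G \<sigma>" by (auto simp: character_of_def)
  with ne show False by simp
qed

text \<open>
  Subtracting an eigenvalue from \<open>T\<close> leaves an intertwiner with a nontrivial kernel, which must be zero.
\<close>

lemma Schur_scalar:
  assumes \<rho>: "irreducible_rep G n \<rho>" and T: "T \<in> carrier_mat n n"
    and comm: "\<And>x. x \<in> carrier G \<Longrightarrow> \<rho> x * T = T * \<rho> x"
  obtains c where "T = c \<cdot>\<^sub>m 1\<^sub>m n"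
proof -
  have n: "n > 0" and rep: "representation G n \<rho>" using \<rho> by (auto simp: irreducible_rep_def)
  from spectrum_non_empty[OF T n] obtain c where "eigenvalue T c" by (auto simp: spectrum_def)
  then obtain v where v: "v \<in> carrier_vec n" "v \<noteq> 0\<^sub>v n" "T *\<^sub>v v = c \<cdot>\<^sub>v v"
    using T by (auto simp: eigenvalue_def eigenvector_def)
  define D where "D = T - c \<cdot>\<^sub>m 1\<^sub>m n"
  have D: "D \<in> carrier_mat n n" using T by (auto simp: D_def)
  have Dv: "D *\<^sub>v v = 0\<^sub>v n"
  proof -
    have "D *\<^sub>v v = T *\<^sub>v v - (c \<cdot>\<^sub>m 1\<^sub>m n) *\<^sub>v v"
      unfolding D_def using T v by (intro minus_mult_distrib_mat_vec) auto
    also have "(c \<cdot>\<^sub>m 1\<^sub>m n) *\<^sub>v v = c \<cdot>\<^sub>v v" using v by (intro eq_vecI) auto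
    finally show ?thesis using v by auto
  qed
  have "\<rho> x * D = D * \<rho> x" if x: "x \<in> carrier G" for x
  proof -
    note c = rep_carrier[OF rep x]
    have "\<rho> x * D = \<rho> x * T - \<rho> x * (c \<cdot>\<^sub>m 1\<^sub>m n)"
      unfolding D_def using T c by (intro mult_minus_distrib_mat) auto
    also have "\<dots> = T * \<rho> x - (c \<cdot>\<^sub>m 1\<^sub>m n) * \<rho> x"
      using c by (simp add: comm[OF x] mult_smult_distrib[OF c one_carrier_mat] mult_smult_assoc_mat[OF one_carrier_mat c])
    also have "\<dots> = D * \<rho> x"
      unfolding D_def using T c by (intro minus_mult_distrib_mat[symmetric]) auto
    finally show ?thesis .
  qed
  then have "D = 0\<^sub>m n n"
  proof (rule_tac ccontr)
    assume *: "\<And>x. x \<in> carrier G \<Longrightarrow> \<rho> x * D = D * \<rho> x" and "D \<noteq> 0\<^sub>m n n"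
    then obtain S where S: "S \<in> carrier_mat n n" "S * D = 1\<^sub>m n"
      using Schur_intertwiner[OF \<rho> \<rho> D] by metis
    have "v = S *\<^sub>v (D *\<^sub>v v)" using S(2) v(1) assoc_mult_mat_vec[OF S(1) D v(1)] by simp
    also have "\<dots> = 0\<^sub>v n" unfolding Dv using S(1) by (intro eq_vecI) (auto simp: scalar_prod_def)
    finally show False using v by simp
  qed
  have "T = c \<cdot>\<^sub>m 1\<^sub>m n"
  proof (rule eq_matI)
    fix i j assume "i < dim_row (c \<cdot>\<^sub>m 1\<^sub>m n)" "j < dim_col (c \<cdot>\<^sub>m 1\<^sub>m n)"
    then show "T $$ (i, j) = (c \<cdot>\<^sub>m 1\<^sub>m n) $$ (i, j)"
      using arg_cong[OF \<open>D = 0\<^sub>m n n\<close>, of "\<lambda>M. M $$ (i, j)"] T by (auto simp: D_def)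
  qed (use T in auto)
  then show ?thesis by (rule that)
qed

section \<open>Orthogonality relations and complex conjugation\<close>

lemma inv_mult_cancel_left: "x \<in> carrier G \<Longrightarrow> y \<in> carrier G \<Longrightarrow> inv x \<otimes> (x \<otimes> y) = y"
  by (simp flip: m_assoc)

lemma mult_inv_cancel_left: "x \<in> carrier G \<Longrightarrow> y \<in> carrier G \<Longrightarrow> x \<otimes> (inv x \<otimes> y) = y"
  by (simp flip: m_assoc)

lemma bij_left_mult: "y \<in> carrier G \<Longrightarrow> bij_betw (\<lambda>x. y \<otimes> x) (carrier G) (carrier G)"
  by (rule bij_betw_byWitness[of _ "\<lambda>x. inv y \<otimes> x"]) (auto simp: m_assoc[symmetric])

lemma bij_right_mult: "y \<in> carrier G \<Longrightarrow> bij_betw (\<lambda>x. x \<otimes> y) (carrier G) (carrier G)"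
  by (rule bij_betw_byWitness[of _ "\<lambda>x. x \<otimes> inv y"]) (auto simp: m_assoc)

lemma bij_inv: "bij_betw (\<lambda>x. inv x) (carrier G) (carrier G)"
  by (rule bij_betw_byWitness[of _ "\<lambda>x. inv x"]) auto

text \<open>
  Substituting \<open>y x\<close> for \<open>x\<close> in the sum moves \<open>\<rho> y\<close> to the front and \<open>\<sigma> y\<close> to the back.
\<close>

lemma averaged_intertwiner:
  assumes \<rho>: "representation G n \<rho>" and \<sigma>: "representation G m \<sigma>"
    and A: "A \<in> carrier_mat n m" and y: "y \<in> carrier G"
  defines "T \<equiv> msum n m (\<lambda>x. \<rho> x * A * \<sigma> (inv x)) (carrier G)"
  shows "\<rho> y * T = T * \<sigma> y"
proof -
  note c = rep_carrier[OF \<rho>] rep_carrier[OF \<sigma>]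
  have cT: "\<rho> x * A * \<sigma> (inv x) \<in> carrier_mat n m" if "x \<in> carrier G" for x
    using mult_carrier_mat[OF mult_carrier_mat[OF c(1)[OF that] A] c(2)[OF inv_closed[OF that]]] .
  have "T * \<sigma> y = msum n m (\<lambda>x. \<rho> x * A * \<sigma> (inv x) * \<sigma> y) (carrier G)"
    unfolding T_def using c y cT by (intro msum_mult) auto
  also have "\<dots> = msum n m (\<lambda>x. \<rho> (y \<otimes> x) * A * \<sigma> (inv (y \<otimes> x)) * \<sigma> y) (carrier G)"
    by (rule msum_reindex[symmetric, OF bij_left_mult[OF y]])
  also have "\<dots> = msum n m (\<lambda>x. \<rho> y * (\<rho> x * A * \<sigma> (inv x))) (carrier G)"
  proof (rule msum_cong)
    fix x assume x: "x \<in> carrier G"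
    have 1: "\<sigma> (inv (y \<otimes> x)) * \<sigma> y = \<sigma> (inv x)"
      using x y rep_mult[OF \<sigma>, of "inv (y \<otimes> x)" y] by (simp add: inv_mult_group m_assoc)
    have "\<rho> (y \<otimes> x) * A * \<sigma> (inv (y \<otimes> x)) * \<sigma> y = \<rho> (y \<otimes> x) * A * (\<sigma> (inv (y \<otimes> x)) * \<sigma> y)"
      using x y c A by (intro assoc_mult_mat[of _ n m _ m _ m]) (auto intro!: mult_carrier_mat[of _ n n])
    also have "\<dots> = \<rho> y * (\<rho> x * A * \<sigma> (inv x))"
      unfolding 1 rep_mult[OF \<rho> y x]
      using assoc_mult_mat[OF c(1)[OF y] c(1)[OF x] A]
        assoc_mult_mat[OF c(1)[OF y] mult_carrier_mat[OF c(1)[OF x] A] c(2)[OF inv_closed[OF x]]] by simp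
    finally show "\<rho> (y \<otimes> x) * A * \<sigma> (inv (y \<otimes> x)) * \<sigma> y = \<rho> y * (\<rho> x * A * \<sigma> (inv x))" .
  qed
  also have "\<dots> = \<rho> y * T"
    unfolding T_def using c y cT by (intro mult_msum[symmetric]) auto
  finally show ?thesis by simp
qed

lemma mult_matrix_unit_mult_entry:
  fixes P Q :: "complex mat"
  assumes "P \<in> carrier_mat r n" "Q \<in> carrier_mat m c" "i < n" "j < m" "k < r" "l < c"
  shows "(P * mat n m (\<lambda>(a, b). if a = i \<and> b = j then 1 else 0) * Q) $$ (k, l) = P $$ (k, i) * Q $$ (j, l)"
proof -
  let ?E = "mat n m (\<lambda>(a, b). if a = i \<and> b = j then 1 else 0) :: complex mat"
  have E: "?E \<in> carrier_mat n m" by simp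
  have PE: "P * ?E \<in> carrier_mat r m" using assms(1) by auto
  have "(P * ?E * Q) $$ (k, l) = (\<Sum>b<m. (\<Sum>a<n. P $$ (k, a) * (if a = i \<and> b = j then 1 else 0)) * Q $$ (b, l))"
    unfolding mult_mat_entry[OF PE assms(2,5,6)]
    by (intro sum.cong refl) (simp add: mult_mat_entry[OF assms(1) E assms(5)] del: index_mult_mat(1))
  also have "\<dots> = (\<Sum>b<m. if b = j then P $$ (k, i) * Q $$ (b, l) else 0)"
  proof (intro sum.cong refl)
    fix b
    have "(\<Sum>a<n. P $$ (k, a) * (if a = i \<and> b = j then 1 else 0)) = (\<Sum>a<n. if a = i then (if b = j then P $$ (k, a) else 0) else 0)"
      by (intro sum.cong) auto
    then show "(\<Sum>a<n. P $$ (k, a) * (if a = i \<and> b = j then 1 else 0)) * Q $$ (b, l) = (if b = j then P $$ (k, i) * Q $$ (b, l) else 0)"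
      using assms(3) by simp
  qed
  finally show ?thesis using assms(4) by simp
qed

text \<open>
  Averaging the matrix units over the group yields intertwiners between inequivalent representations,
  hence zero; the product of the two traces is a sum of entries of these averages. The pairing is
  bilinear, with \<open>\<psi> (inv x)\<close> in place of a complex conjugate.
\<close>

lemma row_orthogonality:
  assumes "\<chi> \<in> Irr G" "\<psi> \<in> Irr G" "\<chi> \<noteq> \<psi>"
  shows "(\<Sum>x\<in>carrier G. \<chi> x * \<psi> (inv x)) = 0"
proof -
  obtain n \<rho> where \<rho>: "irreducible_rep G n \<rho>" "representation G n \<rho>" "\<chi> = character_of G \<rho>"
    using assms(1) by (rule IrrE)
  obtain m \<sigma> where \<sigma>: "irreducible_rep G m \<sigma>" "representation G m \<sigma>" "\<psi> = character_of G \<sigma>"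
    using assms(2) by (rule IrrE)
  have entry: "(\<Sum>x\<in>carrier G. \<rho> x $$ (i, i) * \<sigma> (inv x) $$ (j, j)) = 0" if ij: "i < n" "j < m" for i j
  proof -
    define E :: "complex mat" where "E = mat n m (\<lambda>(a, b). if a = i \<and> b = j then 1 else 0)"
    have E: "E \<in> carrier_mat n m" by (simp add: E_def)
    have "msum n m (\<lambda>x. \<rho> x * E * \<sigma> (inv x)) (carrier G) = 0\<^sub>m n m"
      using averaged_intertwiner[OF \<rho>(2) \<sigma>(2) E] assms(3) \<rho>(3) \<sigma>(3)
      by (intro Schur_intertwiner_distinct[OF \<rho>(1) \<sigma>(1)]) auto
    then have "(\<Sum>x\<in>carrier G. (\<rho> x * E * \<sigma> (inv x)) $$ (i, j)) = 0"
      using ij by (metis msum_entry index_zero_mat(1))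
    then show ?thesis unfolding E_def
      using ij by (simp add: mult_matrix_unit_mult_entry[OF rep_carrier[OF \<rho>(2)] rep_carrier[OF \<sigma>(2)]]
          del: index_mult_mat(1) cong: sum.cong)
  qed
  have "(\<Sum>x\<in>carrier G. \<chi> x * \<psi> (inv x)) =
      (\<Sum>x\<in>carrier G. (\<Sum>i<n. \<rho> x $$ (i, i)) * (\<Sum>j<m. \<sigma> (inv x) $$ (j, j)))"
    by (intro sum.cong refl)
       (simp add: \<rho>(3) \<sigma>(3) character_of_eq mat_trace_carrier[OF rep_carrier[OF \<rho>(2)]] mat_trace_carrier[OF rep_carrier[OF \<sigma>(2)]])
  also have "\<dots> = (\<Sum>i<n. \<Sum>j<m. \<Sum>x\<in>carrier G. \<rho> x $$ (i, i) * \<sigma> (inv x) $$ (j, j))"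
    unfolding sum_product by (subst sum.swap, intro sum.cong refl, rule sum.swap)
  also have "\<dots> = 0" by (simp add: entry)
  finally show ?thesis .
qed

text \<open>
  Up to a scalar, \<open>\<chi>\<close> is an idempotent of the group algebra. The average of a matrix unit \<open>E\<close> is scalar,
  and its trace determines the scalar; multiplying the average by \<open>\<rho> y\<close> before comparing entries gives the
  value at \<open>y\<close>. At \<open>y = \<one>\<close> this is the norm of \<open>\<chi>\<close>.
\<close>

lemma irreducible_character_convolution:
  assumes "\<chi> \<in> Irr G" and y: "y \<in> carrier G"
  shows "\<chi> \<one> * (\<Sum>x\<in>carrier G. \<chi> x * \<chi> (inv x \<otimes> y)) = of_nat (card (carrier G)) * \<chi> y"
proof -
  obtain n \<rho> where \<rho>: "irreducible_rep G n \<rho>" "representation G n \<rho>" "n > 0" "\<chi> = character_of G \<rho>"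
    using assms(1) by (rule IrrE)
  note c = rep_carrier[OF \<rho>(2)]
  have entry: "of_nat n * (\<Sum>x\<in>carrier G. \<rho> x $$ (i, i) * \<rho> (inv x \<otimes> y) $$ (j, j)) =
      (if i = j then of_nat (card (carrier G)) * \<rho> y $$ (j, j) else 0)" if ij: "i < n" "j < n" for i j
  proof -
    define E :: "complex mat" where "E = mat n n (\<lambda>(a, b). if a = i \<and> b = j then 1 else 0)"
    have E: "E \<in> carrier_mat n n" by (simp add: E_def)
    define T where "T = msum n n (\<lambda>x. \<rho> x * E * \<rho> (inv x)) (carrier G)"
    have T: "T \<in> carrier_mat n n" by (simp add: T_def)
    have cc: "\<rho> x * E * \<rho> (inv x) \<in> carrier_mat n n" if "x \<in> carrier G" for x
      using that c E by (auto intro!: mult_carrier_mat[of _ n n])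
    obtain t where t: "T = t \<cdot>\<^sub>m 1\<^sub>m n"
      using averaged_intertwiner[OF \<rho>(2) \<rho>(2) E] by (auto simp: T_def intro: Schur_scalar[OF \<rho>(1) T])
    have "t * of_nat n = mat_trace T" by (simp add: t mat_trace_smult_one)
    also have "\<dots> = (\<Sum>x\<in>carrier G. mat_trace (\<rho> x * E * \<rho> (inv x)))"
      unfolding T_def using cc by (rule mat_trace_msum)
    also have "\<dots> = (\<Sum>x\<in>carrier G. mat_trace E)"
    proof (rule sum.cong[OF refl])
      fix x assume x: "x \<in> carrier G"
      have "mat_trace (\<rho> x * E * \<rho> (inv x)) = mat_trace (\<rho> (inv x) * (\<rho> x * E))"
        using x c E by (intro mat_trace_commute[of _ n n]) (auto intro!: mult_carrier_mat[of _ n n])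
      also have "\<rho> (inv x) * (\<rho> x * E) = E"
        using assoc_mult_mat[OF c[OF inv_closed[OF x]] c[OF x] E] rep_inv(2)[OF \<rho>(2) x] E by simp
      finally show "mat_trace (\<rho> x * E * \<rho> (inv x)) = mat_trace E" .
    qed
    also have "\<dots> = of_nat (card (carrier G)) * (if i = j then 1 else 0)"
      using ij by (simp add: mat_trace_def E_def)
    finally have tn: "t * of_nat n = of_nat (card (carrier G)) * (if i = j then 1 else 0)" .
    have "T * \<rho> y = msum n n (\<lambda>x. \<rho> x * E * \<rho> (inv x) * \<rho> y) (carrier G)"
      unfolding T_def using c y cc by (intro msum_mult) auto
    also have "\<dots> = msum n n (\<lambda>x. \<rho> x * E * \<rho> (inv x \<otimes> y)) (carrier G)"
    proof (rule msum_cong)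
      fix x assume x: "x \<in> carrier G"
      show "\<rho> x * E * \<rho> (inv x) * \<rho> y = \<rho> x * E * \<rho> (inv x \<otimes> y)"
        unfolding rep_mult[OF \<rho>(2) inv_closed[OF x] y]
        using x y c E by (intro assoc_mult_mat[of _ n n _ n _ n]) (auto intro!: mult_carrier_mat[of _ n n])
    qed
    finally have "(\<Sum>x\<in>carrier G. (\<rho> x * E * \<rho> (inv x \<otimes> y)) $$ (i, j)) = (T * \<rho> y) $$ (i, j)"
      using ij by simp
    also have "T * \<rho> y = t \<cdot>\<^sub>m \<rho> y"
      unfolding t using c[OF y] by (simp add: mult_smult_assoc_mat[OF one_carrier_mat c[OF y]])
    finally have "(\<Sum>x\<in>carrier G. \<rho> x $$ (i, i) * \<rho> (inv x \<otimes> y) $$ (j, j)) = t * \<rho> y $$ (i, j)"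
      unfolding E_def using ij y c[OF y]
      by (simp add: mult_matrix_unit_mult_entry[OF c c] del: index_mult_mat(1) cong: sum.cong)
    then have "of_nat n * (\<Sum>x\<in>carrier G. \<rho> x $$ (i, i) * \<rho> (inv x \<otimes> y) $$ (j, j)) =
        (t * of_nat n) * \<rho> y $$ (i, j)" by simp
    then show ?thesis unfolding tn by simp
  qed
  have "(\<Sum>x\<in>carrier G. \<chi> x * \<chi> (inv x \<otimes> y)) =
      (\<Sum>x\<in>carrier G. (\<Sum>i<n. \<rho> x $$ (i, i)) * (\<Sum>j<n. \<rho> (inv x \<otimes> y) $$ (j, j)))"
    using y by (intro sum.cong refl) (simp add: \<rho>(4) character_of_eq mat_trace_carrier[OF c])
  also have "\<dots> = (\<Sum>i<n. \<Sum>j<n. \<Sum>x\<in>carrier G. \<rho> x $$ (i, i) * \<rho> (inv x \<otimes> y) $$ (j, j))"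
    unfolding sum_product by (subst sum.swap, intro sum.cong refl, rule sum.swap)
  finally have "of_nat n * (\<Sum>x\<in>carrier G. \<chi> x * \<chi> (inv x \<otimes> y)) =
      (\<Sum>i<n. \<Sum>j<n. if i = j then of_nat (card (carrier G)) * \<rho> y $$ (j, j) else 0)"
    by (simp add: sum_distrib_left[where r = "of_nat n" and A = "{..<n}"] entry cong: sum.cong_simp)
  also have "\<dots> = of_nat (card (carrier G)) * \<chi> y"
    using y by (simp add: \<rho>(4) character_of_eq mat_trace_carrier[OF c] sum_distrib_left)
  finally show ?thesis using \<rho> by (simp add: character_of_one)
qed

text \<open>
  The matrix \<open>H = \<Sum> \<rho>(y)\<^sup>* \<rho>(y)\<close> is positive definite and satisfies \<open>\<rho>(x)\<^sup>* H \<rho>(x) = H\<close>. Thus \<open>\<rho>(x)\<^sup>-\<^sup>1\<close> is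
  similar to \<open>\<rho>(x)\<^sup>*\<close>.
\<close>

lemma character_of_inv:
  assumes \<rho>: "representation G n \<rho>" and x: "x \<in> carrier G"
  shows "character_of G \<rho> (inv x) = cnj (character_of G \<rho> x)"
proof -
  note c = rep_carrier[OF \<rho>]
  note ca = adjoint_mat_carrier[OF c]
  define H where "H = msum n n (\<lambda>y. adjoint_mat (\<rho> y) * \<rho> y) (carrier G)"
  have H: "H \<in> carrier_mat n n" by (simp add: H_def)
  have cH: "adjoint_mat (\<rho> y) * \<rho> y \<in> carrier_mat n n" if "y \<in> carrier G" for y
    using mult_carrier_mat[OF ca[OF that] c[OF that]] .
  have inv: "adjoint_mat (\<rho> x) * H * \<rho> x = H"
  proof -
    have "adjoint_mat (\<rho> x) * H * \<rho> x = msum n n (\<lambda>y. adjoint_mat (\<rho> x) * (adjoint_mat (\<rho> y) * \<rho> y) * \<rho> x) (carrier G)"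
      unfolding H_def using x c ca cH
      by (subst mult_msum[of _ n n], simp, blast, subst msum_mult[of _ n n]) (auto intro!: mult_carrier_mat[of _ n n])
    also have "\<dots> = msum n n (\<lambda>y. adjoint_mat (\<rho> (y \<otimes> x)) * \<rho> (y \<otimes> x)) (carrier G)"
    proof (rule msum_cong)
      fix y assume y: "y \<in> carrier G"
      show "adjoint_mat (\<rho> x) * (adjoint_mat (\<rho> y) * \<rho> y) * \<rho> x = adjoint_mat (\<rho> (y \<otimes> x)) * \<rho> (y \<otimes> x)"
        unfolding rep_mult[OF \<rho> y x] adjoint_mat_mult[OF c[OF y] c[OF x]]
        using assoc_mult_mat[OF ca[OF x] cH[OF y] c[OF x]] assoc_mult_mat[OF ca[OF y] c[OF y] c[OF x]]
          assoc_mult_mat[OF ca[OF x] ca[OF y] mult_carrier_mat[OF c[OF y] c[OF x]]] by simp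
    qed
    also have "\<dots> = H" unfolding H_def by (rule msum_reindex[OF bij_right_mult[OF x]])
    finally show ?thesis .
  qed
  have "det H \<noteq> 0"
  proof
    assume "det H = 0"
    then obtain v where v: "v \<in> carrier_vec n" "v \<noteq> 0\<^sub>v n" "H *\<^sub>v v = 0\<^sub>v n"
      using det_0_iff_vec_prod_zero[OF H] by blast
    \<comment> \<open>As a one-column matrix, a kernel vector of \<open>H\<close> can be tested with the trace form.\<close>
    define V where "V = mat n 1 (\<lambda>(i, j). v $ i)"
    have V: "V \<in> carrier_mat n 1" by (simp add: V_def)
    note aV = adjoint_mat_carrier[OF V]
    have HV: "H * V = 0\<^sub>m n 1"
    proof (rule eq_matI)
      fix i j assume "i < dim_row (0\<^sub>m n 1 :: complex mat)" "j < dim_col (0\<^sub>m n 1 :: complex mat)"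
      then have ij: "i < n" "j < 1" by auto
      have "(H * V) $$ (i, j) = (H *\<^sub>v v) $ i"
        unfolding mult_mat_entry[OF H V ij] mult_mat_vec_entry[OF H v(1) ij(1)]
        using ij(2) by (intro sum.cong refl) (simp add: V_def)
      then show "(H * V) $$ (i, j) = 0\<^sub>m n 1 $$ (i, j)" using ij v(3) by simp
    qed (use H V in auto)
    have cy: "\<rho> y * V \<in> carrier_mat n 1" if "y \<in> carrier G" for y by (rule mult_carrier_mat[OF c[OF that] V])
    have "0 = mat_trace (adjoint_mat V * (H * V))"
      unfolding HV using aV by (simp add: mat_trace_def)
    also have "adjoint_mat V * (H * V) = msum 1 1 (\<lambda>y. adjoint_mat V * (adjoint_mat (\<rho> y) * \<rho> y * V)) (carrier G)"
      unfolding H_def using V aV cH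
      by (subst msum_mult[of _ n 1], simp, blast, subst mult_msum[of _ 1 n]) (auto intro!: mult_carrier_mat[OF cH])
    also have "\<dots> = msum 1 1 (\<lambda>y. adjoint_mat (\<rho> y * V) * (\<rho> y * V)) (carrier G)"
    proof (rule msum_cong)
      fix y assume y: "y \<in> carrier G"
      show "adjoint_mat V * (adjoint_mat (\<rho> y) * \<rho> y * V) = adjoint_mat (\<rho> y * V) * (\<rho> y * V)"
        unfolding adjoint_mat_mult[OF c[OF y] V]
        using assoc_mult_mat[OF aV ca[OF y] mult_carrier_mat[OF c[OF y] V]] assoc_mult_mat[OF ca[OF y] c[OF y] V] by simp
    qed
    also have "mat_trace \<dots> = (\<Sum>y\<in>carrier G. mat_trace (adjoint_mat (\<rho> y * V) * (\<rho> y * V)))"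
      by (intro mat_trace_msum mult_carrier_mat[OF adjoint_mat_carrier[OF cy] cy])
    also have "\<dots> = of_real (\<Sum>y\<in>carrier G. \<Sum>i<1. \<Sum>l<n. (norm ((\<rho> y * V) $$ (l, i)))\<^sup>2)"
      unfolding of_real_sum[of _ "carrier G"]
      by (intro sum.cong refl) (simp only: adjoint_mat_mult_self_trace[OF cy])
    finally have "(\<Sum>y\<in>carrier G. \<Sum>i<1. \<Sum>l<n. (norm ((\<rho> y * V) $$ (l, i)))\<^sup>2) = 0"
      by (rule of_real_eq_0_iff[THEN iffD1, OF sym])
    then have "(\<Sum>i<1. \<Sum>l<n. (norm ((\<rho> \<one> * V) $$ (l, i)))\<^sup>2) = 0"
      by (subst (asm) sum_nonneg_eq_0_iff) (auto intro!: sum_nonneg simp del: index_mult_mat(1))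
    then have "mat_trace (adjoint_mat V * V) = 0"
      unfolding adjoint_mat_mult_self_trace[OF V] rep_one[OF \<rho>] using V by simp
    then have "V = 0\<^sub>m n 1" by (rule adjoint_mat_mult_self_eq_0[OF V])
    then have "v $ i = 0" if "i < n" for i
    proof -
      have "V $$ (i, 0) = 0" using \<open>V = 0\<^sub>m n 1\<close> that by simp
      then show ?thesis using that by (simp add: V_def)
    qed
    then have "v = 0\<^sub>v n" using v(1) by (intro eq_vecI) auto
    with v(2) show False by simp
  qed
  then obtain K where K: "K \<in> carrier_mat n n" "H * K = 1\<^sub>m n" "K * H = 1\<^sub>m n"
    using det_non_zero_imp_unit[OF H, of "()"] by (auto simp: Units_def ring_mat_simps)
  have xi: "inv x \<in> carrier G" using x by simp
  have "adjoint_mat (\<rho> x) * H = H * \<rho> (inv x)"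
  proof -
    have "adjoint_mat (\<rho> x) * H = adjoint_mat (\<rho> x) * H * (\<rho> x * \<rho> (inv x))"
      using rep_inv(1)[OF \<rho> x] ca[OF x] H by simp
    also have "\<dots> = adjoint_mat (\<rho> x) * H * \<rho> x * \<rho> (inv x)"
      by (rule assoc_mult_mat[symmetric, OF mult_carrier_mat[OF ca[OF x] H] c[OF x] c[OF xi]])
    finally show ?thesis by (simp add: inv)
  qed
  then have "K * (adjoint_mat (\<rho> x) * H) = \<rho> (inv x)"
    using assoc_mult_mat[OF K(1) H c[OF xi]] K(3) c[OF xi] by simp
  then have "mat_trace (\<rho> (inv x)) = mat_trace (K * (adjoint_mat (\<rho> x) * H))" by simp
  also have "\<dots> = mat_trace (adjoint_mat (\<rho> x) * H * K)"
    by (rule mat_trace_commute[OF K(1) mult_carrier_mat[OF ca[OF x] H]])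
  also have "adjoint_mat (\<rho> x) * H * K = adjoint_mat (\<rho> x)"
    using assoc_mult_mat[OF ca[OF x] H K(1)] K(2) ca[OF x] by simp
  also have "mat_trace \<dots> = cnj (mat_trace (\<rho> x))"
    using c[OF x] by (simp add: mat_trace_carrier[OF c[OF x]] mat_trace_carrier[OF ca[OF x]])
  finally show ?thesis using x by (simp add: character_of_eq)
qed

section \<open>Completeness of the irreducible characters\<close>

lemma subrepresentation:
  assumes R: "representation G n R" and W: "invariant_subspace G n R W"
  obtains m \<sigma> B L where "m \<le> n" "representation G m \<sigma>" "B \<in> carrier_mat n m" "L \<in> carrier_mat m n"
    "L * B = 1\<^sub>m m" "\<forall>x\<in>carrier G. R x * B = B * \<sigma> x"
    "\<forall>v\<in>carrier_vec m. B *\<^sub>v v \<in> W" "\<forall>w\<in>W. B *\<^sub>v (L *\<^sub>v w) = w"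
proof -
  note c = rep_carrier[OF R]
  obtain m B L where m: "m \<le> n" and B: "B \<in> carrier_mat n m" and L: "L \<in> carrier_mat m n"
    and LB: "L * B = 1\<^sub>m m" and BW: "\<And>v. v \<in> carrier_vec m \<Longrightarrow> B *\<^sub>v v \<in> W"
    and BL: "\<And>w. w \<in> W \<Longrightarrow> B *\<^sub>v (L *\<^sub>v w) = w"
    using W unfolding invariant_subspace_def by (metis subspace_parametrization)
  define \<sigma> where "\<sigma> x = L * (R x * B)" for x
  have cRB: "R x * B \<in> carrier_mat n m" if "x \<in> carrier G" for x using mult_carrier_mat[OF c[OF that] B] .
  have c\<sigma>: "\<sigma> x \<in> carrier_mat m m" if "x \<in> carrier G" for x
    unfolding \<sigma>_def using mult_carrier_mat[OF L cRB[OF that]] .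
  have comm: "R x * B = B * \<sigma> x" if x: "x \<in> carrier G" for x
  proof (rule mat_eqI_mult_vec[OF cRB[OF x] mult_carrier_mat[OF B c\<sigma>[OF x]]])
    fix v :: "complex vec" assume v: "v \<in> carrier_vec m"
    have RBv: "(R x * B) *\<^sub>v v = R x *\<^sub>v (B *\<^sub>v v)" by (rule assoc_mult_mat_vec[OF c[OF x] B v])
    then have "(R x * B) *\<^sub>v v \<in> W" using W BW[OF v] x unfolding invariant_subspace_def by simp
    then have "(R x * B) *\<^sub>v v = B *\<^sub>v (L *\<^sub>v ((R x * B) *\<^sub>v v))" by (simp add: BL)
    also have "\<dots> = (B * \<sigma> x) *\<^sub>v v"
      using assoc_mult_mat_vec[OF B c\<sigma>[OF x] v] assoc_mult_mat_vec[OF L cRB[OF x] v] by (simp only: \<sigma>_def)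
    finally show "(R x * B) *\<^sub>v v = (B * \<sigma> x) *\<^sub>v v" .
  qed
  have "representation G m \<sigma>"
  proof (rule representationI[OF c\<sigma>])
    fix x y assume x: "x \<in> carrier G" and y: "y \<in> carrier G"
    have "\<sigma> (x \<otimes> y) = L * (R x * (R y * B))"
      unfolding \<sigma>_def rep_mult[OF R x y] assoc_mult_mat[OF c[OF x] c[OF y] B] ..
    also have "R x * (R y * B) = R x * B * \<sigma> y"
      unfolding comm[OF y] using assoc_mult_mat[OF c[OF x] B c\<sigma>[OF y]] by simp
    also have "L * (R x * B * \<sigma> y) = \<sigma> x * \<sigma> y"
      unfolding \<sigma>_def[of x] using assoc_mult_mat[OF L cRB[OF x] c\<sigma>[OF y]] by simp
    finally show "\<sigma> (x \<otimes> y) = \<sigma> x * \<sigma> y" .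
  next
    show "\<sigma> \<one> = 1\<^sub>m m" unfolding \<sigma>_def rep_one[OF R] using B LB by simp
  qed
  from that[OF m this B L LB] comm BW BL show ?thesis by blast
qed

text \<open>
  Among all subrepresentations contained in the range of \<open>T\<close>, one of minimal positive degree is
  irreducible. It is recorded by the injection \<open>B\<close> into the ambient space; \<open>B = T C\<close> expresses that it lies
  in the range of \<open>T\<close>.
\<close>

lemma irreducible_subrepresentation:
  assumes R: "representation G n R" and T: "T \<in> carrier_mat n n" "T \<noteq> 0\<^sub>m n n"
    and comm: "\<And>x. x \<in> carrier G \<Longrightarrow> R x * T = T * R x"
  obtains m \<sigma> B C where "irreducible_rep G m \<sigma>" "B \<in> carrier_mat n m" "C \<in> carrier_mat n m"
    "B = T * C" "B \<noteq> 0\<^sub>m n m" "\<forall>x\<in>carrier G. R x * B = B * \<sigma> x"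
proof -
  note c = rep_carrier[OF R]
  define P where "P m \<longleftrightarrow> m > 0 \<and> (\<exists>\<sigma> B L C. representation G m \<sigma> \<and> B \<in> carrier_mat n m \<and>
      L \<in> carrier_mat m n \<and> L * B = 1\<^sub>m m \<and> C \<in> carrier_mat n m \<and> B = T * C \<and>
      (\<forall>x\<in>carrier G. R x * B = B * \<sigma> x))" for m
  have "\<exists>m. P m"
  proof -
    let ?W = "{T *\<^sub>v v | v. v \<in> carrier_vec n}"
    have "invariant_subspace G n R ?W"
      unfolding invariant_subspace_def subspace_iff
    proof (intro conjI ballI allI)
      show "?W \<subseteq> carrier_vec n" using T by auto
      have "T *\<^sub>v 0\<^sub>v n = 0\<^sub>v n" using T by (intro eq_vecI) (auto simp: scalar_prod_def)
      then show "0\<^sub>v n \<in> ?W" unfolding mem_Collect_eq by (intro exI[of _ "0\<^sub>v n"]) simp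
      fix v assume "v \<in> ?W"
      then obtain v' where v: "v = T *\<^sub>v v'" "v' \<in> carrier_vec n" by blast
      show "v + w \<in> ?W" if "w \<in> ?W" for w
      proof -
        obtain w' where w: "w = T *\<^sub>v w'" "w' \<in> carrier_vec n" using \<open>w \<in> ?W\<close> by blast
        show ?thesis unfolding mem_Collect_eq using v(2) w(2)
          by (intro exI[of _ "v' + w'"]) (simp add: v(1) w(1) mult_add_distrib_mat_vec[OF T(1)])
      qed
      show "a \<cdot>\<^sub>v v \<in> ?W" for a unfolding mem_Collect_eq using v(2)
        by (intro exI[of _ "a \<cdot>\<^sub>v v'"]) (simp add: v(1) mult_mat_vec[OF T(1)])
      show "R x *\<^sub>v v \<in> ?W" if x: "x \<in> carrier G" for x unfolding mem_Collect_eq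
        using v(2) c[OF x] assoc_mult_mat_vec[OF c[OF x] T(1) v(2)] assoc_mult_mat_vec[OF T(1) c[OF x] v(2)]
        by (intro exI[of _ "R x *\<^sub>v v'"]) (simp add: v(1) comm[OF x])
    qed
    then obtain m \<sigma> B L where "m \<le> n" and *: "representation G m \<sigma>" "B \<in> carrier_mat n m" "L \<in> carrier_mat m n"
      "L * B = 1\<^sub>m m" "\<forall>x\<in>carrier G. R x * B = B * \<sigma> x"
      "\<forall>v\<in>carrier_vec m. B *\<^sub>v v \<in> ?W" "\<forall>w\<in>?W. B *\<^sub>v (L *\<^sub>v w) = w"
      by (rule subrepresentation[OF R])
    obtain C where C: "C \<in> carrier_mat n m" "B = T * C"
      using matrix_range_factor[OF T(1) *(2)] *(6) by blast
    have "m > 0"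
    proof (rule ccontr)
      assume "\<not> m > 0"
      then have m: "m = 0" by simp
      have "T *\<^sub>v v = 0\<^sub>m n n *\<^sub>v v" if v: "v \<in> carrier_vec n" for v
      proof -
        have "T *\<^sub>v v = B *\<^sub>v (L *\<^sub>v (T *\<^sub>v v))" using v by (intro *(7)[rule_format, symmetric]) blast
        also have "\<dots> = 0\<^sub>v n" using *(2,3) m by (intro eq_vecI) (auto simp: scalar_prod_def)
        also have "\<dots> = 0\<^sub>m n n *\<^sub>v v" using v by (intro eq_vecI) (auto simp: scalar_prod_def)
        finally show ?thesis .
      qed
      then have "T = 0\<^sub>m n n" using T(1) by (intro mat_eqI_mult_vec[of _ n n]) auto
      with T(2) show False by simp
    qed
    then show ?thesis unfolding P_def using * C by blast
  qed
  then have Pm: "P (LEAST m. P m)" by (rule LeastI_ex)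
  define m where "m = (LEAST m. P m)"
  have m0: "m > 0" using Pm by (simp add: P_def m_def)
  obtain \<sigma> B L C where \<sigma>: "representation G m \<sigma>" and B: "B \<in> carrier_mat n m"
    and L: "L \<in> carrier_mat m n" and LB: "L * B = 1\<^sub>m m" and C: "C \<in> carrier_mat n m" and BC: "B = T * C"
    and RB: "\<And>x. x \<in> carrier G \<Longrightarrow> R x * B = B * \<sigma> x"
    using Pm unfolding P_def m_def by blast
  have "W = {0\<^sub>v m} \<or> W = carrier_vec m" if W: "invariant_subspace G m \<sigma> W" for W
  proof (rule disjCI)
    assume "W \<noteq> carrier_vec m"
    obtain m' \<sigma>' B' L' where m': "m' \<le> m" and \<sigma>': "representation G m' \<sigma>'" and B': "B' \<in> carrier_mat m m'"
      and L': "L' \<in> carrier_mat m' m" and LB': "L' * B' = 1\<^sub>m m'"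
      and RB': "\<forall>x\<in>carrier G. \<sigma> x * B' = B' * \<sigma>' x"
      and BW': "\<forall>v\<in>carrier_vec m'. B' *\<^sub>v v \<in> W" and BL': "\<forall>w\<in>W. B' *\<^sub>v (L' *\<^sub>v w) = w"
      by (rule subrepresentation[OF \<sigma> W])
    have Wc: "W \<subseteq> carrier_vec m" "0\<^sub>v m \<in> W" using W unfolding invariant_subspace_def subspace_iff by auto
    have "m' \<noteq> m"
    proof
      assume "m' = m"
      then have "B' * L' = 1\<^sub>m m" using mat_mult_left_right_inverse[of L' m B'] L' B' LB' by simp
      then have "v \<in> W" if "v \<in> carrier_vec m" for v
        using BW'[rule_format, of "L' *\<^sub>v v"] assoc_mult_mat_vec[OF B' L' that] L' that by simp
      with Wc \<open>W \<noteq> carrier_vec m\<close> show False by auto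
    qed
    then have "\<not> P m'" using m' not_less_Least[of m' P] unfolding m_def by simp
    moreover have "L' * L * (B * B') = 1\<^sub>m m'"
    proof -
      have "L' * L * (B * B') = L' * (L * (B * B'))" by (rule assoc_mult_mat[OF L' L mult_carrier_mat[OF B B']])
      also have "L * (B * B') = L * B * B'" by (rule assoc_mult_mat[OF L B B', symmetric])
      finally show ?thesis using LB LB' B' by simp
    qed
    moreover have "R x * (B * B') = B * B' * \<sigma>' x" if x: "x \<in> carrier G" for x
      using assoc_mult_mat[OF c[OF x] B B'] assoc_mult_mat[OF B rep_carrier[OF \<sigma> x] B']
        assoc_mult_mat[OF B B' rep_carrier[OF \<sigma>' x]] RB[OF x] RB' x by simp
    moreover have "B * B' = T * (C * B')" unfolding BC by (rule assoc_mult_mat[OF T(1) C B'])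
    ultimately have "m' = 0"
      unfolding P_def using \<sigma>' mult_carrier_mat[OF B B'] mult_carrier_mat[OF L' L] mult_carrier_mat[OF C B']
      by blast
    have "w = 0\<^sub>v m" if "w \<in> W" for w
    proof -
      have "w = B' *\<^sub>v (L' *\<^sub>v w)" using BL' that by simp
      also have "\<dots> = 0\<^sub>v m" using B' L' \<open>m' = 0\<close> by (intro eq_vecI) (auto simp: scalar_prod_def)
      finally show ?thesis .
    qed
    then show "W = {0\<^sub>v m}" using Wc(2) by blast
  qed
  then have "irreducible_rep G m \<sigma>" unfolding irreducible_rep_def using \<sigma> m0 by blast
  moreover have "B \<noteq> 0\<^sub>m n m"
  proof
    assume "B = 0\<^sub>m n m"
    then have "L * 0\<^sub>m n m = 1\<^sub>m m" using LB by simp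
    moreover have "L * 0\<^sub>m n m = 0\<^sub>m m m" using L by simp
    ultimately have "(0\<^sub>m m m :: complex mat) $$ (0, 0) = 1\<^sub>m m $$ (0, 0)" by simp
    then show False using m0 by simp
  qed
  ultimately show ?thesis using that[OF _ B C BC] RB by blast
qed

lemma character_of_Irr: "irreducible_rep G n \<rho> \<Longrightarrow> character_of G \<rho> \<in> Irr G"
  by (auto simp: Irr_def)

definition class_function :: "('a \<Rightarrow> complex) \<Rightarrow> bool" where
  "class_function f \<longleftrightarrow> (\<forall>x\<in>carrier G. \<forall>y\<in>carrier G. f (inv y \<otimes> x \<otimes> y) = f x)"

lemma class_functionD:
  "class_function f \<Longrightarrow> x \<in> carrier G \<Longrightarrow> y \<in> carrier G \<Longrightarrow> f (inv y \<otimes> x \<otimes> y) = f x"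
  by (simp add: class_function_def)

lemma Irr_class_function: "\<chi> \<in> Irr G \<Longrightarrow> class_function \<chi>"
  by (auto simp: class_function_def elim!: IrrE intro: character_of_class_function)

text \<open>
  The regular representation of \<open>G\<close> by permutation matrices, for an enumeration \<open>e\<close> of its elements.
\<close>

definition regular_rep :: "(nat \<Rightarrow> 'a) \<Rightarrow> 'a \<Rightarrow> complex mat" where
  "regular_rep e x = mat (card (carrier G)) (card (carrier G)) (\<lambda>(i, j). if e i = x \<otimes> e j then 1 else 0)"

lemma regular_rep_representation:
  assumes e: "bij_betw e {..<card (carrier G)} (carrier G)"
  shows "representation G (card (carrier G)) (regular_rep e)"
proof (rule representationI)
  let ?n = "card (carrier G)"
  have ec: "e i \<in> carrier G" if "i < ?n" for i using e that by (auto simp: bij_betw_def)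
  have inj: "e i = e j \<longleftrightarrow> i = j" if "i < ?n" "j < ?n" for i j
    using e that by (auto simp: bij_betw_def inj_on_def)
  show c: "regular_rep e x \<in> carrier_mat ?n ?n" for x by (simp add: regular_rep_def)
  show "regular_rep e (x \<otimes> y) = regular_rep e x * regular_rep e y"
    if x: "x \<in> carrier G" and y: "y \<in> carrier G" for x y
  proof (rule eq_matI)
    fix i j assume "i < dim_row (regular_rep e x * regular_rep e y)" "j < dim_col (regular_rep e x * regular_rep e y)"
    then have ij: "i < ?n" "j < ?n" by (auto simp: regular_rep_def)
    have "(regular_rep e x * regular_rep e y) $$ (i, j) =
        (\<Sum>l<?n. (if e i = x \<otimes> e l then 1 else 0) * (if e l = y \<otimes> e j then 1 else 0))"
      unfolding mult_mat_entry[OF c c ij] using ij by (intro sum.cong) (auto simp: regular_rep_def)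
    also have "\<dots> = (\<Sum>z\<in>carrier G. (if e i = x \<otimes> z then 1 else 0) * (if z = y \<otimes> e j then 1 else 0))"
      by (rule sum.reindex_bij_betw[OF e])
    also have "\<dots> = (\<Sum>z\<in>carrier G. if z = y \<otimes> e j then (if e i = x \<otimes> z then 1 else 0) else 0)"
      by (intro sum.cong) auto
    also have "\<dots> = (if e i = x \<otimes> (y \<otimes> e j) then 1 else 0)"
      using y ec[OF ij(2)] by simp
    also have "\<dots> = regular_rep e (x \<otimes> y) $$ (i, j)"
      using ij x y ec by (simp add: regular_rep_def m_assoc)
    finally show "regular_rep e (x \<otimes> y) $$ (i, j) = (regular_rep e x * regular_rep e y) $$ (i, j)" by simp
  qed (simp_all add: regular_rep_def)
  show "regular_rep e \<one> = 1\<^sub>m ?n"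
    by (rule eq_matI) (auto simp: regular_rep_def ec inj)
qed

lemma class_function_sum_commutes:
  assumes R: "representation G n R" and f: "class_function f" and y: "y \<in> carrier G"
  defines "T \<equiv> msum n n (\<lambda>x. f x \<cdot>\<^sub>m R x) (carrier G)"
  shows "R y * T = T * R y"
proof -
  note c = rep_carrier[OF R]
  have sc: "f x \<cdot>\<^sub>m R x \<in> carrier_mat n n" if "x \<in> carrier G" for x using c[OF that] by simp
  have bij: "bij_betw (\<lambda>x. inv y \<otimes> x \<otimes> y) (carrier G) (carrier G)"
    by (rule bij_betw_byWitness[of _ "\<lambda>x. y \<otimes> x \<otimes> inv y"])
       (use y in \<open>auto simp: m_assoc inv_mult_cancel_left mult_inv_cancel_left\<close>)
  have "R y * T = msum n n (\<lambda>x. R y * (f x \<cdot>\<^sub>m R x)) (carrier G)"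
    unfolding T_def by (rule mult_msum[OF c[OF y] sc])
  also have "\<dots> = msum n n (\<lambda>x. R y * (f (inv y \<otimes> x \<otimes> y) \<cdot>\<^sub>m R (inv y \<otimes> x \<otimes> y))) (carrier G)"
    by (rule msum_reindex[OF bij, symmetric])
  also have "\<dots> = msum n n (\<lambda>x. f x \<cdot>\<^sub>m R x * R y) (carrier G)"
  proof (rule msum_cong)
    fix x assume x: "x \<in> carrier G"
    have xy: "inv y \<otimes> x \<otimes> y \<in> carrier G" using x y by simp
    have "R y * R (inv y \<otimes> x \<otimes> y) = R (y \<otimes> (inv y \<otimes> x \<otimes> y))" by (rule rep_mult[OF R y xy, symmetric])
    also have "y \<otimes> (inv y \<otimes> x \<otimes> y) = x \<otimes> y" using x y by (simp add: m_assoc mult_inv_cancel_left)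
    also have "R (x \<otimes> y) = R x * R y" by (rule rep_mult[OF R x y])
    finally show "R y * (f (inv y \<otimes> x \<otimes> y) \<cdot>\<^sub>m R (inv y \<otimes> x \<otimes> y)) = f x \<cdot>\<^sub>m R x * R y"
      by (simp add: mult_smult_distrib[OF c[OF y] c[OF xy]] mult_smult_assoc_mat[OF c[OF x] c[OF y]] class_functionD[OF f x y])
  qed
  also have "\<dots> = T * R y" unfolding T_def by (rule msum_mult[OF c[OF y] sc, symmetric])
  finally show ?thesis .
qed

text \<open>
  Such a sum is scalar by Schur's lemma, and its trace is the given pairing.
\<close>

lemma class_function_sum_irreducible:
  assumes \<sigma>: "irreducible_rep G m \<sigma>" and f: "class_function f"
    and 0: "(\<Sum>x\<in>carrier G. f x * character_of G \<sigma> x) = 0"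
  shows "msum m m (\<lambda>x. f x \<cdot>\<^sub>m \<sigma> x) (carrier G) = 0\<^sub>m m m"
proof -
  have rep: "representation G m \<sigma>" and m: "m > 0" using \<sigma> by (auto simp: irreducible_rep_def)
  note c = rep_carrier[OF rep]
  let ?T = "msum m m (\<lambda>x. f x \<cdot>\<^sub>m \<sigma> x) (carrier G)"
  obtain t where t: "?T = t \<cdot>\<^sub>m 1\<^sub>m m"
    using class_function_sum_commutes[OF rep f] by (auto intro: Schur_scalar[OF \<sigma> msum_carrier])
  have "t * of_nat m = mat_trace ?T" unfolding t by (rule mat_trace_smult_one[symmetric])
  also have "\<dots> = (\<Sum>x\<in>carrier G. mat_trace (f x \<cdot>\<^sub>m \<sigma> x))"
    using c by (intro mat_trace_msum) auto
  also have "\<dots> = (\<Sum>x\<in>carrier G. f x * character_of G \<sigma> x)"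
  proof (rule sum.cong[OF refl])
    fix x assume x: "x \<in> carrier G"
    show "mat_trace (f x \<cdot>\<^sub>m \<sigma> x) = f x * character_of G \<sigma> x"
      using c[OF x] x by (simp add: mat_trace_def character_of_def sum_distrib_left)
  qed
  finally have "t = 0" using 0 m by simp
  then show ?thesis unfolding t by (intro eq_matI) auto
qed

text \<open>
  Let \<open>T\<close> be the action of \<open>\<Sum> f(x) x\<close> on the regular representation; its entries are the values of \<open>f\<close>.
  The adjoint of \<open>T\<close> is the action of the class function \<open>h(x) = cnj (f (inv x))\<close>, which is orthogonal to all
  irreducible characters as well, so \<open>T\<^sup>*\<close> kills every irreducible subrepresentation. But if \<open>T \<noteq> 0\<close>, then its
  range contains an irreducible subrepresentation, and the range of \<open>T\<close> meets the kernel of \<open>T\<^sup>*\<close> trivially.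
\<close>

lemma class_function_eq_0:
  assumes f: "class_function f" and orth: "\<And>\<psi>. \<psi> \<in> Irr G \<Longrightarrow> (\<Sum>x\<in>carrier G. f x * \<psi> x) = 0"
    and x: "x \<in> carrier G"
  shows "f x = 0"
proof (rule ccontr)
  assume fx: "f x \<noteq> 0"
  let ?n = "card (carrier G)"
  obtain e where "bij_betw e {0..<?n} (carrier G)" using ex_bij_betw_nat_finite[OF fin] by blast
  then have e: "bij_betw e {..<?n} (carrier G)" by (simp add: lessThan_atLeast0)
  have ec: "e i \<in> carrier G" if "i < ?n" for i using e that by (auto simp: bij_betw_def)
  define R where "R = regular_rep e"
  have R: "representation G ?n R" unfolding R_def by (rule regular_rep_representation[OF e])
  note c = rep_carrier[OF R]
  define T where "T h = msum ?n ?n (\<lambda>x. h x \<cdot>\<^sub>m R x) (carrier G)" for h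
  have T: "T h \<in> carrier_mat ?n ?n" for h by (simp add: T_def)
  have Tij: "T h $$ (i, j) = h (e i \<otimes> inv (e j))" if ij: "i < ?n" "j < ?n" for h i j
  proof -
    have "e i = x \<otimes> e j \<longleftrightarrow> x = e i \<otimes> inv (e j)" if "x \<in> carrier G" for x
      using inv_solve_right[of x "e i" "e j"] that ec ij by auto
    then have "T h $$ (i, j) = (\<Sum>x\<in>carrier G. if x = e i \<otimes> inv (e j) then h x else 0)"
      unfolding T_def msum_entry[OF ij] using ij ec
      by (intro sum.cong refl) (auto simp: R_def regular_rep_def)
    then show ?thesis using ec ij by simp
  qed
  have "T f \<noteq> 0\<^sub>m ?n ?n"
  proof
    assume T0: "T f = 0\<^sub>m ?n ?n"
    have "x \<in> e ` {..<?n}" "\<one> \<in> e ` {..<?n}" using x by (simp_all add: bij_betw_imp_surj_on[OF e])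
    then obtain i j where i: "i < ?n" "e i = x" and j: "j < ?n" "e j = \<one>" by (metis imageE lessThan_iff)
    have "T f $$ (i, j) = f x" using Tij[OF i(1) j(1)] i j x by simp
    then show False using T0 fx i j by simp
  qed
  then obtain m \<sigma> B C where \<sigma>: "irreducible_rep G m \<sigma>" and B: "B \<in> carrier_mat ?n m"
    and C: "C \<in> carrier_mat ?n m" and BC: "B = T f * C" and B0: "B \<noteq> 0\<^sub>m ?n m"
    and RB: "\<forall>x\<in>carrier G. R x * B = B * \<sigma> x"
    by (rule irreducible_subrepresentation[OF R T _ class_function_sum_commutes[OF R f, folded T_def]])
  have rep: "representation G m \<sigma>" using \<sigma> by (simp add: irreducible_rep_def)
  note cs = rep_carrier[OF rep]
  define h where "h x = cnj (f (inv x))" for x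
  have h: "class_function h"
    unfolding class_function_def
  proof (intro ballI)
    fix x y assume x: "x \<in> carrier G" and y: "y \<in> carrier G"
    have "inv (inv y \<otimes> x \<otimes> y) = inv y \<otimes> inv x \<otimes> y" using x y by (simp add: inv_mult_group m_assoc)
    then show "h (inv y \<otimes> x \<otimes> y) = h x" using class_functionD[OF f, of "inv x" y] x y by (simp add: h_def)
  qed
  have adj: "adjoint_mat (T f) = T h"
  proof (rule eq_matI)
    fix i j assume "i < dim_row (T h)" "j < dim_col (T h)"
    then have ij: "i < ?n" "j < ?n" by (auto simp: T_def)
    have "inv (e i \<otimes> inv (e j)) = e j \<otimes> inv (e i)" using ec ij by (simp add: inv_mult_group)
    then show "adjoint_mat (T f) $$ (i, j) = T h $$ (i, j)"
      using ij by (simp add: adjoint_mat_entry[OF T] Tij h_def)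
  qed (auto simp: adjoint_mat_def T_def)
  have "(\<Sum>x\<in>carrier G. h x * character_of G \<sigma> x) = (\<Sum>x\<in>carrier G. h (inv x) * character_of G \<sigma> (inv x))"
    by (rule sum.reindex_bij_betw[OF bij_inv, symmetric])
  also have "\<dots> = cnj (\<Sum>x\<in>carrier G. f x * character_of G \<sigma> x)"
    by (simp add: h_def character_of_inv[OF rep])
  also have "\<dots> = 0" using orth[OF character_of_Irr[OF \<sigma>]] by simp
  finally have Th: "msum m m (\<lambda>x. h x \<cdot>\<^sub>m \<sigma> x) (carrier G) = 0\<^sub>m m m"
    by (rule class_function_sum_irreducible[OF \<sigma> h])
  have "T h * B = msum ?n m (\<lambda>x. (h x \<cdot>\<^sub>m R x) * B) (carrier G)"
    unfolding T_def using c by (intro msum_mult[OF B]) auto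
  also have "\<dots> = msum ?n m (\<lambda>x. B * (h x \<cdot>\<^sub>m \<sigma> x)) (carrier G)"
    by (rule msum_cong) (simp add: mult_smult_assoc_mat[OF c B] mult_smult_distrib[OF B cs] RB)
  also have "\<dots> = B * msum m m (\<lambda>x. h x \<cdot>\<^sub>m \<sigma> x) (carrier G)"
    using cs by (intro mult_msum[OF B, symmetric]) auto
  also have "\<dots> = 0\<^sub>m ?n m" unfolding Th using B by simp
  finally have ThB: "T h * B = 0\<^sub>m ?n m" .
  have "adjoint_mat B * B = adjoint_mat C * T h * B"
    unfolding adj[symmetric] by (subst BC) (simp only: adjoint_mat_mult[OF T C])
  also have "\<dots> = adjoint_mat C * (T h * B)" by (rule assoc_mult_mat[OF adjoint_mat_carrier[OF C] T B])
  also have "\<dots> = 0\<^sub>m m m" unfolding ThB using adjoint_mat_carrier[OF C] by simp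
  finally have "mat_trace (adjoint_mat B * B) = 0" by (simp add: mat_trace_def)
  then show False using adjoint_mat_mult_self_eq_0[OF B] B0 by blast
qed

section \<open>Characters and normal subgroups\<close>

text \<open>
  The sum \<open>T\<close> of \<open>\<rho>\<close> over \<open>N\<close> commutes with \<open>\<rho>\<close>, hence is scalar. Moreover \<open>\<rho> y T = T\<close> for \<open>y \<in> N\<close>, so
  a nonzero scalar forces \<open>\<rho> y = 1\<close>, while the scalar zero makes the trace vanish.
\<close>

lemma sum_normal_subgroup:
  assumes \<rho>: "irreducible_rep G n \<rho>" and N: "N \<lhd> G"
  shows "(\<forall>x\<in>N. \<rho> x = 1\<^sub>m n) \<or> (\<Sum>x\<in>N. character_of G \<rho> x) = 0"
proof -
  interpret N: normal N G by fact
  have rep: "representation G n \<rho>" using \<rho> by (simp add: irreducible_rep_def)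
  note c = rep_carrier[OF rep]
  define T where "T = msum n n \<rho> N"
  have T: "T \<in> carrier_mat n n" by (simp add: T_def)
  have cN: "x \<in> N \<Longrightarrow> \<rho> x \<in> carrier_mat n n" for x using c N.subset by auto
  have "\<rho> y * T = T * \<rho> y" if y: "y \<in> carrier G" for y
  proof -
    have bij: "bij_betw (\<lambda>x. y \<otimes> x \<otimes> inv y) N N"
      by (rule bij_betw_byWitness[of _ "\<lambda>x. inv y \<otimes> x \<otimes> y"])
         (use y N.subset N.inv_op_closed1 N.inv_op_closed2 in
            \<open>auto simp: m_assoc subset_iff inv_mult_cancel_left mult_inv_cancel_left\<close>)
    have "T * \<rho> y = msum n n (\<lambda>x. \<rho> x * \<rho> y) N"
      unfolding T_def using cN c y by (intro msum_mult) auto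
    also have "\<dots> = msum n n (\<lambda>x. \<rho> (y \<otimes> x \<otimes> inv y) * \<rho> y) N"
      by (rule msum_reindex[symmetric, OF bij])
    also have "\<dots> = msum n n (\<lambda>x. \<rho> y * \<rho> x) N"
    proof (rule msum_cong)
      fix x assume "x \<in> N"
      then have x: "x \<in> carrier G" using N.subset by auto
      have "\<rho> (y \<otimes> x \<otimes> inv y) * \<rho> y = \<rho> (y \<otimes> x \<otimes> inv y \<otimes> y)"
        using x y by (simp add: rep_mult[OF rep])
      also have "y \<otimes> x \<otimes> inv y \<otimes> y = y \<otimes> x" using x y by (simp add: m_assoc)
      finally show "\<rho> (y \<otimes> x \<otimes> inv y) * \<rho> y = \<rho> y * \<rho> x" using x y by (simp add: rep_mult[OF rep])
    qed
    also have "\<dots> = \<rho> y * T" unfolding T_def using cN c y by (intro mult_msum[symmetric]) auto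
    finally show ?thesis by simp
  qed
  then obtain t where t: "T = t \<cdot>\<^sub>m 1\<^sub>m n" by (auto intro: Schur_scalar[OF \<rho> T])
  show ?thesis
  proof (cases "t = 0")
    case True
    have "(\<Sum>x\<in>N. character_of G \<rho> x) = mat_trace T"
      unfolding T_def using cN N.subset by (subst mat_trace_msum) (auto intro!: sum.cong simp: character_of_eq)
    also have "\<dots> = 0" by (simp add: t mat_trace_smult_one True)
    finally show ?thesis by simp
  next
    case False
    have "\<rho> y = 1\<^sub>m n" if y: "y \<in> N" for y
    proof -
      have yc: "y \<in> carrier G" using y N.subset by auto
      have bij: "bij_betw (\<lambda>x. y \<otimes> x) N N"
        by (rule bij_betw_byWitness[of _ "\<lambda>x. inv y \<otimes> x"]) (use y N.subset in \<open>auto simp: m_assoc[symmetric] subset_iff\<close>)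
      have "\<rho> y * T = msum n n (\<lambda>x. \<rho> y * \<rho> x) N"
        unfolding T_def using cN y by (intro mult_msum) auto
      also have "\<dots> = msum n n (\<lambda>x. \<rho> (y \<otimes> x)) N"
        using N.subset yc by (intro msum_cong) (auto simp: rep_mult[OF rep])
      also have "\<dots> = T" unfolding T_def by (rule msum_reindex[OF bij])
      finally have "t \<cdot>\<^sub>m \<rho> y = t \<cdot>\<^sub>m 1\<^sub>m n"
        unfolding t using cN[OF y] by (simp add: mult_smult_distrib[OF cN[OF y] one_carrier_mat])
      then show ?thesis using False cN[OF y] by (auto simp: mat_eq_iff)
    qed
    then show ?thesis by blast
  qed
qed

lemma sum_over_normal_subgroup:
  assumes \<psi>: "\<psi> \<in> Irr G" and N: "N \<lhd> G"
  shows "(\<Sum>x\<in>N. \<psi> x) = (if N \<subseteq> char_ker G \<psi> then of_nat (card N) * \<psi> \<one> else 0)"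
proof -
  obtain n \<rho> where \<rho>: "irreducible_rep G n \<rho>" "representation G n \<rho>" "\<psi> = character_of G \<rho>"
    using \<psi> by (rule IrrE)
  have NG: "N \<subseteq> carrier G" using N by (simp add: normal_imp_subgroup subgroup.subset)
  show ?thesis
  proof (cases "N \<subseteq> char_ker G \<psi>")
    case True
    then have "(\<Sum>x\<in>N. \<psi> x) = (\<Sum>x\<in>N. \<psi> \<one>)" by (intro sum.cong) (auto simp: char_ker_def)
    then show ?thesis using True by simp
  next
    case False
    then obtain x where x: "x \<in> N" "\<psi> x \<noteq> \<psi> \<one>" using NG by (auto simp: char_ker_def)
    then have "\<rho> x \<noteq> 1\<^sub>m n" using NG \<rho>(3) rep_one[OF \<rho>(2)] by (auto simp: character_of_eq)
    then show ?thesis using sum_normal_subgroup[OF \<rho>(1) N] x False \<rho>(3) by auto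
  qed
qed

text \<open>
  The set \<open>char_ker\<close> is defined by character values only. On a normal subgroup these determine the
  representation, because the character does not sum to zero over it.
\<close>

lemma rep_trivial_on_normal_subgroup:
  assumes \<rho>: "irreducible_rep G n \<rho>" and N: "N \<lhd> G" "N \<subseteq> char_ker G (character_of G \<rho>)" and x: "x \<in> N"
  shows "\<rho> x = 1\<^sub>m n"
proof -
  have rep: "representation G n \<rho>" "n > 0" using \<rho> by (auto simp: irreducible_rep_def)
  interpret N: normal N G by fact
  have "finite N" by (rule finite_subset[OF N.subset fin])
  then have "card N > 0" unfolding card_gt_0_iff using N.one_closed by blast
  then have "(\<Sum>x\<in>N. character_of G \<rho> x) \<noteq> 0"
    using sum_over_normal_subgroup[OF character_of_Irr[OF \<rho>] N(1)] N(2) rep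
    by (simp add: character_of_one)
  then show ?thesis using sum_normal_subgroup[OF \<rho> N(1)] x by blast
qed

text \<open>
  Let \<open>K \<supseteq> N\<close> be the common kernel of all irreducible representations that are trivial on \<open>N\<close>. An
  irreducible character has the same mean value over \<open>K\<close> as over \<open>N\<close>: its degree if it is trivial on \<open>N\<close>, and
  zero otherwise. By completeness the normalised indicators of \<open>K\<close> and \<open>N\<close> coincide.
\<close>

lemma normal_subgroup_separation:
  assumes N: "N \<lhd> G" and x: "x \<in> carrier G"
    and triv: "\<And>n \<rho>. irreducible_rep G n \<rho> \<Longrightarrow> (\<And>y. y \<in> N \<Longrightarrow> \<rho> y = 1\<^sub>m n) \<Longrightarrow> \<rho> x = 1\<^sub>m n"
  shows "x \<in> N"
proof -
  interpret N: normal N G by fact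
  define K where "K = {y \<in> carrier G. \<forall>n \<rho>. irreducible_rep G n \<rho> \<longrightarrow> (\<forall>z\<in>N. \<rho> z = 1\<^sub>m n) \<longrightarrow> \<rho> y = 1\<^sub>m n}"
  have rep: "irreducible_rep G n \<rho> \<Longrightarrow> representation G n \<rho>" for n \<rho> by (simp add: irreducible_rep_def)
  have K: "K \<lhd> G"
  proof (rule normal_invI)
    show "subgroup K G"
    proof (rule subgroupI)
      show "K \<subseteq> carrier G" "K \<noteq> {}" using rep_one rep by (auto simp: K_def)
      fix a b assume a: "a \<in> K" and b: "b \<in> K"
      then have "a \<in> carrier G" "b \<in> carrier G" by (auto simp: K_def)
      moreover have "\<rho> (a \<otimes> b) = 1\<^sub>m n" if "irreducible_rep G n \<rho>" "\<forall>z\<in>N. \<rho> z = 1\<^sub>m n" for n \<rho>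
      proof -
        have "\<rho> a = 1\<^sub>m n" "\<rho> b = 1\<^sub>m n" using that a b by (auto simp: K_def)
        then show ?thesis using rep_mult[OF rep[OF that(1)] \<open>a \<in> carrier G\<close> \<open>b \<in> carrier G\<close>] by simp
      qed
      ultimately show "a \<otimes> b \<in> K" by (simp add: K_def)
      show "inv a \<in> K"
        unfolding K_def
      proof (intro CollectI conjI allI impI)
        show "inv a \<in> carrier G" using a by (simp add: K_def)
        fix n \<rho> assume \<rho>: "irreducible_rep G n \<rho>" "\<forall>z\<in>N. \<rho> z = 1\<^sub>m n"
        then have "\<rho> a = 1\<^sub>m n" "a \<in> carrier G" using a by (auto simp: K_def)
        then show "\<rho> (inv a) = 1\<^sub>m n"
          using rep_inv(2)[OF rep[OF \<rho>(1)], of a] rep_carrier[OF rep[OF \<rho>(1)], of "inv a"] by simp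
      qed
    qed
    fix a h assume a: "a \<in> carrier G" and h: "h \<in> K"
    show "a \<otimes> h \<otimes> inv a \<in> K"
      unfolding K_def
    proof (intro CollectI conjI allI impI)
      show "a \<otimes> h \<otimes> inv a \<in> carrier G" using a h by (simp add: K_def)
      fix n \<rho> assume \<rho>: "irreducible_rep G n \<rho>" "\<forall>z\<in>N. \<rho> z = 1\<^sub>m n"
      then have "\<rho> h = 1\<^sub>m n" "h \<in> carrier G" using h by (auto simp: K_def)
      then show "\<rho> (a \<otimes> h \<otimes> inv a) = 1\<^sub>m n"
        using rep_inv(1)[OF rep[OF \<rho>(1)] a] rep_carrier[OF rep[OF \<rho>(1)] a] a
        by (simp add: rep_mult[OF rep[OF \<rho>(1)]])
    qed
  qed
  interpret K: normal K G by fact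
  have NK: "N \<subseteq> K" unfolding K_def using N.subset by blast
  have pos: "card N > 0" "card K > 0"
    unfolding card_gt_0_iff using N.one_closed K.one_closed finite_subset[OF N.subset fin] finite_subset[OF K.subset fin]
    by blast+
  define f where "f y = (if y \<in> K then 1 / of_nat (card K) else 0) - (if y \<in> N then 1 / of_nat (card N) else 0 :: complex)" for y
  have conj_iff: "inv b \<otimes> a \<otimes> b \<in> L \<longleftrightarrow> a \<in> L" if "L \<lhd> G" "a \<in> carrier G" "b \<in> carrier G" for L a b
  proof -
    interpret L: normal L G by fact
    have "b \<otimes> (inv b \<otimes> a \<otimes> b) \<otimes> inv b = a" using that by (simp add: m_assoc mult_inv_cancel_left)
    then show ?thesis using L.inv_op_closed1[of b a] L.inv_op_closed2[of b "inv b \<otimes> a \<otimes> b"] that by auto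
  qed
  have f: "class_function f" unfolding class_function_def f_def using conj_iff[OF N] conj_iff[OF K] by simp
  have sum_f: "(\<Sum>y\<in>carrier G. f y * \<psi> y) = (\<Sum>y\<in>K. \<psi> y) / of_nat (card K) - (\<Sum>y\<in>N. \<psi> y) / of_nat (card N)" for \<psi>
  proof -
    have "(\<Sum>y\<in>carrier G. (if y \<in> L then 1 / of_nat (card L) else 0) * \<psi> y) = (\<Sum>y\<in>L. \<psi> y) / of_nat (card L)"
      if "L \<subseteq> carrier G" for L
    proof -
      have "(\<Sum>y\<in>carrier G. (if y \<in> L then 1 / of_nat (card L) else 0) * \<psi> y) = (\<Sum>y\<in>L. \<psi> y / of_nat (card L))"
        using that by (intro sum.mono_neutral_cong_right) auto
      then show ?thesis by (simp add: sum_divide_distrib)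
    qed
    then show ?thesis using N.subset K.subset by (simp add: f_def left_diff_distrib sum_subtractf)
  qed
  have "f x = 0"
  proof (rule class_function_eq_0[OF f _ x])
    fix \<psi> assume \<psi>: "\<psi> \<in> Irr G"
    then obtain n \<rho> where \<rho>: "irreducible_rep G n \<rho>" "representation G n \<rho>" "\<psi> = character_of G \<rho>" by (rule IrrE)
    have "N \<subseteq> char_ker G \<psi> \<longleftrightarrow> K \<subseteq> char_ker G \<psi>"
    proof
      assume "K \<subseteq> char_ker G \<psi>" then show "N \<subseteq> char_ker G \<psi>" using NK by auto
    next
      assume "N \<subseteq> char_ker G \<psi>"
      then have "\<forall>z\<in>N. \<rho> z = 1\<^sub>m n" using rep_trivial_on_normal_subgroup[OF \<rho>(1) N] \<rho>(3) by auto
      then have "\<rho> y = 1\<^sub>m n" if "y \<in> K" for y using that \<rho>(1) unfolding K_def by blast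
      then show "K \<subseteq> char_ker G \<psi>"
        using K.subset rep_one[OF \<rho>(2)] by (auto simp: char_ker_def \<rho>(3) character_of_eq)
    qed
    then show "(\<Sum>y\<in>carrier G. f y * \<psi> y) = 0"
      unfolding sum_f sum_over_normal_subgroup[OF \<psi> N] sum_over_normal_subgroup[OF \<psi> K] using pos by simp
  qed
  moreover have "x \<in> K" unfolding K_def using x triv by blast
  ultimately show ?thesis using pos by (auto simp: f_def split: if_splits)
qed

text \<open>
  By Schur's lemma all matrices are scalar, so the first coordinate axis is invariant.
\<close>

lemma irreducible_commuting_degree_1:
  assumes \<rho>: "irreducible_rep G n \<rho>"
    and comm: "\<And>x y. x \<in> carrier G \<Longrightarrow> y \<in> carrier G \<Longrightarrow> \<rho> x * \<rho> y = \<rho> y * \<rho> x"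
  shows "n = 1"
proof -
  have rep: "representation G n \<rho>" "n > 0" using \<rho> by (auto simp: irreducible_rep_def)
  let ?W = "{v \<in> carrier_vec n. \<forall>i<n. i \<noteq> 0 \<longrightarrow> v $ i = (0::complex)}"
  have "?W = {0\<^sub>v n} \<or> ?W = carrier_vec n"
  proof (rule irreducible_repD[OF \<rho>])
    fix x v assume x: "x \<in> carrier G" and v: "v \<in> ?W"
    obtain t where t: "\<rho> x = t \<cdot>\<^sub>m 1\<^sub>m n"
      using comm[OF _ x] by (auto intro: Schur_scalar[OF \<rho> rep_carrier[OF rep(1) x]])
    have "\<rho> x *\<^sub>v v = t \<cdot>\<^sub>v v" unfolding t using v by (intro eq_vecI) auto
    then show "\<rho> x *\<^sub>v v \<in> ?W" using v by auto
  qed auto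
  moreover have "?W \<noteq> {0\<^sub>v n}"
  proof
    assume "?W = {0\<^sub>v n}"
    moreover have "vec n (\<lambda>i. if i = 0 then 1 else 0) \<in> ?W" by auto
    ultimately have "vec n (\<lambda>i. if i = 0 then 1 else 0) = (0\<^sub>v n :: complex vec)" by blast
    then have "vec n (\<lambda>i. if i = 0 then 1 else 0) $ 0 = (0\<^sub>v n :: complex vec) $ 0" by (rule arg_cong)
    then show False using rep(2) by simp
  qed
  ultimately have W: "?W = carrier_vec n" by blast
  show "n = 1"
  proof (rule ccontr)
    assume "n \<noteq> 1"
    then have n: "1 < n" using rep(2) by simp
    have "vec n (\<lambda>i. 1 :: complex) \<in> ?W" unfolding W by simp
    then have "vec n (\<lambda>i. 1 :: complex) $ 1 = 0" using n by auto
    then show False using n by simp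
  qed
qed

text \<open>
  An irreducible representation that is trivial on the derived subgroup has commuting values, hence
  degree one; so elements outside the derived subgroup are detected by linear characters. These never vanish,
  which is the form in which the second condition of the theorem can be applied to them.
\<close>

lemma derived_subgroup_separation:
  assumes x: "x \<in> carrier G"
    and triv: "\<And>\<psi>. \<psi> \<in> Irr G \<Longrightarrow> \<psi> \<one> = 1 \<Longrightarrow> (\<And>y. y \<in> carrier G \<Longrightarrow> \<psi> y \<noteq> 0) \<Longrightarrow> \<psi> x = 1"
  shows "x \<in> derived G (carrier G)"
proof (rule normal_subgroup_separation[OF derived_self_is_normal x])
  fix n \<rho> assume \<rho>: "irreducible_rep G n \<rho>" and tr: "\<And>y. y \<in> derived G (carrier G) \<Longrightarrow> \<rho> y = 1\<^sub>m n"
  have rep: "representation G n \<rho>" using \<rho> by (auto simp: irreducible_rep_def)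
  note c = rep_carrier[OF rep]
  have n: "n = 1"
  proof (rule irreducible_commuting_degree_1[OF \<rho>])
    fix a b assume a: "a \<in> carrier G" and b: "b \<in> carrier G"
    have "a \<otimes> b \<otimes> inv a \<otimes> inv b \<in> derived G (carrier G)"
      unfolding derived_def using a b by (intro generate.incl) auto
    then have "\<rho> (a \<otimes> b \<otimes> inv a \<otimes> inv b) = 1\<^sub>m n" by (rule tr)
    moreover have "a \<otimes> b = (a \<otimes> b \<otimes> inv a \<otimes> inv b) \<otimes> (b \<otimes> a)" using a b by (simp add: m_assoc inv_mult_cancel_left)
    moreover have "\<rho> ((a \<otimes> b \<otimes> inv a \<otimes> inv b) \<otimes> (b \<otimes> a)) = \<rho> (a \<otimes> b \<otimes> inv a \<otimes> inv b) * \<rho> (b \<otimes> a)"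
      using a b by (intro rep_mult[OF rep]) auto
    ultimately have "\<rho> (a \<otimes> b) = \<rho> (b \<otimes> a)" using c[of "b \<otimes> a"] a b by simp
    then show "\<rho> a * \<rho> b = \<rho> b * \<rho> a" using a b by (simp add: rep_mult[OF rep])
  qed
  have tr1: "mat_trace A = A $$ (0, 0)" if "A \<in> carrier_mat 1 1" for A :: "complex mat"
    using that by (simp add: mat_trace_def)
  have val: "character_of G \<rho> y = \<rho> y $$ (0, 0)" if "y \<in> carrier G" for y
    using tr1 c[OF that] n that by (simp add: character_of_eq)
  have "character_of G \<rho> y \<noteq> 0" if y: "y \<in> carrier G" for y
  proof
    assume "character_of G \<rho> y = 0"
    then have "\<rho> y = 0\<^sub>m n n" using val[OF y] c[OF y] n by (intro eq_matI) auto
    then have "(0\<^sub>m n n :: complex mat) = 1\<^sub>m n" using rep_inv(1)[OF rep y] c[of "inv y"] y by simp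
    then have "(0\<^sub>m n n :: complex mat) $$ (0, 0) = 1\<^sub>m n $$ (0, 0)" by simp
    then show False using n by simp
  qed
  then have "character_of G \<rho> x = 1"
    using triv[OF character_of_Irr[OF \<rho>]] n by (simp add: character_of_one[OF rep])
  then show "\<rho> x = 1\<^sub>m n" using val[OF x] c[OF x] n by (intro eq_matI) auto
qed

lemma trivial_character: "(\<lambda>x\<in>carrier G. 1) \<in> Irr G"
proof -
  have rep: "representation G 1 (\<lambda>_. 1\<^sub>m 1)" by (rule representationI) auto
  have "W = {0\<^sub>v 1} \<or> W = carrier_vec 1" if "invariant_subspace G 1 (\<lambda>_. 1\<^sub>m 1) W" for W
  proof (rule disjCI)
    have W: "W \<subseteq> carrier_vec 1" "0\<^sub>v 1 \<in> W" "\<And>c v. v \<in> W \<Longrightarrow> c \<cdot>\<^sub>v v \<in> W"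
      using that unfolding invariant_subspace_def subspace_iff by auto
    assume ne: "W \<noteq> carrier_vec 1"
    have "v = 0\<^sub>v 1" if v: "v \<in> W" for v
    proof (rule ccontr)
      assume v0: "v \<noteq> 0\<^sub>v 1"
      have vc: "v \<in> carrier_vec 1" using v W by auto
      have v00: "v $ 0 \<noteq> 0"
      proof
        assume "v $ 0 = 0" then have "v = 0\<^sub>v 1" using vc by (intro eq_vecI) auto
        with v0 show False by simp
      qed
      have "w \<in> W" if w: "w \<in> carrier_vec 1" for w
      proof -
        have "w = (w $ 0 / v $ 0) \<cdot>\<^sub>v v" using w vc v00 by (intro eq_vecI) auto
        then show ?thesis using W(3)[OF v] by metis
      qed
      then show False using ne W(1) by auto
    qed
    then show "W = {0\<^sub>v 1}" using W(2) by blast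
  qed
  then have "irreducible_rep G 1 (\<lambda>_. 1\<^sub>m 1)" unfolding irreducible_rep_def using rep by auto
  moreover have "character_of G (\<lambda>_. 1\<^sub>m 1) = (\<lambda>x\<in>carrier G. 1)"
    by (auto simp: character_of_def mat_trace_one)
  ultimately show ?thesis unfolding Irr_def by (metis (mono_tags, lifting) mem_Collect_eq)
qed

section \<open>The center and conjugacy classes\<close>

lemma center_normal: "center G \<lhd> G"
proof (rule normal_invI)
  show "subgroup (center G) G"
  proof (rule subgroupI)
    show "center G \<subseteq> carrier G" "center G \<noteq> {}" by (auto simp: center_def)
    fix a b assume a: "a \<in> center G" and b: "b \<in> center G"
    show "inv a \<in> center G"
      unfolding center_def
    proof (intro CollectI conjI ballI)
      have ac: "a \<in> carrier G" using a by (simp add: center_def)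
      then show "inv a \<in> carrier G" by simp
      fix x assume x: "x \<in> carrier G"
      have "inv (inv x \<otimes> a) = inv (a \<otimes> inv x)" using a x by (simp add: center_def)
      then show "inv a \<otimes> x = x \<otimes> inv a" using ac x by (simp add: inv_mult_group)
    qed
    show "a \<otimes> b \<in> center G"
      unfolding center_def
    proof (intro CollectI conjI ballI)
      have ab: "a \<in> carrier G" "b \<in> carrier G" using a b unfolding center_def by blast+
      then show "a \<otimes> b \<in> carrier G" by simp
      fix x assume x: "x \<in> carrier G"
      have ax: "a \<otimes> x = x \<otimes> a" and bx: "b \<otimes> x = x \<otimes> b"
        using a b x unfolding center_def by blast+
      have "a \<otimes> b \<otimes> x = a \<otimes> (x \<otimes> b)" unfolding bx[symmetric] by (rule m_assoc[OF ab x])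
      also have "\<dots> = (x \<otimes> a) \<otimes> b" unfolding ax[symmetric] by (rule m_assoc[OF ab(1) x ab(2), symmetric])
      also have "\<dots> = x \<otimes> (a \<otimes> b)" by (rule m_assoc[OF x ab])
      finally show "a \<otimes> b \<otimes> x = x \<otimes> (a \<otimes> b)" .
    qed
  qed
  show "x \<otimes> h \<otimes> inv x \<in> center G" if "x \<in> carrier G" "h \<in> center G" for x h
  proof -
    have h: "h \<in> carrier G" "h \<otimes> x = x \<otimes> h" using that unfolding center_def by blast+
    have "x \<otimes> h \<otimes> inv x = h \<otimes> (x \<otimes> inv x)"
      unfolding h(2)[symmetric] using that(1) h(1) by (simp only: m_assoc inv_closed)
    also have "\<dots> = h" using that(1) h(1) by simp
    finally show ?thesis using that by simp
  qed
qed

lemma conj_class_subset: "g \<in> carrier G \<Longrightarrow> conj_class G g \<subseteq> carrier G"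
  by (auto simp: conj_class_def)

lemma conj_class_self: "g \<in> carrier G \<Longrightarrow> g \<in> conj_class G g"
  unfolding conj_class_def by (auto intro!: exI[of _ \<one>])

lemma class_function_on_conj_class:
  "class_function f \<Longrightarrow> g \<in> carrier G \<Longrightarrow> x \<in> conj_class G g \<Longrightarrow> f x = f g"
  by (auto simp: conj_class_def class_functionD)

lemma conj_class_conjugate:
  assumes "g \<in> carrier G" "x \<in> conj_class G g" "y \<in> carrier G"
  shows "y \<otimes> x \<otimes> inv y \<in> conj_class G g"
proof -
  obtain u where u: "u \<in> carrier G" "x = inv u \<otimes> g \<otimes> u" using assms(2) by (auto simp: conj_class_def)
  have "y \<otimes> x \<otimes> inv y = inv (u \<otimes> inv y) \<otimes> g \<otimes> (u \<otimes> inv y)"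
    using assms u by (simp add: inv_mult_group m_assoc)
  then show ?thesis unfolding conj_class_def using u assms by blast
qed

lemma conj_class_conjugate_inv:
  assumes "g \<in> carrier G" "x \<in> conj_class G g" "y \<in> carrier G"
  shows "inv y \<otimes> x \<otimes> y \<in> conj_class G g"
  using conj_class_conjugate[OF assms(1,2), of "inv y"] assms(3) by simp

lemma center_conjugate: "z \<in> center G \<Longrightarrow> y \<in> carrier G \<Longrightarrow> inv y \<otimes> z \<otimes> y = z"
proof -
  assume z: "z \<in> center G" and y: "y \<in> carrier G"
  then have zc: "z \<in> carrier G" "z \<otimes> y = y \<otimes> z" by (auto simp: center_def)
  have "inv y \<otimes> z \<otimes> y = inv y \<otimes> (y \<otimes> z)" using zc y by (simp only: m_assoc inv_closed)
  then show ?thesis using zc(1) y by (simp add: inv_mult_cancel_left)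
qed

lemma conj_class_disjoint_center:
  assumes "g \<in> carrier G - center G"
  shows "conj_class G g \<inter> center G = {}"
proof (rule ccontr)
  assume "conj_class G g \<inter> center G \<noteq> {}"
  then obtain u where u: "u \<in> carrier G" "inv u \<otimes> g \<otimes> u \<in> center G" by (auto simp: conj_class_def)
  have "u \<otimes> (inv u \<otimes> g \<otimes> u) \<otimes> inv u = g" using u assms by (simp add: m_assoc mult_inv_cancel_left)
  then have "g \<in> center G"
    using normal.inv_op_closed2[OF center_normal u] by simp
  then show False using assms by simp
qed

lemma centralizer_subgroup:
  assumes g: "g \<in> carrier G"
  shows "subgroup (centralizer G g) G"
proof (rule subgroupI)
  show "centralizer G g \<subseteq> carrier G" "centralizer G g \<noteq> {}"
    using g by (auto simp: centralizer_def)
  fix a b assume a: "a \<in> centralizer G g" and b: "b \<in> centralizer G g"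
  then have ab: "a \<in> carrier G" "b \<in> carrier G" "a \<otimes> g = g \<otimes> a" "b \<otimes> g = g \<otimes> b"
    by (auto simp: centralizer_def)
  have "inv a \<otimes> g = inv a \<otimes> (g \<otimes> a) \<otimes> inv a" using ab(1) g by (simp add: m_assoc)
  also have "\<dots> = inv a \<otimes> (a \<otimes> g) \<otimes> inv a" by (simp only: ab(3))
  also have "\<dots> = g \<otimes> inv a" using ab(1) g by (simp add: inv_mult_cancel_left)
  finally show "inv a \<in> centralizer G g" using ab by (simp add: centralizer_def)
  have "a \<otimes> b \<otimes> g = a \<otimes> (g \<otimes> b)" using ab(1,2,4) g by (simp add: m_assoc)
  also have "\<dots> = (a \<otimes> g) \<otimes> b" using ab(1,2) g by (simp add: m_assoc)
  also have "\<dots> = g \<otimes> (a \<otimes> b)" unfolding ab(3) using ab(1,2) g by (simp add: m_assoc)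
  finally show "a \<otimes> b \<in> centralizer G g" using ab by (simp add: centralizer_def)
qed

text \<open>
  The fibres of \<open>x \<mapsto> inv x \<otimes> g \<otimes> x\<close> are the right cosets of the centralizer.
\<close>

lemma card_conj_class:
  assumes g: "g \<in> carrier G"
  shows "card (conj_class G g) * card (centralizer G g) = card (carrier G)"
proof -
  let ?f = "\<lambda>x. inv x \<otimes> g \<otimes> x"
  have img: "?f ` carrier G = conj_class G g" by (auto simp: conj_class_def)
  have fib: "card {x \<in> carrier G. ?f x = y} = card (centralizer G g)" if y: "y \<in> conj_class G g" for y
  proof -
    obtain u where u: "u \<in> carrier G" "y = ?f u" using y by (auto simp: conj_class_def)
    have "bij_betw (\<lambda>c. c \<otimes> u) (centralizer G g) {x \<in> carrier G. ?f x = y}"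
    proof (rule bij_betw_byWitness[of _ "\<lambda>x. x \<otimes> inv u"])
      show "\<forall>c\<in>centralizer G g. c \<otimes> u \<otimes> inv u = c" using u by (auto simp: centralizer_def m_assoc)
      show "\<forall>x\<in>{x \<in> carrier G. ?f x = y}. x \<otimes> inv u \<otimes> u = x" using u by (auto simp: m_assoc)
      show "(\<lambda>c. c \<otimes> u) ` centralizer G g \<subseteq> {x \<in> carrier G. ?f x = y}"
      proof (rule image_subsetI)
        fix c assume c: "c \<in> centralizer G g"
        have "inv (c \<otimes> u) \<otimes> g \<otimes> (c \<otimes> u) = inv u \<otimes> (inv c \<otimes> (g \<otimes> c)) \<otimes> u"
          using c u g by (simp add: centralizer_def inv_mult_group m_assoc)
        also have "inv c \<otimes> (g \<otimes> c) = inv c \<otimes> (c \<otimes> g)" using c by (simp add: centralizer_def)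
        also have "\<dots> = g" using c g by (intro inv_mult_cancel_left) (simp_all add: centralizer_def)
        finally show "c \<otimes> u \<in> {x \<in> carrier G. ?f x = y}" using c u by (simp add: centralizer_def)
      qed
      show "(\<lambda>x. x \<otimes> inv u) ` {x \<in> carrier G. ?f x = y} \<subseteq> centralizer G g"
      proof (rule image_subsetI)
        fix x assume "x \<in> {x \<in> carrier G. ?f x = y}"
        then have x: "x \<in> carrier G" and eq: "?f x = ?f u" using u by auto
        have "x \<otimes> inv u \<otimes> g = x \<otimes> (?f u) \<otimes> inv u" using x u g by (simp add: m_assoc)
        also have "\<dots> = x \<otimes> (?f x) \<otimes> inv u" by (simp only: eq)
        also have "\<dots> = g \<otimes> (x \<otimes> inv u)" using x u g by (simp add: m_assoc mult_inv_cancel_left)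
        finally show "x \<otimes> inv u \<in> centralizer G g" using x u by (simp add: centralizer_def)
      qed
    qed
    then show ?thesis by (simp add: bij_betw_same_card)
  qed
  have "card (carrier G) = (\<Sum>y\<in>?f ` carrier G. \<Sum>x\<in>{x \<in> carrier G. ?f x = y}. 1)"
    using sum.image_gen[OF fin, of "\<lambda>_. 1::nat" ?f] by simp
  also have "\<dots> = (\<Sum>y\<in>conj_class G g. card (centralizer G g))"
    unfolding img by (intro sum.cong refl) (simp add: fib)
  finally show ?thesis by simp
qed

lemma sum_center_and_class:
  assumes g: "g \<in> carrier G - center G"
    and 0: "\<And>x. x \<in> carrier G - (center G \<union> conj_class G g) \<Longrightarrow> F x = 0"
  shows "(\<Sum>x\<in>carrier G. F x) = (\<Sum>x\<in>center G. F x) + (\<Sum>x\<in>conj_class G g. F x)"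
proof -
  have sub: "center G \<subseteq> carrier G" "conj_class G g \<subseteq> carrier G"
    using g conj_class_subset by (auto simp: center_def)
  have "(\<Sum>x\<in>carrier G. F x) = (\<Sum>x\<in>center G \<union> conj_class G g. F x)"
    using sub 0 by (intro sum.mono_neutral_right) auto
  also have "\<dots> = (\<Sum>x\<in>center G. F x) + (\<Sum>x\<in>conj_class G g. F x)"
    using conj_class_disjoint_center[OF g] finite_subset[OF sub(1) fin] finite_subset[OF sub(2) fin]
    by (intro sum.union_disjoint) auto
  finally show ?thesis .
qed

section \<open>Equivalence of the two conditions\<close>

lemma sum_irreducible_character:
  assumes \<chi>: "\<chi> \<in> Irr G" and "nonlinear G \<chi>"
  shows "(\<Sum>x\<in>carrier G. \<chi> x) = 0"
proof -
  have "\<chi> \<noteq> (\<lambda>x\<in>carrier G. 1)" using assms(2) by (auto simp: nonlinear_def)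
  from row_orthogonality[OF \<chi> trivial_character this] show ?thesis by simp
qed

lemma Irr_inv: "\<psi> \<in> Irr G \<Longrightarrow> x \<in> carrier G \<Longrightarrow> \<psi> (inv x) = cnj (\<psi> x)"
  by (auto elim!: IrrE simp: character_of_inv)

lemma center_pos: "card (center G) > 0"
  using center_def one_closed fin by (auto simp: card_gt_0_iff center_def)

text \<open>
  Both claims come from the vanishing of the sum of \<open>\<chi>\<close> over \<open>G\<close>. If the center were not in the kernel, its
  contribution would be zero and \<open>\<chi> g\<close> would vanish.
\<close>

lemma vanishing_character_value:
  assumes \<chi>: "\<chi> \<in> Irr G" and nl: "nonlinear G \<chi>" and van: "vanishes_off_one_class G \<chi> g"
  shows "center G \<subseteq> char_ker G \<chi>"
    and "of_nat (card (center G)) * \<chi> \<one> + of_nat (card (conj_class G g)) * \<chi> g = 0"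
proof -
  have g: "g \<in> carrier G - center G" "g \<in> carrier G" and g0: "\<chi> g \<noteq> 0"
    and off: "\<And>x. x \<in> carrier G - (center G \<union> conj_class G g) \<Longrightarrow> \<chi> x = 0"
    using van by (auto simp: vanishes_off_one_class_def)
  have fK: "finite (conj_class G g)" using finite_subset[OF conj_class_subset[OF g(2)] fin] .
  have "card (conj_class G g) \<noteq> 0" using conj_class_self[OF g(2)] fK by auto
  have "(\<Sum>x\<in>conj_class G g. \<chi> x) = (\<Sum>x\<in>conj_class G g. \<chi> g)"
    by (intro sum.cong refl class_function_on_conj_class[OF Irr_class_function[OF \<chi>] g(2)])
  then have *: "(\<Sum>x\<in>center G. \<chi> x) + of_nat (card (conj_class G g)) * \<chi> g = 0"
    using sum_irreducible_character[OF \<chi> nl] sum_center_and_class[OF g(1) off] by simp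
  show ker: "center G \<subseteq> char_ker G \<chi>"
  proof (rule ccontr)
    assume "\<not> center G \<subseteq> char_ker G \<chi>"
    then have "(\<Sum>x\<in>center G. \<chi> x) = 0" using sum_over_normal_subgroup[OF \<chi> center_normal] by simp
    then show False using * g0 \<open>card (conj_class G g) \<noteq> 0\<close> by simp
  qed
  show "of_nat (card (center G)) * \<chi> \<one> + of_nat (card (conj_class G g)) * \<chi> g = 0"
    using * ker sum_over_normal_subgroup[OF \<chi> center_normal] by simp
qed

lemma vanishes_imp_others_trivial_or_vanish:
  assumes \<chi>: "\<chi> \<in> Irr G" and nl: "nonlinear G \<chi>" and van: "vanishes_off_one_class G \<chi> g"
  shows "others_trivial_or_vanish G \<chi> g"
proof -
  have g: "g \<in> carrier G - center G" "g \<in> carrier G" and g0: "\<chi> g \<noteq> 0"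
    and off: "\<And>x. x \<in> carrier G - (center G \<union> conj_class G g) \<Longrightarrow> \<chi> x = 0"
    using van by (auto simp: vanishes_off_one_class_def)
  have fK: "finite (conj_class G g)" using finite_subset[OF conj_class_subset[OF g(2)] fin] .
  have K0: "card (conj_class G g) \<noteq> 0" using conj_class_self[OF g(2)] fK by auto
  note val = vanishing_character_value[OF assms]
  have Zsub: "center G \<subseteq> carrier G" by (auto simp: center_def)
  have deg: "\<chi> \<one> \<noteq> 0" using nl by (auto simp: nonlinear_def)
  have "if \<psi> \<in> Irr_quot G (center G) then g \<in> char_ker G \<psi> else \<psi> g = 0" if \<psi>: "\<psi> \<in> Irr G" "\<psi> \<noteq> \<chi>" for \<psi>
  proof -
    have "0 = (\<Sum>x\<in>carrier G. \<chi> x * \<psi> (inv x))" using row_orthogonality[OF \<chi> \<psi>(1)] \<psi>(2) by auto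
    also have "\<dots> = (\<Sum>x\<in>carrier G. \<chi> x * cnj (\<psi> x))" by (intro sum.cong refl) (simp add: Irr_inv[OF \<psi>(1)])
    also have "\<dots> = (\<Sum>x\<in>center G. \<chi> x * cnj (\<psi> x)) + (\<Sum>x\<in>conj_class G g. \<chi> x * cnj (\<psi> x))"
      by (rule sum_center_and_class[OF g(1)]) (simp add: off)
    also have "(\<Sum>x\<in>center G. \<chi> x * cnj (\<psi> x)) = (\<Sum>x\<in>center G. \<chi> \<one> * cnj (\<psi> x))"
      using val(1) by (intro sum.cong refl) (auto simp: char_ker_def)
    also have "\<dots> = \<chi> \<one> * cnj (\<Sum>x\<in>center G. \<psi> x)" by (simp add: sum_distrib_left)
    also have "(\<Sum>x\<in>conj_class G g. \<chi> x * cnj (\<psi> x)) = (\<Sum>x\<in>conj_class G g. \<chi> g * cnj (\<psi> g))"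
      using class_function_on_conj_class[OF Irr_class_function[OF \<chi>] g(2)]
        class_function_on_conj_class[OF Irr_class_function[OF \<psi>(1)] g(2)] by (intro sum.cong refl) simp
    finally have eq: "\<chi> \<one> * cnj (\<Sum>x\<in>center G. \<psi> x) + (of_nat (card (conj_class G g)) * \<chi> g) * cnj (\<psi> g) = 0"
      by (simp add: mult.assoc)
    have eq: "\<chi> \<one> * (cnj (\<Sum>x\<in>center G. \<psi> x) - of_nat (card (center G)) * cnj (\<psi> g)) = 0"
      using eq unfolding eq_neg_iff_add_eq_0[THEN iffD2, OF val(2)[unfolded add.commute[of "of_nat (card (center G)) * \<chi> \<one>"]]]
      by (simp add: algebra_simps)
    show ?thesis
    proof (cases "\<psi> \<in> Irr_quot G (center G)")
      case True
      then have "(\<Sum>x\<in>center G. \<psi> x) = of_nat (card (center G)) * \<psi> \<one>"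
        using sum_over_normal_subgroup[OF \<psi>(1) center_normal] by (simp add: Irr_quot_def)
      then have "of_nat (card (center G)) * (cnj (\<psi> \<one>) - cnj (\<psi> g)) = 0"
        using eq deg by (simp add: algebra_simps)
      then have "\<psi> g = \<psi> \<one>" using center_pos by simp
      then show ?thesis using True g by (simp add: char_ker_def)
    next
      case False
      then have "(\<Sum>x\<in>center G. \<psi> x) = 0"
        using sum_over_normal_subgroup[OF \<psi>(1) center_normal] \<psi>(1) by (simp add: Irr_quot_def)
      then show ?thesis using False eq deg center_pos by simp
    qed
  qed
  then show ?thesis using val(1) g by (simp add: others_trivial_or_vanish_def)
qed

text \<open>
  The class function \<open>\<theta>\<close>, the difference of the normalised indicators of the class of \<open>g\<close> and of the center,
  pairs to zero with every irreducible character other than \<open>\<chi>\<close>. It is therefore a nonzero multiple of the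
  conjugate of \<open>\<chi>\<close>, and \<open>\<chi>\<close> vanishes exactly where \<open>\<theta>\<close> does.
\<close>

lemma others_trivial_or_vanish_imp_vanishes:
  assumes \<chi>: "\<chi> \<in> Irr G" and nl: "nonlinear G \<chi>" and oth: "others_trivial_or_vanish G \<chi> g"
  shows "vanishes_off_one_class G \<chi> g"
proof -
  have g: "g \<in> carrier G - center G" "g \<in> carrier G" using oth by (auto simp: others_trivial_or_vanish_def)
  let ?K = "conj_class G g" and ?Z = "center G" and ?n = "of_nat (card (carrier G)) :: complex"
  have Zsub: "?Z \<subseteq> carrier G" by (auto simp: center_def)
  have Ksub: "?K \<subseteq> carrier G" by (rule conj_class_subset[OF g(2)])
  have fK: "finite ?K" using finite_subset[OF Ksub fin] .
  have K0: "card ?K \<noteq> 0" using conj_class_self[OF g(2)] fK by auto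
  have n0: "?n \<noteq> 0" using fin one_closed by (auto simp: card_eq_0_iff)
  define \<theta> where "\<theta> x = (if x \<in> ?K then ?n / of_nat (card ?K) else 0) - (if x \<in> ?Z then ?n / of_nat (card ?Z) else 0)" for x
  have sum\<theta>: "(\<Sum>x\<in>carrier G. \<theta> x * \<psi> x) = ?n * (\<psi> g - (\<Sum>x\<in>?Z. \<psi> x) / of_nat (card ?Z))"
    if \<psi>: "\<psi> \<in> Irr G" for \<psi>
  proof -
    have "(\<Sum>x\<in>carrier G. \<theta> x * \<psi> x) = (\<Sum>x\<in>?Z. \<theta> x * \<psi> x) + (\<Sum>x\<in>?K. \<theta> x * \<psi> x)"
      by (rule sum_center_and_class[OF g(1)]) (simp add: \<theta>_def)
    also have "(\<Sum>x\<in>?Z. \<theta> x * \<psi> x) = (\<Sum>x\<in>?Z. - (?n / of_nat (card ?Z)) * \<psi> x)"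
      using conj_class_disjoint_center[OF g(1)] by (intro sum.cong refl) (auto simp: \<theta>_def)
    also have "\<dots> = - (?n / of_nat (card ?Z)) * (\<Sum>x\<in>?Z. \<psi> x)" by (simp add: sum_distrib_left)
    also have "(\<Sum>x\<in>?K. \<theta> x * \<psi> x) = (\<Sum>x\<in>?K. ?n / of_nat (card ?K) * \<psi> g)"
      using conj_class_disjoint_center[OF g(1)] class_function_on_conj_class[OF Irr_class_function[OF \<psi>] g(2)]
      by (intro sum.cong refl) (auto simp: \<theta>_def)
    also have "\<dots> = ?n * \<psi> g" using K0 by simp
    finally show ?thesis by (simp add: algebra_simps)
  qed
  \<comment> \<open>The coefficient for which \<open>\<theta> - a \<chi>(inv x)\<close> also pairs to zero with \<open>\<chi>\<close> itself.\<close>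
  define a where "a = (\<Sum>x\<in>carrier G. \<theta> x * \<chi> x) / ?n"
  have conv: "(\<Sum>x\<in>carrier G. \<chi> (inv x) * \<chi> x) = ?n"
  proof -
    have "\<chi> \<one> \<noteq> 0" using nl by (auto simp: nonlinear_def)
    then show ?thesis using irreducible_character_convolution[OF \<chi> one_closed] by (simp add: mult.commute)
  qed
  define f where "f x = \<theta> x - a * \<chi> (inv x)" for x
  have f: "class_function f"
    unfolding class_function_def
  proof (intro ballI)
    fix x y assume x: "x \<in> carrier G" and y: "y \<in> carrier G"
    have 1: "inv y \<otimes> x \<otimes> y \<in> L \<longleftrightarrow> x \<in> L"
      if "\<And>u. u \<in> L \<Longrightarrow> inv y \<otimes> u \<otimes> y \<in> L" "\<And>u. u \<in> L \<Longrightarrow> y \<otimes> u \<otimes> inv y \<in> L" for L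
    proof -
      have "y \<otimes> (inv y \<otimes> x \<otimes> y) \<otimes> inv y = x" using x y by (simp add: m_assoc mult_inv_cancel_left)
      then show ?thesis using that(1)[of x] that(2)[of "inv y \<otimes> x \<otimes> y"] by auto
    qed
    have "inv y \<otimes> x \<otimes> y \<in> ?K \<longleftrightarrow> x \<in> ?K"
      by (rule 1) (use y conj_class_conjugate[OF g(2)] conj_class_conjugate_inv[OF g(2)] in auto)
    moreover have "inv y \<otimes> x \<otimes> y \<in> ?Z \<longleftrightarrow> x \<in> ?Z"
      by (rule 1) (use y normal.inv_op_closed2[OF center_normal] normal.inv_op_closed1[OF center_normal] in auto)
    moreover have "\<chi> (inv (inv y \<otimes> x \<otimes> y)) = \<chi> (inv x)"
      using x y class_functionD[OF Irr_class_function[OF \<chi>], of x y] by (simp add: Irr_inv[OF \<chi>])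
    ultimately show "f (inv y \<otimes> x \<otimes> y) = f x" by (simp add: f_def \<theta>_def)
  qed
  have f0: "\<theta> x = a * \<chi> (inv x)" if x: "x \<in> carrier G" for x
  proof -
    have "f x = 0"
    proof (rule class_function_eq_0[OF f _ x])
      fix \<psi> assume \<psi>: "\<psi> \<in> Irr G"
      have split: "(\<Sum>x\<in>carrier G. f x * \<psi> x) = (\<Sum>x\<in>carrier G. \<theta> x * \<psi> x) - a * (\<Sum>x\<in>carrier G. \<chi> (inv x) * \<psi> x)"
        by (simp add: f_def left_diff_distrib sum_subtractf sum_distrib_left mult.assoc)
      show "(\<Sum>x\<in>carrier G. f x * \<psi> x) = 0"
      proof (cases "\<psi> = \<chi>")
        case True
        then show ?thesis unfolding split using conv n0 by (simp add: a_def)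
      next
        case False
        then have 1: "(\<Sum>x\<in>carrier G. \<chi> (inv x) * \<psi> x) = 0"
          using row_orthogonality[OF \<psi> \<chi>] by (simp add: mult.commute)
        have 2: "if \<psi> \<in> Irr_quot G ?Z then g \<in> char_ker G \<psi> else \<psi> g = 0"
          using oth \<psi> False by (simp add: others_trivial_or_vanish_def)
        have "\<psi> g = (\<Sum>x\<in>?Z. \<psi> x) / of_nat (card ?Z)"
          unfolding sum_over_normal_subgroup[OF \<psi> center_normal] using 2 center_pos \<psi>
          by (auto simp: Irr_quot_def char_ker_def split: if_splits)
        then show ?thesis unfolding split sum\<theta>[OF \<psi>] 1 by simp
      qed
    qed
    then show ?thesis by (simp add: f_def)
  qed
  have "\<theta> \<one> \<noteq> 0"
    using conj_class_disjoint_center[OF g(1)] n0 center_pos subgroup.one_closed[OF normal_imp_subgroup[OF center_normal]]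
    by (auto simp: \<theta>_def)
  then have a0: "a \<noteq> 0" using f0[of \<one>] by auto
  have zero_iff: "\<chi> x = 0 \<longleftrightarrow> \<theta> x = 0" if "x \<in> carrier G" for x
    using f0[OF that] a0 by (simp add: Irr_inv[OF \<chi> that])
  have "\<theta> g \<noteq> 0" using g conj_class_self[OF g(2)] n0 K0 by (simp add: \<theta>_def)
  then show ?thesis
    unfolding vanishes_off_one_class_def using g zero_iff by (auto simp: \<theta>_def)
qed

end

section \<open>Auxiliary facts on prime powers\<close>

lemma nat_eq_prime_power:
  assumes p: "Factorial_Ring.prime (p::nat)" and c: "c > 0"
    and q: "\<And>q. Factorial_Ring.prime q \<Longrightarrow> q dvd c \<Longrightarrow> q = p"
  shows "\<exists>k. c = p ^ k"
proof -
  obtain k n where kn: "\<not> p dvd n" "c = n * p ^ k" using prime_power_canonical[OF p c] by blast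
  have "n = 1"
  proof (rule ccontr)
    assume "n \<noteq> 1"
    then obtain q where "Factorial_Ring.prime q" "q dvd n" using prime_factor_nat by blast
    then show False using q[of q] kn by auto
  qed
  then show ?thesis using kn by auto
qed

lemma nontrivial_root_of_unity_exists:
  assumes "p > 1"
  obtains \<zeta> :: complex where "\<zeta> ^ p = 1" "(\<Sum>i<p. \<zeta> ^ i) = 0"
proof -
  have "card {z::complex. z ^ p = 1} = p" using assms by (intro card_roots_unity_eq) simp
  then have "\<not> {z::complex. z ^ p = 1} \<subseteq> {1}"
    using assms card_mono[of "{1::complex}" "{z. z ^ p = 1}"] by auto
  then obtain \<zeta> :: complex where "\<zeta> ^ p = 1" "\<zeta> \<noteq> 1" by auto
  then show ?thesis using that[of \<zeta>] geometric_sum[of \<zeta> p] by simp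
qed

context group
begin

text \<open>
  The order of \<open>x\<close> divides both exponents.
\<close>

lemma coprime_pow_eq_one:
  assumes x: "x \<in> carrier G" and "x [^] (a::nat) = \<one>" "x [^] (b::nat) = \<one>" "coprime a b"
  shows "x = \<one>"
proof -
  have "ord x dvd 1" using assms pow_eq_id[OF x] by (metis coprime_def)
  then show ?thesis using ord_eq_1[OF x] by simp
qed

lemma pow_conjugate:
  assumes "g \<in> carrier G" "u \<in> carrier G"
  shows "(inv u \<otimes> g \<otimes> u) [^] (n::nat) = inv u \<otimes> g [^] n \<otimes> u"
proof (induction n)
  case 0 then show ?case using assms by simp
next
  case (Suc n)
  have "u \<otimes> (inv u \<otimes> (g \<otimes> u)) = g \<otimes> u" using assms by (simp flip: m_assoc)
  then show ?case using assms Suc by (simp add: m_assoc)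
qed

lemma subgroup_nat_pow_closed: "subgroup H G \<Longrightarrow> x \<in> H \<Longrightarrow> x [^] (n::nat) \<in> H"
  by (induction n) (auto simp: subgroup.one_closed subgroup.m_closed)

lemma pow_card_subgroup_eq_one:
  assumes H: "subgroup H G" and x: "x \<in> H"
  shows "x [^] card H = \<one>"
proof -
  interpret H: group "G\<lparr>carrier := H\<rparr>" by (rule subgroup.subgroup_is_group[OF H group_axioms])
  show ?thesis using H.pow_order_eq_1[of x] x by (simp add: Coset.order_def nat_pow_consistent[symmetric])
qed

lemma sylow_subgroup_of_subgroup:
  assumes H: "subgroup H G" and "finite H" and q: "Factorial_Ring.prime q" and card: "card H = q ^ b * r"
  obtains Q where "subgroup Q G" "Q \<subseteq> H" "card Q = q ^ b"
proof -
  have grp: "group (G\<lparr>carrier := H\<rparr>)" by (rule subgroup.subgroup_is_group[OF H group_axioms])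
  obtain Q where Q: "subgroup Q (G\<lparr>carrier := H\<rparr>)" "card Q = q ^ b"
    using sylow_thm[OF q grp, of b r] assms by (auto simp: Coset.order_def)
  have "subgroup Q G" by (rule incl_subgroup[OF H Q(1)])
  moreover have "Q \<subseteq> H" using subgroup.subset[OF Q(1)] by simp
  ultimately show ?thesis using Q(2) that by blast
qed

end

section \<open>Degree and values of the character\<close>

locale one_class_character = finite_group +
  fixes \<chi> :: "'a \<Rightarrow> complex" and g :: 'a
  assumes irr: "\<chi> \<in> Irr G" and nonlin: "nonlinear G \<chi>" and van: "vanishes_off_one_class G \<chi> g"
begin

abbreviation "Z \<equiv> center G"
abbreviation "K \<equiv> conj_class G g"

definition deg :: nat where "deg = (SOME d. \<chi> \<one> = of_nat d)"

lemma deg: "\<chi> \<one> = of_nat deg" "deg > 1"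
proof -
  obtain d :: nat where d: "\<chi> \<one> = of_nat d" "d > 1" using nonlin by (auto simp: nonlinear_def)
  show *: "\<chi> \<one> = of_nat deg" unfolding deg_def by (rule someI[of _ d]) (rule d)
  show "deg > 1" using * d by simp
qed

lemma g_carrier: "g \<in> carrier G" "g \<notin> Z" and \<chi>_g: "\<chi> g \<noteq> 0"
  using van by (auto simp: vanishes_off_one_class_def)

lemma Z_subgroup: "subgroup Z G" by (rule normal_imp_subgroup[OF center_normal])

lemma Z_carrier: "z \<in> Z \<Longrightarrow> z \<in> carrier G" by (simp add: center_def)

lemma Z_comm: "z \<in> Z \<Longrightarrow> x \<in> carrier G \<Longrightarrow> z \<otimes> x = x \<otimes> z" by (simp add: center_def)

lemma K_carrier: "x \<in> K \<Longrightarrow> x \<in> carrier G" using conj_class_subset[OF g_carrier(1)] by auto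

lemma finite_Z [simp]: "finite Z" using finite_subset[OF _ fin] Z_carrier by blast

lemma Z_nonempty [simp]: "Z \<noteq> {}" using subgroup.one_closed[OF Z_subgroup] by blast

lemma finite_K [simp]: "finite K" using finite_subset[OF conj_class_subset[OF g_carrier(1)] fin] .

lemma K_Z_disjoint: "x \<in> K \<Longrightarrow> x \<notin> Z"
  using conj_class_disjoint_center g_carrier by blast

lemma \<chi>_Z: "z \<in> Z \<Longrightarrow> \<chi> z = of_nat deg"
  using vanishing_character_value(1)[OF irr nonlin van] by (auto simp: char_ker_def deg)

lemma \<chi>_K: "x \<in> K \<Longrightarrow> \<chi> x = \<chi> g"
  by (rule class_function_on_conj_class[OF Irr_class_function[OF irr] g_carrier(1)])

lemma K_iff: "x \<in> K \<longleftrightarrow> x \<in> carrier G \<and> x \<notin> Z \<and> \<chi> x \<noteq> 0"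
  using van K_carrier K_Z_disjoint \<chi>_K \<chi>_g by (auto simp: vanishes_off_one_class_def)

lemma \<chi>_inv: "x \<in> carrier G \<Longrightarrow> \<chi> (inv x) = cnj (\<chi> x)" by (rule Irr_inv[OF irr])

text \<open>
  A representation affording \<open>\<chi>\<close> is trivial on the center.
\<close>

lemma \<chi>_translate:
  assumes "z \<in> Z" "x \<in> carrier G"
  shows "\<chi> (z \<otimes> x) = \<chi> x"
proof -
  obtain n \<rho> where \<rho>: "irreducible_rep G n \<rho>" "representation G n \<rho>" "n > 0" "\<chi> = character_of G \<rho>"
    using irr by (rule IrrE)
  have "\<rho> z = 1\<^sub>m n"
    using rep_trivial_on_normal_subgroup[OF \<rho>(1) center_normal] vanishing_character_value(1)[OF irr nonlin van]
      assms(1) \<rho>(4) by blast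
  then have "\<rho> (z \<otimes> x) = \<rho> x"
    using rep_mult[OF \<rho>(2) Z_carrier[OF assms(1)] assms(2)] rep_carrier[OF \<rho>(2) assms(2)] by simp
  then show ?thesis using assms Z_carrier by (simp add: \<rho>(4) character_of_eq)
qed

lemma Z_mult_notin: "z \<in> Z \<Longrightarrow> x \<in> carrier G \<Longrightarrow> x \<notin> Z \<Longrightarrow> z \<otimes> x \<notin> Z"
  using subgroup.m_closed[OF Z_subgroup, of "inv z" "z \<otimes> x"] subgroup.m_inv_closed[OF Z_subgroup, of z]
    Z_carrier[of z] by (auto simp: inv_mult_cancel_left)

lemma Z_mult_K:
  assumes "z \<in> Z" "x \<in> K" shows "z \<otimes> x \<in> K"
  using assms K_carrier[OF assms(2)] Z_carrier[OF assms(1)] Z_mult_notin[OF assms(1)] \<chi>_translate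
  by (simp add: K_iff)

text \<open>
  The class of \<open>g\<close> turns out to be a union of \<open>k\<close> cosets of the center.
\<close>

definition k :: nat where "k = card (conj_class (G Mod Z) (Z #> g))"

lemma coset_conj_class: "conj_class (G Mod Z) (Z #> g) = (\<lambda>x. Z #> x) ` K"
proof -
  interpret Z: normal Z G by (rule center_normal)
  have *: "inv\<^bsub>G Mod Z\<^esub> (Z #> u) \<otimes>\<^bsub>G Mod Z\<^esub> (Z #> g) \<otimes>\<^bsub>G Mod Z\<^esub> (Z #> u) = Z #> (inv u \<otimes> g \<otimes> u)"
    if u: "u \<in> carrier G" for u
  proof -
    have "Z #> u \<in> carrier (G Mod Z)" using u by (auto simp: carrier_FactGroup)
    then have "inv\<^bsub>G Mod Z\<^esub> (Z #> u) = Z #> inv u" using Z.inv_FactGroup Z.rcos_inv[OF u] by simp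
    then show ?thesis using u g_carrier by (simp add: Z.rcos_sum)
  qed
  show ?thesis unfolding conj_class_def carrier_FactGroup using * by (auto simp: image_iff)
qed

lemma card_K: "card K = k * card Z"
proof -
  interpret Z: normal Z G by (rule center_normal)
  have fib: "card {y \<in> K. Z #> y = C} = card Z" if C: "C \<in> (\<lambda>x. Z #> x) ` K" for C
  proof -
    obtain x where x: "x \<in> K" "C = Z #> x" using C by blast
    have "{y \<in> K. Z #> y = C} = Z #> x"
    proof (intro equalityI subsetI)
      fix y assume "y \<in> {y \<in> K. Z #> y = C}"
      then show "y \<in> Z #> x" using rcos_self[OF K_carrier Z_subgroup, of y] x by auto
    next
      fix y assume y: "y \<in> Z #> x"
      then obtain z where z: "z \<in> Z" "y = z \<otimes> x" by (auto simp: r_coset_def)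
      then have "y \<in> K" using Z_mult_K x by simp
      then show "y \<in> {y \<in> K. Z #> y = C}"
        using repr_independence[OF y K_carrier[OF x(1)] Z_subgroup] x(2) by simp
    qed
    moreover have "card Z = card (Z #> x)"
      by (rule card_rcosets_equal) (use K_carrier[OF x(1)] Z_carrier in \<open>auto simp: RCOSETS_def\<close>)
    ultimately show ?thesis by simp
  qed
  have "card K = (\<Sum>C\<in>(\<lambda>x. Z #> x) ` K. \<Sum>y\<in>{y \<in> K. Z #> y = C}. 1)"
    using sum.image_gen[OF finite_K, of "\<lambda>_. 1::nat" "\<lambda>x. Z #> x"] by simp
  also have "\<dots> = (\<Sum>C\<in>(\<lambda>x. Z #> x) ` K. card Z)" by (intro sum.cong refl) (simp add: fib)
  finally show ?thesis unfolding k_def coset_conj_class by simp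
qed

lemma card_K_pos: "card K > 0"
  using conj_class_self[OF g_carrier(1)] by (auto simp: card_gt_0_iff)

lemma k_pos: "k > 0" using card_K card_K_pos by (cases k) auto

definition c :: nat where "c = card (centralizer G g)"

lemma card_G: "card (carrier G) = k * card Z * c"
  using card_conj_class[OF g_carrier(1)] card_K by (simp add: c_def)

lemma c_pos: "c > 0"
  using card_G fin one_closed by (cases c) (auto simp: card_eq_0_iff)

text \<open>
  The orbit-stabilizer formula in \<open>G\<close> and in \<open>G/Z\<close>: passing to the quotient divides both the order of the
  group and the size of the class by \<open>|Z|\<close>.
\<close>

lemma card_centralizer_quotient: "card (centralizer (G Mod Z) (Z #> g)) = c"
proof -
  interpret Z: normal Z G by (rule center_normal)
  interpret Q: group "G Mod Z" by (rule Z.factorgroup_is_group)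
  have "finite (carrier (G Mod Z))" by (simp add: carrier_FactGroup)
  then interpret Q: finite_group "G Mod Z" by unfold_locales
  have "Z #> g \<in> carrier (G Mod Z)" using g_carrier by (auto simp: carrier_FactGroup)
  then have "k * card (centralizer (G Mod Z) (Z #> g)) = card (carrier (G Mod Z))"
    unfolding k_def by (rule Q.card_conj_class)
  moreover have "card (carrier (G Mod Z)) * card Z = k * card Z * c"
    using lagrange[OF Z_subgroup] card_G by (simp add: FactGroup_def Coset.order_def)
  ultimately have "(k * card Z) * card (centralizer (G Mod Z) (Z #> g)) = (k * card Z) * c"
    by (metis mult.assoc mult.commute)
  then show ?thesis using k_pos center_pos by simp
qed

lemma \<chi>_g_eq: "\<chi> g = - of_nat deg / of_nat k"
proof -
  have "of_nat (card Z) * (of_nat deg + of_nat k * \<chi> g) = (0 :: complex)"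
    using vanishing_character_value(2)[OF irr nonlin van] unfolding card_K deg by (simp add: algebra_simps)
  then have "of_nat deg + of_nat k * \<chi> g = 0" using center_pos by simp
  then show ?thesis using k_pos by (simp add: field_simps eq_neg_iff_add_eq_0)
qed

text \<open>
  The norm equation \<open>|G| = |Z| d\<^sup>2 + |K| (d / k)\<^sup>2\<close>, with \<open>|G| = k |Z| c\<close> and \<open>|K| = k |Z|\<close>
  inserted and denominators cleared.
\<close>

lemma degree_equation: "k ^ 2 * c = deg ^ 2 * (k + 1)"
proof -
  have "of_nat deg * (\<Sum>x\<in>carrier G. \<chi> x * \<chi> (inv x)) = of_nat (card (carrier G)) * of_nat deg"
    using irreducible_character_convolution[OF irr one_closed] by (simp add: deg)
  then have "of_nat (card (carrier G)) = (\<Sum>x\<in>carrier G. \<chi> x * \<chi> (inv x))" using deg(2) by (simp add: mult.commute)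
  also have "\<dots> = (\<Sum>x\<in>Z. \<chi> x * \<chi> (inv x)) + (\<Sum>x\<in>K. \<chi> x * \<chi> (inv x))"
    using g_carrier van by (intro sum_center_and_class) (auto simp: vanishes_off_one_class_def)
  also have "(\<Sum>x\<in>Z. \<chi> x * \<chi> (inv x)) = (\<Sum>x\<in>Z. of_nat deg ^ 2)"
    using \<chi>_Z \<chi>_inv Z_carrier by (intro sum.cong refl) (simp add: power2_eq_square)
  also have "(\<Sum>x\<in>K. \<chi> x * \<chi> (inv x)) = (\<Sum>x\<in>K. (of_nat deg / of_nat k) ^ 2)"
    using \<chi>_K \<chi>_inv K_carrier by (intro sum.cong refl) (simp add: power2_eq_square \<chi>_g_eq)
  finally have "of_nat (k * card Z * c) = of_nat (card Z) * of_nat deg ^ 2 + of_nat (k * card Z) * (of_nat deg / of_nat k :: complex) ^ 2"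
    by (simp add: card_G card_K)
  then have "of_nat (card Z) * (of_nat (k * c)) = of_nat (card Z) * (of_nat deg ^ 2 + of_nat k * (of_nat deg / of_nat k :: complex) ^ 2)"
    by (simp add: algebra_simps)
  then have "of_nat (k * c) = of_nat deg ^ 2 + of_nat k * (of_nat deg / of_nat k :: complex) ^ 2"
    using center_pos by simp
  then have "of_nat (k ^ 2 * c) = (of_nat (deg ^ 2 * (k + 1)) :: complex)"
    using k_pos by (simp add: field_simps power2_eq_square)
  then show ?thesis by (simp only: of_nat_eq_iff)
qed

text \<open>
  The absolute value of \<open>\<chi> g\<close>; the division is exact.
\<close>

definition m :: nat where "m = deg div k"

lemma deg_eq: "deg = k * m"
proof -
  have "coprime (k ^ 2) (k + 1)" by simp
  moreover have "k ^ 2 dvd deg ^ 2 * (k + 1)" using degree_equation by (metis dvd_triv_left)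
  ultimately have "k ^ 2 dvd deg ^ 2" using coprime_dvd_mult_left_iff by blast
  then have "k dvd deg" by simp
  then show ?thesis by (simp add: m_def)
qed

lemma m_pos: "m > 0" using deg_eq deg(2) by (cases m) auto

lemma \<chi>_g_m: "\<chi> g = - of_nat m"
  using \<chi>_g_eq k_pos by (simp add: deg_eq)

lemma c_eq: "c = m ^ 2 * (k + 1)"
proof -
  have "k ^ 2 * c = k ^ 2 * (m ^ 2 * (k + 1))" using degree_equation by (simp add: deg_eq power_mult_distrib algebra_simps)
  then show ?thesis using k_pos by simp
qed

text \<open>
  The value of \<open>\<chi>\<close> on \<open>K\<close> is negative and thus different from the degree.
\<close>

lemma Z_eq_char_ker: "Z = char_ker G \<chi>"
proof
  show "Z \<subseteq> char_ker G \<chi>" by (rule vanishing_character_value(1)[OF irr nonlin van])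
  show "char_ker G \<chi> \<subseteq> Z"
  proof
    fix x assume "x \<in> char_ker G \<chi>"
    then have x: "x \<in> carrier G" "\<chi> x = of_nat deg" by (auto simp: char_ker_def deg)
    show "x \<in> Z"
    proof (rule ccontr)
      assume "x \<notin> Z"
      then have "x \<in> K" using x deg(2) by (simp add: K_iff)
      then have "of_nat deg = (- of_nat m :: complex)" using \<chi>_K \<chi>_g_m x(2) by simp
      then have "of_nat (deg + m) = (0 :: complex)" by simp
      then show False using deg(2) by (simp only: of_nat_eq_0_iff)
    qed
  qed
qed

text \<open>
  A linear character does not vanish at \<open>g\<close>, so the second condition makes it trivial on \<open>Z\<close> and at \<open>g\<close>.
\<close>

lemma Z_less_derived: "Z \<subset> derived G (carrier G)"
proof -
  note oth = vanishes_imp_others_trivial_or_vanish[OF irr nonlin van]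
  have "x \<in> derived G (carrier G)" if x: "x \<in> Z \<or> x = g" for x
  proof (rule derived_subgroup_separation)
    show "x \<in> carrier G" using x Z_carrier g_carrier by auto
    fix \<psi> assume \<psi>: "\<psi> \<in> Irr G" "\<psi> \<one> = 1" and nz: "\<And>y. y \<in> carrier G \<Longrightarrow> \<psi> y \<noteq> 0"
    have "\<psi> \<noteq> \<chi>" using \<psi>(2) deg by auto
    then have *: "if \<psi> \<in> Irr_quot G Z then g \<in> char_ker G \<psi> else \<psi> g = 0"
      using oth \<psi>(1) by (simp add: others_trivial_or_vanish_def)
    then have "\<psi> \<in> Irr_quot G Z" using nz[OF g_carrier(1)] by (auto split: if_splits)
    then show "\<psi> x = 1" using * x \<psi>(2) by (auto simp: Irr_quot_def char_ker_def)
  qed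
  then show ?thesis using g_carrier by blast
qed

section \<open>The minimal normal subgroup\<close>

abbreviation "M \<equiv> Z \<union> K"

lemma M_carrier: "x \<in> M \<Longrightarrow> x \<in> carrier G" using Z_carrier K_carrier by blast

lemma \<chi>_off_M: "x \<in> carrier G \<Longrightarrow> x \<notin> M \<Longrightarrow> \<chi> x = 0" using K_iff by blast

lemma M_inv: "x \<in> M \<Longrightarrow> inv x \<in> M"
proof -
  assume x: "x \<in> M"
  have "\<chi> x \<noteq> 0" using x \<chi>_Z \<chi>_K \<chi>_g deg(2) by auto
  then have "\<chi> (inv x) \<noteq> 0" using \<chi>_inv M_carrier[OF x] by simp
  then show ?thesis using \<chi>_off_M M_carrier[OF x] by blast
qed

text \<open>
  The convolution of \<open>\<chi>\<close> with itself is a multiple of \<open>\<chi>\<close> and vanishes at any \<open>y \<notin> M\<close>. A term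
  \<open>\<chi> x * \<chi> (inv x \<otimes> y)\<close> with \<open>x \<in> Z\<close> or \<open>inv x \<otimes> y \<in> Z\<close> is zero, since one factor is then a translate of a
  value outside \<open>M\<close>; the remaining terms are \<open>m\<^sup>2\<close> each and cannot cancel. A factorisation of \<open>y\<close> into two
  elements of \<open>K\<close> would give such a term.
\<close>

lemma K_mult_K:
  assumes a: "a \<in> K" and b: "b \<in> K"
  shows "a \<otimes> b \<in> M"
proof (rule ccontr)
  assume ab: "a \<otimes> b \<notin> M"
  let ?y = "a \<otimes> b"
  have y: "?y \<in> carrier G" using a b K_carrier by simp
  have summand: "\<chi> x * \<chi> (inv x \<otimes> ?y) = (if x \<in> K \<and> inv x \<otimes> ?y \<in> K then of_nat (m ^ 2) else 0)"
    if x: "x \<in> carrier G" for x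
  proof -
    have ixy: "inv x \<otimes> ?y \<in> carrier G" using x y by simp
    consider "x \<notin> M" | "x \<in> Z" | "x \<in> K" by blast
    then show ?thesis
    proof cases
      case 1 then show ?thesis using \<chi>_off_M[OF x] by simp
    next
      case 2
      then have "\<chi> (inv x \<otimes> ?y) = \<chi> ?y"
        using \<chi>_translate[OF subgroup.m_inv_closed[OF Z_subgroup] y] by simp
      then show ?thesis using 2 \<chi>_off_M[OF y ab] K_Z_disjoint by auto
    next
      case 3
      have "inv x \<otimes> ?y \<notin> Z"
      proof
        assume z: "inv x \<otimes> ?y \<in> Z"
        have "?y = x \<otimes> (inv x \<otimes> ?y)" using x y by (simp add: mult_inv_cancel_left)
        also have "\<dots> = (inv x \<otimes> ?y) \<otimes> x" using Z_comm[OF z x] by simp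
        finally have "?y \<in> K" using Z_mult_K[OF z 3] by simp
        then show False using ab by simp
      qed
      then show ?thesis using 3 \<chi>_off_M[OF ixy] \<chi>_K by (auto simp: \<chi>_g_m power2_eq_square)
    qed
  qed
  have "of_nat deg * (\<Sum>x\<in>carrier G. \<chi> x * \<chi> (inv x \<otimes> ?y)) = of_nat (card (carrier G)) * \<chi> ?y"
    using irreducible_character_convolution[OF irr y] by (simp add: deg)
  then have "(\<Sum>x\<in>carrier G. \<chi> x * \<chi> (inv x \<otimes> ?y)) = 0" using \<chi>_off_M[OF y ab] deg(2) by simp
  then have "of_nat (\<Sum>x\<in>carrier G. if x \<in> K \<and> inv x \<otimes> ?y \<in> K then m ^ 2 else 0) = (0 :: complex)"
    unfolding of_nat_sum by (simp add: summand if_distrib cong: if_cong sum.cong)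
  then have "(\<Sum>x\<in>carrier G. if x \<in> K \<and> inv x \<otimes> ?y \<in> K then m ^ 2 else 0) = 0" by (simp only: of_nat_eq_0_iff)
  then have "(if a \<in> K \<and> inv a \<otimes> ?y \<in> K then m ^ 2 else 0) = 0"
    using K_carrier[OF a] fin by (subst (asm) sum_eq_0_iff) blast+
  moreover have "inv a \<otimes> ?y = b" using a b K_carrier by (simp add: inv_mult_cancel_left)
  ultimately show False using a b m_pos by simp
qed

lemma M_subgroup: "subgroup M G"
proof (rule subgroupI)
  show "M \<subseteq> carrier G" using M_carrier by blast
  show "M \<noteq> {}" using conj_class_self[OF g_carrier(1)] by blast
  show "inv a \<in> M" if "a \<in> M" for a using M_inv that .
  show "a \<otimes> b \<in> M" if a: "a \<in> M" and b: "b \<in> M" for a b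
  proof -
    have "a \<otimes> b \<in> M" if "a \<in> Z" using that b Z_mult_K subgroup.m_closed[OF Z_subgroup] by blast
    moreover have "a \<otimes> b \<in> M" if "a \<in> K" "b \<in> Z"
      using that Z_mult_K[OF that(2,1)] Z_comm[OF that(2) K_carrier[OF that(1)]] by simp
    ultimately show ?thesis using a b K_mult_K by blast
  qed
qed

lemma M_normal: "M \<lhd> G"
proof (rule normal_invI[OF M_subgroup])
  fix x h assume "x \<in> carrier G" "h \<in> M"
  then show "x \<otimes> h \<otimes> inv x \<in> M"
    using conj_class_conjugate[OF g_carrier(1)] normal.inv_op_closed2[OF center_normal] by blast
qed

text \<open>
  As \<open>N\<close> is not in the kernel, \<open>\<chi>\<close> sums to zero over \<open>N\<close>. The part of \<open>N\<close> in the center contributes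
  a positive amount, so \<open>N\<close> contains an element of \<open>K\<close>.
\<close>

lemma M_subset_normal:
  assumes N: "N \<lhd> G" and ZN: "Z \<subset> N"
  shows "M \<subseteq> N"
proof -
  interpret N: normal N G by fact
  have fN: "finite N" by (rule finite_subset[OF N.subset fin])
  have "\<not> N \<subseteq> char_ker G \<chi>" using ZN Z_eq_char_ker by blast
  then have 0: "(\<Sum>x\<in>N. \<chi> x) = 0" using sum_over_normal_subgroup[OF irr N] by simp
  have "N \<inter> K \<noteq> {}"
  proof
    assume NK: "N \<inter> K = {}"
    have "(\<Sum>x\<in>N. \<chi> x) = (\<Sum>x\<in>Z. \<chi> x)"
      using fN ZN NK \<chi>_off_M N.subset by (intro sum.mono_neutral_right) auto
    also have "\<dots> = of_nat (card Z * deg)" by (simp add: \<chi>_Z)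
    finally show False using 0 center_pos deg(2) by (simp only: of_nat_eq_0_iff) simp
  qed
  then obtain u where u: "u \<in> carrier G" "inv u \<otimes> g \<otimes> u \<in> N" by (auto simp: conj_class_def)
  have "u \<otimes> (inv u \<otimes> g \<otimes> u) \<otimes> inv u = g" using u g_carrier by (simp add: m_assoc mult_inv_cancel_left)
  then have gN: "g \<in> N" using N.inv_op_closed2[OF u] by simp
  have "K \<subseteq> N" using N.inv_op_closed1[OF _ gN] by (auto simp: conj_class_def)
  then show ?thesis using ZN by blast
qed

lemma M_quotient_minimal_normal:
  shows "minimal_normal (carrier (G\<lparr>carrier := M\<rparr> Mod Z)) (G Mod Z)"
    and "minimal_normal N (G Mod Z) \<Longrightarrow> N = carrier (G\<lparr>carrier := M\<rparr> Mod Z)"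
proof -
  interpret Z: normal Z G by (rule center_normal)
  let ?M = "carrier (G\<lparr>carrier := M\<rparr> Mod Z)"
  have M: "?M \<lhd> G Mod Z"
    using normality_factorization[OF center_normal _ M_normal] by (simp add: FactGroup_def)
  have M_eq: "?M = (\<lambda>x. Z #> x) ` M"
    by (auto simp: FactGroup_def RCOSETS_def r_coset_def)
  have M_ne: "?M \<noteq> {\<one>\<^bsub>G Mod Z\<^esub>}"
  proof
    assume "?M = {\<one>\<^bsub>G Mod Z\<^esub>}"
    moreover have "Z #> g \<in> ?M" unfolding M_eq using conj_class_self[OF g_carrier(1)] by blast
    ultimately have "Z #> g = Z" by simp
    then show False using rcos_self[OF g_carrier(1) Z_subgroup] g_carrier(2) by simp
  qed
  have sub: "?M \<subseteq> A" if A: "A \<lhd> G Mod Z" "A \<noteq> {\<one>\<^bsub>G Mod Z\<^esub>}" for A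
  proof -
    have sA: "subgroup A (G Mod Z)" by (rule normal_imp_subgroup[OF A(1)])
    have UA: "\<Union>A = {x \<in> carrier G. Z #> x \<in> A}" by (rule Z.factgroup_subgroup_union_char[OF sA])
    have ZA: "Z \<in> A" using subgroup.one_closed[OF sA] by simp
    have "Z \<subseteq> \<Union>A" using ZA by blast
    moreover have "Z \<noteq> \<Union>A"
    proof
      assume eq: "Z = \<Union>A"
      have "C = Z" if C: "C \<in> A" for C
      proof -
        have "C \<in> carrier (G Mod Z)" using C subgroup.subset[OF sA] by blast
        then obtain x where x: "x \<in> carrier G" "C = Z #> x" by (auto simp: carrier_FactGroup)
        then have "x \<in> Z" using C UA eq by blast
        then show ?thesis using x coset_join2[OF x(1) Z_subgroup] by simp
      qed
      then have "A = {Z}" using ZA by blast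
      then show False using A(2) by simp
    qed
    ultimately have "M \<subseteq> \<Union>A"
      using M_subset_normal[OF Z.factgroup_subgroup_union_normal[OF A(1)]] by blast
    then show ?thesis unfolding M_eq UA by blast
  qed
  show 1: "minimal_normal ?M (G Mod Z)"
    unfolding minimal_normal_def using M M_ne sub by blast
  show "N = ?M" if N: "minimal_normal N (G Mod Z)"
    using N M M_ne sub[of N] unfolding minimal_normal_def by blast
qed

section \<open>The centralizer has prime power order\<close>

text \<open>
  If \<open>r\<close> is the order of \<open>gZ\<close> and \<open>p\<close> a prime divisor of \<open>r\<close>, then \<open>g\<^bsup>r/p\<^esup>\<close> lies in \<open>M\<close> but not in \<open>Z\<close>, so it is
  conjugate to \<open>g\<close>, and all of \<open>K\<close> has order \<open>p\<close> modulo \<open>Z\<close>. For \<open>z \<in> Z\<close> the elements \<open>z \<otimes> g\<close> and \<open>g\<close> are conjugate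
  with the central \<open>p\<close>-th power \<open>g\<^sup>p\<close>, which gives \<open>z\<^sup>p = \<one>\<close>.
\<close>

lemma exists_prime_exponent:
  obtains p :: nat where "Factorial_Ring.prime p"
    "\<And>x. x \<in> M \<Longrightarrow> x [^] p \<in> Z" "\<And>z. z \<in> Z \<Longrightarrow> z [^] p = \<one>"
proof -
  interpret Z: normal Z G by (rule center_normal)
  have ex: "\<exists>n::nat. n > 0 \<and> g [^] n \<in> Z"
    using pow_order_eq_1[OF g_carrier(1)] subgroup.one_closed[OF Z_subgroup] fin one_closed
    by (intro exI[of _ "Coset.order G"]) (auto simp: Coset.order_def card_gt_0_iff)
  define r where "r = (LEAST n::nat. n > 0 \<and> g [^] n \<in> Z)"
  have r: "r > 0" "g [^] r \<in> Z" using LeastI_ex[OF ex] by (auto simp: r_def)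
  have "r \<noteq> 1" using r(2) g_carrier by auto
  then obtain p where p: "Factorial_Ring.prime p" "p dvd r" using prime_factor_nat by blast
  obtain s where s: "r = p * s" using p(2) by blast
  have "s > 0" "s < r" using s r(1) prime_gt_1_nat[OF p(1)] by auto
  let ?h = "g [^] s"
  have h: "?h \<in> M" "?h \<notin> Z"
    using subgroup_nat_pow_closed[OF M_subgroup, of g s] conj_class_self[OF g_carrier(1)]
      not_less_Least[of s "\<lambda>n. n > 0 \<and> g [^] n \<in> Z"] \<open>s > 0\<close> \<open>s < r\<close> by (auto simp: r_def)
  have hp: "?h [^] p \<in> Z" using r(2) g_carrier by (simp add: nat_pow_pow s mult.commute)
  have hK: "?h \<in> K" using h by blast
  obtain u where u: "u \<in> carrier G" "?h = inv u \<otimes> g \<otimes> u" using hK by (auto simp: conj_class_def)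
  have gp: "g [^] p \<in> Z"
  proof -
    have "?h [^] p = inv u \<otimes> g [^] p \<otimes> u" unfolding u(2) by (rule pow_conjugate[OF g_carrier(1) u(1)])
    then have "u \<otimes> ?h [^] p \<otimes> inv u = g [^] p" using u g_carrier by (simp add: m_assoc mult_inv_cancel_left)
    then show ?thesis using Z.inv_op_closed2[OF u(1) hp] by simp
  qed
  have Kp: "x [^] p = g [^] p" if x: "x \<in> K" for x
  proof -
    obtain v where v: "v \<in> carrier G" "x = inv v \<otimes> g \<otimes> v" using x by (auto simp: conj_class_def)
    have "x [^] p = inv v \<otimes> g [^] p \<otimes> v" unfolding v(2) by (rule pow_conjugate[OF g_carrier(1) v(1)])
    then show ?thesis using center_conjugate[OF gp v(1)] by simp
  qed
  have Zp: "z [^] p = \<one>" if z: "z \<in> Z" for z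
  proof -
    have "(z \<otimes> g) [^] p = g [^] p" using Kp Z_mult_K[OF z conj_class_self[OF g_carrier(1)]] by simp
    moreover have "(z \<otimes> g) [^] p = z [^] p \<otimes> g [^] p"
      by (rule pow_mult_distrib[OF Z_comm[OF z g_carrier(1)] Z_carrier[OF z] g_carrier(1)])
    ultimately show ?thesis using Z_carrier[OF z] g_carrier by simp
  qed
  have "x [^] p \<in> Z" if "x \<in> M" for x
    using that Kp[of x] gp subgroup_nat_pow_closed[OF Z_subgroup, of x p] by auto
  from that[OF p(1) this Zp] show ?thesis .
qed

text \<open>
  Since \<open>\<chi>\<close> vanishes on \<open>Q - {\<one>}\<close>, the trivial character of \<open>Q\<close> has multiplicity \<open>deg / |Q|\<close>. Modulo the
  kernel of the representation, \<open>g\<close> and \<open>Q\<close> generate a group of order \<open>p |Q|\<close> in which \<open>\<chi>\<close> vanishes outside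
  the powers of \<open>g\<close>. A character that is trivial on \<open>Q\<close> and nontrivial on \<open>g\<close> then has multiplicity
  \<open>(deg + m) / (p |Q|)\<close>. The trivial character on \<open>g\<close> would only bound \<open>(p - 1) m\<close>.
\<close>

lemma prime_to_p_part_dvd_m:
  assumes p: "Factorial_Ring.prime (p :: nat)" and gp: "g [^] p \<in> Z"
    and Q: "subgroup Q G" "Q \<subseteq> centralizer G g" "Q \<inter> M = {\<one>}"
  shows "card Q dvd m"
proof -
  obtain n \<rho> where \<rho>: "irreducible_rep G n \<rho>" "representation G n \<rho>" "n > 0" "\<chi> = character_of G \<rho>"
    using irr by (rule IrrE)
  note c = rep_carrier[OF \<rho>(2)]
  interpret Q: subgroup Q G by fact
  have fQ: "finite Q" by (rule finite_subset[OF Q.subset fin])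
  have Q0: "Q \<noteq> {}" "card Q > 0" unfolding card_gt_0_iff using Q.one_closed fQ by blast+
  have tr: "mat_trace (\<rho> x) = \<chi> x" if "x \<in> carrier G" for x using that by (simp add: \<rho>(4) character_of_eq)
  have Qc: "y \<in> carrier G" "y \<otimes> g = g \<otimes> y" if "y \<in> Q" for y using that Q(2) by (auto simp: centralizer_def)
  have Qbij: "bij_betw (\<lambda>x. y \<otimes> x) Q Q" if "y \<in> Q" for y
    by (rule bij_betw_byWitness[of _ "\<lambda>x. inv y \<otimes> x"])
       (use that Qc in \<open>auto simp: inv_mult_cancel_left mult_inv_cancel_left\<close>)
  have \<rho>Z: "\<rho> z = 1\<^sub>m n" if "z \<in> Z" for z
    using rep_trivial_on_normal_subgroup[OF \<rho>(1) center_normal] vanishing_character_value(1)[OF irr nonlin van] that \<rho>(4)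
    by blast
  have p1: "p > 1" by (rule prime_gt_1_nat[OF p])
  have \<rho>mod: "\<rho> (g [^] i) = \<rho> (g [^] (i mod p))" for i
  proof -
    have "g [^] i = g [^] (i mod p) \<otimes> (g [^] p) [^] (i div p)"
      using g_carrier by (simp add: nat_pow_pow nat_pow_mult)
    moreover have "(g [^] p) [^] (i div p) \<in> Z" by (rule subgroup_nat_pow_closed[OF Z_subgroup gp])
    ultimately show ?thesis
      using rep_mult[OF \<rho>(2), of "g [^] (i mod p)" "(g [^] p) [^] (i div p)"] \<rho>Z g_carrier c[of "g [^] (i mod p)"] by simp
  qed
  have "card Q dvd deg"
  proof -
    obtain m' where m': "(\<Sum>y\<in>Q. mat_trace (\<rho> y)) = of_nat (card Q * m')"
      by (rule card_dvd_trace_sum[OF fQ Q0(1), of \<rho> n "\<lambda>y x. y \<otimes> x"])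
         (use c Qc Qbij rep_mult[OF \<rho>(2)] in auto)
    have "(\<Sum>y\<in>Q. mat_trace (\<rho> y)) = (\<Sum>y\<in>Q. if y = \<one> then of_nat deg else 0)"
    proof (rule sum.cong[OF refl])
      fix y assume y: "y \<in> Q"
      have "y \<notin> M" if "y \<noteq> \<one>" using Q(3) y that by blast
      then show "mat_trace (\<rho> y) = (if y = \<one> then of_nat deg else 0)"
        using \<chi>_off_M[OF Qc(1)[OF y]] by (simp add: tr[OF Qc(1)[OF y]] deg)
    qed
    also have "\<dots> = of_nat deg" using fQ by simp
    finally have "deg = card Q * m'" unfolding m' by (simp only: of_nat_eq_iff)
    then show ?thesis by simp
  qed
  moreover have "card Q dvd deg + m"
  proof -
    obtain \<zeta> :: complex where \<zeta>: "\<zeta> ^ p = 1" "(\<Sum>i<p. \<zeta> ^ i) = 0"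
      using nontrivial_root_of_unity_exists[OF p1] by blast
    have \<zeta>mod: "\<zeta> ^ (i mod p) = \<zeta> ^ i" for i
    proof -
      have "\<zeta> ^ i = \<zeta> ^ (i mod p + p * (i div p))" by simp
      also have "\<dots> = \<zeta> ^ (i mod p)" unfolding power_add power_mult \<zeta> by simp
      finally show ?thesis by simp
    qed
    \<comment> \<open>The pair \<open>(i, y)\<close> stands for \<open>g\<^sup>i y\<close>; exponents count modulo \<open>p\<close>, as \<open>g\<^sup>p\<close> acts trivially.\<close>
    let ?S = "{..<p} \<times> Q"
    define F where "F = (\<lambda>(i, y). \<zeta> ^ i \<cdot>\<^sub>m \<rho> (g [^] i \<otimes> y))"
    define \<tau> where "\<tau> = (\<lambda>(i, y) (j, y'). ((i + j) mod p, y \<otimes> y'))"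
    have S: "finite ?S" "?S \<noteq> {}" using fQ Q0 p1 by auto
    have cF: "F s \<in> carrier_mat n n" if "s \<in> ?S" for s
      using that c Qc g_carrier by (auto simp: F_def split: prod.splits)
    have bij: "bij_betw (\<tau> s) ?S ?S" if s: "s \<in> ?S" for s
    proof -
      obtain i y where iy: "s = (i, y)" "i < p" "y \<in> Q" using s by auto
      have maps: "\<tau> s ` ?S \<subseteq> ?S" using iy p1 by (auto simp: \<tau>_def)
      have "inj_on (\<tau> s) ?S"
      proof (rule inj_onI)
        fix a b assume a: "a \<in> ?S" and b: "b \<in> ?S" and eq: "\<tau> s a = \<tau> s b"
        obtain j y1 where a': "a = (j, y1)" "j < p" "y1 \<in> Q" using a by auto
        obtain j' y2 where b': "b = (j', y2)" "j' < p" "y2 \<in> Q" using b by auto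
        have 1: "(i + j) mod p = (i + j') mod p" and 2: "y \<otimes> y1 = y \<otimes> y2"
          using eq by (auto simp: iy a' b' \<tau>_def)
        have "j mod p = j' mod p" using 1 by (metis cong_def cong_add_lcancel_nat)
        then have "j = j'" using a' b' by simp
        moreover have "y1 = y2" using 2 Qc iy a' b' by simp
        ultimately show "a = b" using a' b' by simp
      qed
      then show ?thesis unfolding bij_betw_def using endo_inj_surj[OF S(1) maps] by blast
    qed
    have mult: "F s * F t = F (\<tau> s t)" if s: "s \<in> ?S" and t: "t \<in> ?S" for s t
    proof -
      obtain i y where iy: "s = (i, y)" "i < p" "y \<in> Q" using s by auto
      obtain j y' where jy: "t = (j, y')" "j < p" "y' \<in> Q" using t by auto
      have cc: "g [^] i \<otimes> y \<in> carrier G" "g [^] j \<otimes> y' \<in> carrier G" using iy jy Qc g_carrier by auto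
      have ygj: "y \<otimes> g [^] j = g [^] j \<otimes> y"
      proof (induction j)
        case 0 then show ?case using Qc iy by simp
      next
        case (Suc j)
        have "y \<otimes> g [^] Suc j = g [^] j \<otimes> (y \<otimes> g)" using Suc Qc(1)[OF iy(3)] g_carrier by (simp flip: m_assoc)
        also have "\<dots> = g [^] Suc j \<otimes> y" using Qc[OF iy(3)] g_carrier by (simp add: m_assoc)
        finally show ?case .
      qed
      have "F s * F t = \<zeta> ^ (i + j) \<cdot>\<^sub>m (\<rho> (g [^] i \<otimes> y) * \<rho> (g [^] j \<otimes> y'))"
        using c[OF cc(1)] c[OF cc(2)]
        by (simp add: iy jy F_def mult_smult_distrib[of _ n n _ n] mult_smult_assoc_mat[of _ n n _ n] power_add) (auto intro!: eq_matI)
      also have "\<rho> (g [^] i \<otimes> y) * \<rho> (g [^] j \<otimes> y') = \<rho> ((g [^] i \<otimes> y) \<otimes> (g [^] j \<otimes> y'))"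
        by (rule rep_mult[OF \<rho>(2) cc, symmetric])
      also have "(g [^] i \<otimes> y) \<otimes> (g [^] j \<otimes> y') = g [^] i \<otimes> (y \<otimes> g [^] j) \<otimes> y'"
        using iy jy Qc g_carrier by (simp add: m_assoc)
      also have "\<dots> = g [^] (i + j) \<otimes> (y \<otimes> y')"
        unfolding ygj using iy jy Qc g_carrier by (simp add: m_assoc flip: nat_pow_mult)
      also have "\<rho> \<dots> = \<rho> (g [^] ((i + j) mod p)) * \<rho> (y \<otimes> y')"
        using iy jy Qc g_carrier by (subst rep_mult[OF \<rho>(2)]) (auto simp: \<rho>mod[of "i + j"])
      also have "\<dots> = \<rho> (g [^] ((i + j) mod p) \<otimes> (y \<otimes> y'))"
        using iy jy Qc g_carrier by (intro rep_mult[OF \<rho>(2), symmetric]) auto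
      finally show ?thesis by (simp add: iy jy F_def \<tau>_def \<zeta>mod)
    qed
    obtain m' where m': "(\<Sum>s\<in>?S. mat_trace (F s)) = of_nat (card ?S * m')"
      by (rule card_dvd_trace_sum[OF S cF bij mult])
    have gi: "g [^] i \<in> K" if i: "i \<in> {..<p} - {0}" for i
    proof -
      have "g [^] i \<in> M" using subgroup_nat_pow_closed[OF M_subgroup] conj_class_self[OF g_carrier(1)] by blast
      moreover have "g [^] i \<notin> Z"
      proof
        assume gZ: "g [^] i \<in> Z"
        have "\<not> p dvd i" using i by (auto dest: dvd_imp_le)
        then have "coprime i p" using p by (metis coprime_commute prime_imp_coprime)
        interpret Z: normal Z G by (rule center_normal)
        interpret GZ: group "G Mod Z" by (rule Z.factorgroup_is_group)
        have car: "Z #> g \<in> carrier (G Mod Z)" using g_carrier by (auto simp: carrier_FactGroup)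
        have "(Z #> g) [^]\<^bsub>G Mod Z\<^esub> i = \<one>\<^bsub>G Mod Z\<^esub>" "(Z #> g) [^]\<^bsub>G Mod Z\<^esub> p = \<one>\<^bsub>G Mod Z\<^esub>"
          using Z.FactGroup_pow[OF g_carrier(1)] coset_join2[OF _ Z_subgroup] gZ gp g_carrier by auto
        then have "Z #> g = \<one>\<^bsub>G Mod Z\<^esub>" using GZ.coprime_pow_eq_one[OF car] \<open>coprime i p\<close> by blast
        then show False using rcos_self[OF g_carrier(1) Z_subgroup] g_carrier(2) by simp
      qed
      ultimately show ?thesis by blast
    qed
    have gM: "g [^] i \<in> M" for i :: nat
      using subgroup_nat_pow_closed[OF M_subgroup] conj_class_self[OF g_carrier(1)] by blast
    have trF: "mat_trace (F (i, y)) = \<zeta> ^ i * \<chi> (g [^] i \<otimes> y)" if "y \<in> Q" for i y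
      using c[of "g [^] i \<otimes> y"] Qc[OF that] g_carrier tr[of "g [^] i \<otimes> y"]
      by (simp add: F_def mat_trace_def flip: sum_distrib_left)
    have inner: "(\<Sum>y\<in>Q. mat_trace (F (i, y))) = \<zeta> ^ i * \<chi> (g [^] i)" for i
    proof -
      have "(\<Sum>y\<in>Q. mat_trace (F (i, y))) = (\<Sum>y\<in>Q. if y = \<one> then \<zeta> ^ i * \<chi> (g [^] i) else 0)"
      proof (rule sum.cong[OF refl])
        fix y assume y: "y \<in> Q"
        have "g [^] i \<otimes> y \<notin> M" if "y \<noteq> \<one>"
        proof
          assume gy: "g [^] i \<otimes> y \<in> M"
          have "inv (g [^] i) \<otimes> (g [^] i \<otimes> y) \<in> M"
            by (rule subgroup.m_closed[OF M_subgroup M_inv[OF gM] gy])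
          then have "y \<in> M" using Qc[OF y] g_carrier by (simp add: inv_mult_cancel_left)
          then show False using Q(3) y that by blast
        qed
        then show "mat_trace (F (i, y)) = (if y = \<one> then \<zeta> ^ i * \<chi> (g [^] i) else 0)"
          using trF[OF y] \<chi>_off_M[of "g [^] i \<otimes> y"] Qc[OF y] g_carrier by auto
      qed
      then show ?thesis using fQ by simp
    qed
    have "(\<Sum>s\<in>?S. mat_trace (F s)) = (\<Sum>i<p. \<Sum>y\<in>Q. mat_trace (F (i, y)))"
      by (simp add: sum.cartesian_product case_prod_unfold)
    also have "\<dots> = (\<Sum>i<p. \<zeta> ^ i * \<chi> (g [^] i))" by (simp add: inner)
    also have "\<dots> = of_nat deg + (\<Sum>i\<in>{..<p} - {0}. \<zeta> ^ i * \<chi> (g [^] i))"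
      using p1 by (subst sum.remove[of _ 0]) (auto simp: deg)
    also have "(\<Sum>i\<in>{..<p} - {0}. \<zeta> ^ i * \<chi> (g [^] i)) = (\<Sum>i\<in>{..<p} - {0}. - of_nat m * \<zeta> ^ i)"
      using gi \<chi>_K by (intro sum.cong refl) (simp add: \<chi>_g_m)
    also have "\<dots> = - of_nat m * (\<Sum>i\<in>{..<p} - {0}. \<zeta> ^ i)" by (simp add: sum_distrib_left)
    also have "(\<Sum>i\<in>{..<p} - {0}. \<zeta> ^ i) = - 1"
      using \<zeta>(2) p1 by (subst (asm) sum.remove[of _ 0]) (auto simp: add_eq_0_iff)
    finally have "of_nat (card ?S * m') = (of_nat (deg + m) :: complex)" unfolding m' by simp
    then have "card ?S * m' = deg + m" by (simp only: of_nat_eq_iff)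
    then have "deg + m = card Q * (p * m')" by (simp add: card_cartesian_product algebra_simps)
    then show ?thesis by simp
  qed
  ultimately show ?thesis using dvd_add_right_iff by blast
qed

text \<open>
  For a prime \<open>q \<noteq> p\<close> the order of a Sylow \<open>q\<close>-subgroup of the centralizer divides \<open>m\<close>, so its square divides
  \<open>c = m\<^sup>2 (k + 1)\<close>; being the full \<open>q\<close>-part of \<open>c\<close>, it is 1.
\<close>

lemma centralizer_prime_power:
  obtains p :: nat where "Factorial_Ring.prime p" "\<exists>j. c = p ^ j" "\<exists>j. card Z = p ^ j"
proof -
  obtain p :: nat where p: "Factorial_Ring.prime p"
    and Mp: "\<And>x. x \<in> M \<Longrightarrow> x [^] p \<in> Z" and Zp: "\<And>z. z \<in> Z \<Longrightarrow> z [^] p = \<one>"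
    using exists_prime_exponent by blast
  have gp: "g [^] p \<in> Z" using Mp conj_class_self[OF g_carrier(1)] by blast
  have "q = p" if q: "Factorial_Ring.prime q" and qc: "q dvd c" for q
  proof (rule ccontr)
    assume qp: "q \<noteq> p"
    obtain b r where br: "\<not> q dvd r" "c = r * q ^ b" using prime_power_canonical[OF q c_pos] by blast
    have "b \<noteq> 0" using br qc by (intro notI) simp
    have C: "finite (centralizer G g)" using finite_subset[OF subgroup.subset[OF centralizer_subgroup[OF g_carrier(1)]] fin] .
    have cc: "card (centralizer G g) = q ^ b * r" using br by (simp add: c_def mult.commute)
    obtain Q where Q: "subgroup Q G" "Q \<subseteq> centralizer G g" "card Q = q ^ b"
      by (rule sylow_subgroup_of_subgroup[OF centralizer_subgroup[OF g_carrier(1)] C q cc])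
    \<comment> \<open>Elements of \<open>M\<close> have order dividing \<open>p\<^sup>2\<close>, as their \<open>p\<close>-th powers lie in \<open>Z\<close>, which has exponent dividing \<open>p\<close>.\<close>
    have "y = \<one>" if y: "y \<in> Q" "y \<in> M" for y
    proof (rule coprime_pow_eq_one)
      show yc: "y \<in> carrier G" by (rule M_carrier[OF y(2)])
      show "y [^] (p * p) = \<one>" using Zp[OF Mp[OF y(2)]] yc by (simp add: nat_pow_pow)
      show "y [^] (q ^ b) = \<one>" using pow_card_subgroup_eq_one[OF Q(1) y(1)] Q(3) by simp
      show "coprime (p * p) (q ^ b)" using primes_coprime[OF p q] qp by simp
    qed
    then have "Q \<inter> M = {\<one>}" using subgroup.one_closed[OF Q(1)] subgroup.one_closed[OF M_subgroup] by blast
    then have "q ^ b dvd m" using prime_to_p_part_dvd_m[OF p gp Q(1,2)] Q(3) by simp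
    then have "(q ^ b) ^ 2 dvd m ^ 2" by simp
    then have "(q ^ b) ^ 2 dvd c" unfolding c_eq by (rule dvd_mult2)
    then have "q ^ b dvd r" using br(2) q by (simp add: power2_eq_square prime_gt_0_nat)
    then show False using br(1) \<open>b \<noteq> 0\<close> by (meson dvd_power dvd_trans neq0_conv)
  qed
  then obtain j where j: "c = p ^ j" using nat_eq_prime_power[OF p c_pos] by blast
  moreover have "card Z dvd c"
  proof -
    interpret C: group "G\<lparr>carrier := centralizer G g\<rparr>"
      by (rule subgroup.subgroup_is_group[OF centralizer_subgroup[OF g_carrier(1)] group_axioms])
    have "Z \<subseteq> centralizer G g" using g_carrier by (auto simp: center_def centralizer_def)
    then have "subgroup Z (G\<lparr>carrier := centralizer G g\<rparr>)"
      by (rule subgroup_incl[OF Z_subgroup centralizer_subgroup[OF g_carrier(1)]])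
    from C.lagrange[OF this] have "card (rcosets\<^bsub>G\<lparr>carrier := centralizer G g\<rparr>\<^esub> Z) * card Z = c"
      by (simp add: Coset.order_def c_def)
    then show ?thesis by (metis dvd_triv_right)
  qed
  ultimately have "\<exists>i\<le>j. card Z = p ^ i" using divides_primepow_nat[OF p, of "card Z" j] by simp
  then show ?thesis using that[OF p] j by blast
qed

end

section \<open>The characterization\<close>

theorem theorem7:
  fixes G :: "('a, 'b) monoid_scheme" (structure)
    and \<chi> :: "'a \<Rightarrow> complex"
  assumes "group G" and "finite (carrier G)"
    and "\<chi> \<in> Irr G" and "nonlinear G \<chi>"
  shows
    "((\<exists>g. vanishes_off_one_class G \<chi> g) \<longleftrightarrow> (\<exists>g. others_trivial_or_vanish G \<chi> g)) \<and>
     (\<forall>g. vanishes_off_one_class G \<chi> g \<or> others_trivial_or_vanish G \<chi> g \<longrightarrow>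
        center G = char_ker G \<chi> \<and> char_ker G \<chi> \<subset> derived G (carrier G) \<and>
        \<chi> g = - of_nat (card (center G)) * \<chi> \<one> / of_nat (card (conj_class G g)) \<and>
        \<chi> g \<in> \<int> \<and>
        card (centralizer G g) = card (centralizer (G Mod center G) (center G #> g)) \<and>
        (\<exists>p::nat. Factorial_Ring.prime p \<and>
             (\<exists>k. card (centralizer G g) = p ^ k) \<and>
             (\<exists>m. card (center G) = p ^ m)) \<and>
        (\<exists>M. subgroup M G \<and> center G \<subseteq> M \<and>
             minimal_normal (carrier (G\<lparr>carrier := M\<rparr> Mod center G)) (G Mod center G) \<and>
             (\<forall>N. minimal_normal N (G Mod center G) \<longrightarrow>
                  N = carrier (G\<lparr>carrier := M\<rparr> Mod center G)) \<and>
             (\<exists>x \<in> carrier G. M - center G = conj_class G x)))"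
proof -
  interpret group G by fact
  interpret finite_group G by unfold_locales fact
  have iff: "vanishes_off_one_class G \<chi> g \<longleftrightarrow> others_trivial_or_vanish G \<chi> g" for g
    using vanishes_imp_others_trivial_or_vanish[OF assms(3,4)]
      others_trivial_or_vanish_imp_vanishes[OF assms(3,4)] by blast
  show ?thesis
  proof (intro conjI allI impI)
    show "(\<exists>g. vanishes_off_one_class G \<chi> g) \<longleftrightarrow> (\<exists>g. others_trivial_or_vanish G \<chi> g)"
      using iff by blast
    fix g assume "vanishes_off_one_class G \<chi> g \<or> others_trivial_or_vanish G \<chi> g"
    then interpret one_class_character G \<chi> g
      using iff assms(3,4) by unfold_locales blast+
    show "center G = char_ker G \<chi>" by (rule Z_eq_char_ker)
    show "char_ker G \<chi> \<subset> derived G (carrier G)" using Z_less_derived Z_eq_char_ker by simp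
    show "\<chi> g = - of_nat (card (center G)) * \<chi> \<one> / of_nat (card (conj_class G g))"
      using center_pos by (simp add: \<chi>_g_eq card_K deg)
    show "\<chi> g \<in> \<int>" by (simp add: \<chi>_g_m)
    show "card (centralizer G g) = card (centralizer (G Mod center G) (center G #> g))"
      using card_centralizer_quotient by (simp add: c_def)
    show "\<exists>p::nat. Factorial_Ring.prime p \<and> (\<exists>k. card (centralizer G g) = p ^ k) \<and> (\<exists>m. card (center G) = p ^ m)"
      using centralizer_prime_power unfolding c_def by metis
    show "\<exists>M. subgroup M G \<and> center G \<subseteq> M \<and>
             minimal_normal (carrier (G\<lparr>carrier := M\<rparr> Mod center G)) (G Mod center G) \<and>
             (\<forall>N. minimal_normal N (G Mod center G) \<longrightarrow>
                  N = carrier (G\<lparr>carrier := M\<rparr> Mod center G)) \<and>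
             (\<exists>x \<in> carrier G. M - center G = conj_class G x)"
    proof (intro exI[of _ "center G \<union> conj_class G g"] conjI allI impI)
      show "subgroup (center G \<union> conj_class G g) G" by (rule M_subgroup)
      show "center G \<subseteq> center G \<union> conj_class G g" by simp
      show "minimal_normal (carrier (G\<lparr>carrier := center G \<union> conj_class G g\<rparr> Mod center G)) (G Mod center G)"
        by (rule M_quotient_minimal_normal(1))
      show "N = carrier (G\<lparr>carrier := center G \<union> conj_class G g\<rparr> Mod center G)"
        if "minimal_normal N (G Mod center G)" for N by (rule M_quotient_minimal_normal(2)[OF that])
      show "\<exists>x\<in>carrier G. center G \<union> conj_class G g - center G = conj_class G x"
        using K_Z_disjoint by (intro bexI[OF _ g_carrier(1)]) auto
    qed
  qed
qed

end
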